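(* Let $X$ be an asymptotic $\ell_1$ space of $D$-bounded distortion not containing (a subspace isomorphic to) $\ell_1$. Then there exist $(w_i)\prec X$, an ordinal $\alpha=\omega^{\beta_0}$ with $\beta_0<\omega_1$, a number $0<\theta<1$, and $(z_i)\prec(w_i)$ such that for every $k\in\mathbb N$ and every $z\in[z_i]_k^\infty$, $$\frac1{4D}\sup_{1\le n\le k}\sup\Big\{\theta^n\sum\|E_iz\|:(E_i)\text{ is }\alpha\cdot n\text{-admissible}\Big\}\le\|z\|\le4D\inf_{1\le n\le k}\sup\Big\{\theta^n\sum\|E_iz\|:(E_i)\text{ is }\alpha\cdot n\text{-admissible}\Big\}.$$ Here, for an interval $E$ of $\mathbb N$ and $z=\sum a_iw_i\in[w_i]$, $Ez$ denotes the restriction with respect to $(w_i)$, i.e. $Ez=\sum_{i\in E}a_iw_i$.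
   Context: Spaces and subspaces are (closed) separable infinite-dimensional Banach spaces; ordinal arithmetic is the usual one. For a basic sequence $(x_i)$, $(y_i)\prec(x_i)$ means that $(y_i)$ is a block basis of $(x_i)$; for $X$ with a given basis, $(w_i)\prec X$ means that $(w_i)$ is a block basis of that basis; $[z_i]_k^\infty$ is the closed linear span of $(z_i)_{i\ge k}$. Supports are w.r.t. the indicated basic sequence, and $x<y$ means $\max\operatorname{supp}x<\min\operatorname{supp}y$. A space $X$ with a basis $(e_i)$ is asymptotic $\ell_1$ (w.r.t. $(e_i)$) if there is $C$ such that for all $n$ and all finitely supported $e_n\le x_1<\dots<x_n$ (i.e. $n\le\min\operatorname{supp}x_1$), $\|\sum_1^nx_i\|\ge(1/C)\sum_1^n\|x_i\|$. For an equivalent norm $|\cdot|$ on $(Y,\|\cdot\|)$, $d(Y,|\cdot|)=\inf_Z\sup\{|x|/|y|:x,y\in Z,\ \|x\|=\|y\|=1\}$, the infimum over all infinite-dimensional subspaces $Z$ of $Y$. $X$ is of $D$-bounded distortion if for all equivalent norms $|\cdot|$ on $X$ and all infinite-dimensional subspaces $Y\subseteq X$, $d(Y,|\cdot|)\le D$. For finite $F,G\subseteq\mathbb N$, $F<G$ means $\max F<\min G$ (or one is empty); $F\ge n$ means $\min F\ge n$. Schreier classes: for sets $\mathcal F,\mathcal G$ of finite subsets of $\mathbb N$, $\mathcal F[\mathcal G]=\{\bigcup_1^nG_i: n\in\mathbb N, G_1<\dots<G_n, G_i\in\mathcal G, (\min G_i)_1^n\in\mathcal F\}$. $\mathcal S_0=\{\{n\}:n\in\mathbb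 N\}\cup\{\emptyset\}$, $\mathcal S_1=\{F:\min F\ge|F|\}\cup\{\emptyset\}$, $\mathcal S_{\alpha+1}=\mathcal S_1[\mathcal S_\alpha]$, and for a limit ordinal $\alpha<\omega_1$ one fixes $\alpha_n\uparrow\alpha$ and sets $\mathcal S_\alpha=\{F:\text{for some }n,\ F\in\mathcal S_{\alpha_n}\text{ and }F\ge n\}$. For $\beta<\omega_1$, a finite sequence of sets (here intervals of $\mathbb N$) $E_1<\dots<E_k$ is $\beta$-admissible if $(\min E_i)_{i=1}^k\in\mathcal S_\beta$. *)

theory Defs
  imports "HOL-Analysis.Analysis"
begin

section \<open>Countable ordinals\<close>

text \<open>The type \<open>omega1\<close> is the set of all ordinals below \<open>\<omega>\<^sub>1\<close>: \<open>cardSuc natLeq\<close> is the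
  successor cardinal of \<open>\<aleph>\<^sub>0\<close>, represented in the library by a well-order of minimal type.\<close>

typedef omega1 = "Field (cardSuc natLeq)"
proof -
  have "infinite (Field (cardSuc natLeq))"
    unfolding cardSuc_finite[OF natLeq_Card_order] Field_natLeq by simp
  then show ?thesis by (metis ex_in_conv finite.emptyI)
qed

lemma omega1_Well_order: "Well_order (cardSuc natLeq)"
  using cardSuc_Card_order[OF natLeq_Card_order] card_order_on_def by blast

instantiation omega1 :: wellorder
begin

definition less_eq_omega1 :: "omega1 \<Rightarrow> omega1 \<Rightarrow> bool" where
  "a \<le> b \<longleftrightarrow> (Rep_omega1 a, Rep_omega1 b) \<in> cardSuc natLeq"

definition less_omega1 :: "omega1 \<Rightarrow> omega1 \<Rightarrow> bool" where
  "(a::omega1) < b \<longleftrightarrow> a \<le> b \<and> a \<noteq> b"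

instance
proof
  have lin: "Linear_order (cardSuc natLeq)" and wf: "wf (cardSuc natLeq - Id)"
    using omega1_Well_order by (auto simp: well_order_on_def)
  have rf: "Refl (cardSuc natLeq)" and tr: "trans (cardSuc natLeq)"
    and as: "antisym (cardSuc natLeq)" and tot: "Total (cardSuc natLeq)"
    using lin by (auto simp: linear_order_on_def partial_order_on_def preorder_on_def)
  fix x y z :: omega1
  show refl: "x \<le> x"
    using rf Rep_omega1[of x] by (auto simp: less_eq_omega1_def refl_on_def)
  show anti: "x = y" if "x \<le> y" "y \<le> x"
    using as that by (metis Rep_omega1_inject antisymD less_eq_omega1_def)
  show "x < y \<longleftrightarrow> x \<le> y \<and> \<not> y \<le> x"
    using as rf Rep_omega1[of x]
    by (metis Rep_omega1_inject antisymD less_eq_omega1_def less_omega1_def refl_onD)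
  show "x \<le> z" if "x \<le> y" "y \<le> z"
    using tr that by (meson less_eq_omega1_def transD)
  show "x \<le> y \<or> y \<le> x"
    using tot rf Rep_omega1[of x] Rep_omega1[of y]
    by (metis less_eq_omega1_def refl_onD total_on_def)
next
  have wf: "wf (cardSuc natLeq - Id)"
    using omega1_Well_order by (auto simp: well_order_on_def)
  fix P :: "omega1 \<Rightarrow> bool" and a :: omega1
  assume step: "\<And>x. (\<And>y. y < x \<Longrightarrow> P y) \<Longrightarrow> P x"
  have "wf {(x, y). x < (y::omega1)}"
    by (rule wf_subset[OF wf_inv_image[OF wf, of Rep_omega1]])
       (auto simp: less_omega1_def less_eq_omega1_def inv_image_def Rep_omega1_inject)
  then show "P a"
    by (induction a rule: wf_induct_rule) (use step in auto)
qed

end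

lemma countable_lessThan_omega1:
  includes cardinal_syntax
  shows "countable {..< (a::omega1)}"
proof -
  have "|underS (cardSuc natLeq) (Rep_omega1 a)| <o cardSuc natLeq"
    by (rule card_of_underS[OF cardSuc_Card_order[OF natLeq_Card_order] Rep_omega1])
  then have "|underS (cardSuc natLeq) (Rep_omega1 a)| \<le>o natLeq"
    using cardSuc_ordLeq_ordLess[OF natLeq_Card_order card_of_Card_order] by blast
  then have "|underS (cardSuc natLeq) (Rep_omega1 a)| \<le>o |UNIV :: nat set|"
    using card_of_nat ordIso_symmetric ordLeq_ordIso_trans by blast
  then have "countable (underS (cardSuc natLeq) (Rep_omega1 a))"
    by (meson card_of_ordLeq countableI)
  moreover have "Rep_omega1 ` {..<a} \<subseteq> underS (cardSuc natLeq) (Rep_omega1 a)"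
    by (auto simp: underS_def less_omega1_def less_eq_omega1_def Rep_omega1_inject)
  ultimately have "countable (Rep_omega1 ` {..<a})"
    using countable_subset by blast
  then show ?thesis
    by (rule countable_image_inj_on) (meson Rep_omega1_inject inj_onI)
qed

lemma uncountable_omega1:
  includes cardinal_syntax
  shows "uncountable (UNIV :: omega1 set)"
proof
  assume "countable (UNIV :: omega1 set)"
  then have "countable (range Rep_omega1)" by simp
  then have "countable (Field (cardSuc natLeq))"
    using type_definition.Rep_range[OF type_definition_omega1] by simp
  then obtain f :: "nat set \<Rightarrow> nat" where "inj_on f (Field (cardSuc natLeq))"
    by (auto simp: countable_def)
  then have "|Field (cardSuc natLeq)| \<le>o |UNIV :: nat set|"
    by (meson card_of_ordLeq subset_UNIV)
  then have "|Field (cardSuc natLeq)| \<le>o natLeq"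
    using card_of_nat ordLeq_ordIso_trans by blast
  then have "cardSuc natLeq \<le>o natLeq"
    using card_of_Field_ordIso[OF cardSuc_Card_order[OF natLeq_Card_order]]
    by (meson ordIso_ordLeq_trans ordIso_symmetric)
  then show False
    using cardSuc_greater[OF natLeq_Card_order] not_ordLess_ordLeq by blast
qed

lemma countable_imp_bounded_omega1:
  assumes "countable (A :: omega1 set)"
  shows "\<exists>b. \<forall>a\<in>A. a < b"
proof (rule ccontr)
  assume "\<not> ?thesis"
  then have "UNIV = (\<Union>a\<in>A. insert a {..<a})"
    by (auto simp: not_less order_le_less)
  moreover have "countable (\<Union>a\<in>A. insert a {..<a})"
    using assms countable_lessThan_omega1 by (intro countable_UN) auto
  ultimately show False using uncountable_omega1 by simp
qed

definition osuc :: "omega1 \<Rightarrow> omega1" where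
  "osuc a = (LEAST b. a < b)"

definition osup :: "omega1 set \<Rightarrow> omega1" where
  "osup A = (LEAST b. \<forall>a\<in>A. a \<le> b)"

lemma osuc_le_iff: "osuc a \<le> b \<longleftrightarrow> a < b"
proof
  obtain c where "a < c" using countable_imp_bounded_omega1[of "{a}"] by auto
  then have "a < osuc a" unfolding osuc_def by (rule LeastI)
  then show "osuc a \<le> b \<Longrightarrow> a < b" by simp
  show "a < b \<Longrightarrow> osuc a \<le> b" unfolding osuc_def by (rule Least_le)
qed

lemma osup_le_iff:
  assumes "countable A"
  shows "osup A \<le> b \<longleftrightarrow> (\<forall>a\<in>A. a \<le> b)"
proof
  obtain c where "\<forall>a\<in>A. a \<le> c"
    using countable_imp_bounded_omega1[OF assms] less_imp_le by blast
  then have "\<forall>a\<in>A. a \<le> osup A" unfolding osup_def by (rule LeastI)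
  then show "osup A \<le> b \<Longrightarrow> \<forall>a\<in>A. a \<le> b" by force
  show "\<forall>a\<in>A. a \<le> b \<Longrightarrow> osup A \<le> b" unfolding osup_def by (rule Least_le)
qed

lemma less_osuc: "a < osuc a"
  using osuc_le_iff by blast

lemma osuc_inject: "osuc a = osuc b \<longleftrightarrow> a = b"
  by (metis less_osuc linorder_neqE osuc_le_iff not_le)

instantiation omega1 :: "{zero, one}"
begin
definition zero_omega1 :: omega1 where "0 = (LEAST a::omega1. True)"
definition one_omega1 :: omega1 where "1 = osuc 0"
instance ..
end

lemma omega1_zero_le: "(0::omega1) \<le> a"
  unfolding zero_omega1_def by (simp add: Least_le)

lemma osuc_neq_zero: "osuc a \<noteq> 0"
  using less_osuc[of a] omega1_zero_le[of a] by auto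

definition is_limit :: "omega1 \<Rightarrow> bool" where
  "is_limit a \<longleftrightarrow> a \<noteq> 0 \<and> (\<forall>b. a \<noteq> osuc b)"

text \<open>Transfinite recursion: value \<open>z\<close> at \<open>0\<close>, step \<open>s\<close> at successors, and \<open>l a f\<close> at a limit \<open>a\<close>,
  where \<open>f\<close> gives the values below \<open>a\<close>.\<close>

definition trec :: "'b \<Rightarrow> ('b \<Rightarrow> 'b) \<Rightarrow> (omega1 \<Rightarrow> (omega1 \<Rightarrow> 'b) \<Rightarrow> 'b) \<Rightarrow> omega1 \<Rightarrow> 'b" where
  "trec z s l = wfrec {(a, b). a < b}
     (\<lambda>f a. if a = 0 then z
            else if \<exists>b. a = osuc b then s (f (THE b. a = osuc b))
            else l a f)"

lemma trec_zero: "trec z s l 0 = z"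
  and trec_osuc: "trec z s l (osuc a) = s (trec z s l a)"
  and trec_limit: "is_limit a \<Longrightarrow> trec z s l a = l a (cut (trec z s l) {(a, b). a < b} a)"
  unfolding trec_def
  by (subst wfrec[OF wf]; simp add: osuc_neq_zero osuc_inject less_osuc cut_apply is_limit_def)+

instantiation omega1 :: "{plus, times}"
begin

definition plus_omega1 :: "omega1 \<Rightarrow> omega1 \<Rightarrow> omega1" where
  "a + b = trec a osuc (\<lambda>c f. osup (f ` {..<c})) b"

definition times_omega1 :: "omega1 \<Rightarrow> omega1 \<Rightarrow> omega1" where
  "a * b = trec 0 (\<lambda>x. x + a) (\<lambda>c f. osup (f ` {..<c})) b"

instance ..
end

definition opow :: "omega1 \<Rightarrow> omega1 \<Rightarrow> omega1" where
  "opow a b = trec 1 (\<lambda>x. x * a) (\<lambda>c f. osup (f ` {..<c})) b"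

lemma trec_osup_limit:
  assumes "is_limit a"
  shows "trec z s (\<lambda>c f. osup (f ` {..<c})) a = osup (trec z s (\<lambda>c f. osup (f ` {..<c})) ` {..<a})"
  by (subst trec_limit[OF assms], rule arg_cong[where f = osup], rule image_cong)
     (simp_all add: cut_apply)

lemma omega1_add:
  fixes a b :: omega1
  shows "a + 0 = a" "a + osuc b = osuc (a + b)"
    "is_limit b \<Longrightarrow> a + b = osup ((+) a ` {..<b})"
  by (simp_all add: plus_omega1_def[abs_def] trec_zero trec_osuc trec_osup_limit)

lemma omega1_mult:
  fixes a b :: omega1
  shows "a * 0 = 0" "a * osuc b = a * b + a"
    "is_limit b \<Longrightarrow> a * b = osup ((*) a ` {..<b})"
  by (simp_all add: times_omega1_def[abs_def] trec_zero trec_osuc trec_osup_limit)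

lemma opow_rec:
  "opow a 0 = 1" "opow a (osuc b) = opow a b * a"
  "is_limit b \<Longrightarrow> opow a b = osup (opow a ` {..<b})"
  by (simp_all add: opow_def[abs_def] trec_zero trec_osuc trec_osup_limit)

primrec ord_of_nat :: "nat \<Rightarrow> omega1" where
  "ord_of_nat 0 = 0"
| "ord_of_nat (Suc n) = osuc (ord_of_nat n)"

definition omega :: omega1 where
  "omega = osup (range ord_of_nat)"


section \<open>Schreier families and admissible sequences\<close>

text \<open>Throughout, the natural numbers of the mathematical text are \<open>{1..}\<close>; in particular sequences are
  functions on \<open>nat\<close> whose value at \<open>0\<close> is irrelevant.\<close>

text \<open>A fixed choice, for every limit \<open>a\<close>, of a sequence \<open>(L a n)\<close>, \<open>n \<ge> 1\<close>, strictly increasing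
  to \<open>a\<close>.\<close>

definition ladder_system :: "(omega1 \<Rightarrow> nat \<Rightarrow> omega1) \<Rightarrow> bool" where
  "ladder_system L \<longleftrightarrow> (\<forall>a. is_limit a \<longrightarrow>
     strict_mono_on {1..} (L a) \<and> (\<forall>n\<ge>1. L a n < a) \<and> (\<forall>b<a. \<exists>n\<ge>1. b < L a n))"

definition successive :: "nat set list \<Rightarrow> bool" where
  "successive Es \<longleftrightarrow> (\<forall>E\<in>set Es. finite E \<and> E \<noteq> {}) \<and> sorted_wrt (\<lambda>E F. Max E < Min F) Es"

definition schreier0 :: "nat set set" where
  "schreier0 = {{n} |n. 1 \<le> n} \<union> {{}}"

definition schreier1 :: "nat set set" where
  "schreier1 = {F. finite F \<and> F \<noteq> {} \<and> 0 \<notin> F \<and> card F \<le> Min F} \<union> {{}}"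

definition family_comp :: "nat set set \<Rightarrow> nat set set \<Rightarrow> nat set set" where
  "family_comp \<F> \<G> = {\<Union> (set Gs) |Gs. successive Gs \<and> set Gs \<subseteq> \<G> \<and> Min ` set Gs \<in> \<F>}"

definition schreier :: "(omega1 \<Rightarrow> nat \<Rightarrow> omega1) \<Rightarrow> omega1 \<Rightarrow> nat set set" where
  "schreier L = trec schreier0 (family_comp schreier1)
     (\<lambda>a S. {F. \<exists>n\<ge>1. F \<in> S (L a n) \<and> (\<forall>i\<in>F. n \<le> i)})"

lemma schreier_zero: "schreier L 0 = schreier0"
  by (simp add: schreier_def trec_zero)

lemma schreier_osuc: "schreier L (osuc a) = family_comp schreier1 (schreier L a)"
  by (simp add: schreier_def trec_osuc)

lemma schreier_limit:
  assumes "ladder_system L" "is_limit a"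
  shows "schreier L a = {F. \<exists>n\<ge>1. F \<in> schreier L (L a n) \<and> (\<forall>i\<in>F. n \<le> i)}"
proof -
  have "L a n < a" if "1 \<le> n" for n
    using assms that by (auto simp: ladder_system_def)
  then show ?thesis
    unfolding schreier_def trec_limit[OF assms(2)] by (auto simp: cut_apply)
qed

text \<open>The successor clause at \<open>0\<close> yields the family \<open>schreier1\<close>, so no separate clause for \<open>1\<close> is needed.\<close>

lemma schreier_one: "schreier L 1 = schreier1"
proof -
  have "family_comp schreier1 schreier0 = schreier1"
  proof (intro equalityI subsetI)
    fix F assume "F \<in> family_comp schreier1 schreier0"
    then obtain Gs where Gs: "successive Gs" "set Gs \<subseteq> schreier0" "Min ` set Gs \<in> schreier1"
      and F: "F = \<Union> (set Gs)"
      by (auto simp: family_comp_def)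
    have "\<exists>n. G = {n}" if "G \<in> set Gs" for G
      using Gs that by (auto simp: successive_def schreier0_def)
    then have "{Min G} = G" if "G \<in> set Gs" for G
      using that by force
    then have "F = Min ` set Gs" unfolding F by force
    then show "F \<in> schreier1" using Gs by simp
  next
    fix F assume F: "F \<in> schreier1"
    then have fin: "finite F" and z: "0 \<notin> F" by (auto simp: schreier1_def)
    define Gs where "Gs = map (\<lambda>i. {i}) (sorted_list_of_set F)"
    have set: "set Gs = (\<lambda>i. {i}) ` F" using fin by (simp add: Gs_def)
    have "successive Gs"
      using strict_sorted_list_of_set[of F]
      by (auto simp: successive_def set) (simp add: Gs_def sorted_wrt_map)
    moreover have "set Gs \<subseteq> schreier0"
      using z by (auto simp: set schreier0_def) (metis One_nat_def Suc_leI gr0I)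
    moreover have "Min ` set Gs = F" by (simp add: set image_image)
    moreover have "F = \<Union> (set Gs)" by (auto simp: set)
    ultimately show "F \<in> family_comp schreier1 schreier0"
      unfolding family_comp_def using F by auto
  qed
  then show ?thesis
    by (simp add: one_omega1_def schreier_osuc schreier_zero)
qed

definition admissible :: "(omega1 \<Rightarrow> nat \<Rightarrow> omega1) \<Rightarrow> omega1 \<Rightarrow> nat set list \<Rightarrow> bool" where
  "admissible L b Es \<longleftrightarrow> successive Es \<and> (\<forall>E\<in>set Es. \<exists>m n. 1 \<le> m \<and> m \<le> n \<and> E = {m..n})
     \<and> Min ` set Es \<in> schreier L b"


section \<open>Bases and block bases\<close>

definition expansion :: "(nat \<Rightarrow> 'a::banach) \<Rightarrow> (nat \<Rightarrow> real) \<Rightarrow> 'a \<Rightarrow> bool" where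
  "expansion e a x \<longleftrightarrow> a 0 = 0 \<and> (\<lambda>n. \<Sum>i=1..n. a i *\<^sub>R e i) \<longlonglongrightarrow> x"

definition schauder_basis :: "(nat \<Rightarrow> 'a::banach) \<Rightarrow> bool" where
  "schauder_basis e \<longleftrightarrow> (\<forall>x. \<exists>!a. expansion e a x)"

definition clspan_from :: "(nat \<Rightarrow> 'a::banach) \<Rightarrow> nat \<Rightarrow> 'a set" where
  "clspan_from e k = closure (span (e ` {k..}))"

text \<open>The coefficients, support and restrictions are meaningful when \<open>e\<close> is a basic sequence and
  \<open>x\<close> lies in its closed linear span, so that the expansion of \<open>x\<close> exists and is unique.\<close>

definition coeffs_wrt :: "(nat \<Rightarrow> 'a::banach) \<Rightarrow> 'a \<Rightarrow> nat \<Rightarrow> real" where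
  "coeffs_wrt e x = (THE a. expansion e a x)"

definition supp_wrt :: "(nat \<Rightarrow> 'a::banach) \<Rightarrow> 'a \<Rightarrow> nat set" where
  "supp_wrt e x = {i. coeffs_wrt e x i \<noteq> 0}"

definition restr_wrt :: "(nat \<Rightarrow> 'a::banach) \<Rightarrow> nat set \<Rightarrow> 'a \<Rightarrow> 'a" where
  "restr_wrt e E x = (\<Sum>i\<in>E. coeffs_wrt e x i *\<^sub>R e i)"

definition block_basis_of :: "(nat \<Rightarrow> 'a::banach) \<Rightarrow> (nat \<Rightarrow> 'a) \<Rightarrow> bool" where
  "block_basis_of y x \<longleftrightarrow> (\<exists>p::nat \<Rightarrow> nat. strict_mono p \<and>
     (\<forall>i\<ge>1. y i \<noteq> 0 \<and> y i \<in> span (x ` {p (i - 1)<..p i})))"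

definition asymptotic_l1 :: "(nat \<Rightarrow> 'a::banach) \<Rightarrow> bool" where
  "asymptotic_l1 e \<longleftrightarrow> (\<exists>C>0. \<forall>n\<ge>1. \<forall>x::nat \<Rightarrow> 'a.
     (\<forall>i\<in>{1..n}. x i \<noteq> 0 \<and> finite (supp_wrt e (x i))) \<longrightarrow>
     n \<le> Min (supp_wrt e (x 1)) \<longrightarrow>
     (\<forall>i\<in>{1..<n}. Max (supp_wrt e (x i)) < Min (supp_wrt e (x (Suc i)))) \<longrightarrow>
     norm (\<Sum>i=1..n. x i) \<ge> (1 / C) * (\<Sum>i=1..n. norm (x i)))"


section \<open>Bounded distortion and containment of \<open>\<ell>\<^sub>1\<close>\<close>

definition infdim_subspace :: "'a::banach set \<Rightarrow> bool" where
  "infdim_subspace Y \<longleftrightarrow> subspace Y \<and> closed Y \<and> \<not> (\<exists>B. finite B \<and> span B = Y)"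

definition equivalent_norm_on :: "'a::banach set \<Rightarrow> ('a \<Rightarrow> real) \<Rightarrow> bool" where
  "equivalent_norm_on Y N \<longleftrightarrow>
     (\<forall>x\<in>Y. \<forall>y\<in>Y. N (x + y) \<le> N x + N y) \<and>
     (\<forall>c. \<forall>x\<in>Y. N (c *\<^sub>R x) = \<bar>c\<bar> * N x) \<and>
     (\<exists>c>0. \<exists>C. \<forall>x\<in>Y. c * norm x \<le> N x \<and> N x \<le> C * norm x)"

text \<open>For an equivalent norm \<open>N\<close> on an infinite-dimensional subspace \<open>Y\<close>, the inner sets are nonempty
  and bounded and all suprema are at least \<open>1\<close>, so the real-valued \<open>Sup\<close> and \<open>Inf\<close> are the genuine ones.\<close>

definition norm_distortion :: "'a::banach set \<Rightarrow> ('a \<Rightarrow> real) \<Rightarrow> real" where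
  "norm_distortion Y N =
     (INF Z\<in>{Z. infdim_subspace Z \<and> Z \<subseteq> Y}.
        Sup {N x / N y |x y. x \<in> Z \<and> y \<in> Z \<and> norm x = 1 \<and> norm y = 1})"

definition bounded_distortion :: "'a::banach set \<Rightarrow> real \<Rightarrow> bool" where
  "bounded_distortion X D \<longleftrightarrow>
     (\<forall>N Y. equivalent_norm_on X N \<longrightarrow> infdim_subspace Y \<longrightarrow> Y \<subseteq> X \<longrightarrow> norm_distortion Y N \<le> D)"

definition ell1 :: "(nat \<Rightarrow> real) set" where
  "ell1 = {a. summable (\<lambda>i. \<bar>a i\<bar>)}"

definition contains_ell1 :: "'a::banach set \<Rightarrow> bool" where
  "contains_ell1 X \<longleftrightarrow> (\<exists>Y T. infdim_subspace Y \<and> Y \<subseteq> X \<and> bij_betw T ell1 Y \<and>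
     (\<forall>a\<in>ell1. \<forall>b\<in>ell1. T (\<lambda>i. a i + b i) = T a + T b) \<and>
     (\<forall>c. \<forall>a\<in>ell1. T (\<lambda>i. c * a i) = c *\<^sub>R T a) \<and>
     (\<exists>c>0. \<exists>C. \<forall>a\<in>ell1. c * (\<Sum>i. \<bar>a i\<bar>) \<le> norm (T a) \<and> norm (T a) \<le> C * (\<Sum>i. \<bar>a i\<bar>)))"

end

(* Attach to a block sequence w and an ordinal b the least constant T with sum |E_i x| <= T |x| for b-admissible
   intervals E_i (along tails of w). It decreases when passing to block sequences, so countably many of these
   constants can be stabilised at once. Since l_1 does not embed, a tree argument bounds the ordinals for which T
   can stay below 3 D; let beta be the least exponent for which the constants of the multiples omega^beta * n
   exceed 3 D on all blocks of some x. Then all of them are finite on a suitable block sequence, and after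
   stabilising them to T_n one has T_(n+m) <= T_n T_m, by comparing the Schreier family of a + b with the
   composition of the families of b and a. Bounded distortion, applied to the equivalent norm given by the
   alpha n-admissible sums, makes that norm lie between A_n and 2 D A_n times the original one on a further block
   sequence, where T_n <= 2 D A_n and A_n T_m <= T_(n+m). Hence A_n and T_n grow like the powers of
   lim T_n^(1/n) = 1/theta up to the factor 2 D. No basis constant enters, because only the T_n and A_n are compared. *)

theory Submission
  imports Defs
begin

section \<open>Arithmetic of countable ordinals\<close>

text \<open>The ladders at different limits are chosen independently, so the family of a + b and the
  composition of the families of b and a can be compared only after their members are spread by a
  fast growing map. Passing to a sparse subsequence does exactly this to the left endpoints of
  intervals. This, and the need to diagonalise over countably many block sequences, is why estimates
  are required only from some index on and why \<open>sub_block\<close> neglects finitely many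
  terms. Powers of \<omega> enter because every ordinal below such a power lies below a finite
  multiple of a smaller one. Minimality of the exponent then gives one common bound for all smaller
  ordinals, and a common bound survives the passage to the limit ordinal. The threshold 3 D has to
  exceed 2 D: as T_n is at most 2 D A_n, a value of T_n above 2 D forces some A_n > 1, and hence
  \<theta> < 1. In 4 D, one factor 2 pays for the distortion constant being only approached and for
  replacing subspaces by block sequences, the other for extending the lower estimate from linear to
  closed spans.\<close>

lemma less_osuc_iff: "a < osuc b \<longleftrightarrow> a \<le> b"
  using osuc_le_iff[of b a] by (simp add: not_le[symmetric])

lemma omega1_not_less_zero: "\<not> a < (0::omega1)"
  using omega1_zero_le[of a] by simp

lemma osuc_less_limit: "is_limit c \<Longrightarrow> b < c \<Longrightarrow> osuc b < c"
  by (metis is_limit_def osuc_le_iff order_le_less)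

lemma is_limit_pos: "is_limit c \<Longrightarrow> 0 < c"
  using omega1_zero_le[of c] by (auto simp: is_limit_def order_le_less)

lemma omega1_cases:
  obtains "a = 0" | b where "a = osuc b" | "is_limit a"
  by (auto simp: is_limit_def)

lemma omega1_induct [case_names zero osuc limit]:
  assumes "P 0" "\<And>b. P b \<Longrightarrow> P (osuc b)" "\<And>c. is_limit c \<Longrightarrow> (\<And>b. b < c \<Longrightarrow> P b) \<Longrightarrow> P c"
  shows "P a"
proof (induction a rule: less_induct)
  case (less a)
  show ?case
    by (cases a rule: omega1_cases) (use assms less less_osuc in auto)
qed

lemma less_osup_iff: "countable A \<Longrightarrow> b < osup A \<longleftrightarrow> (\<exists>a\<in>A. b < a)"
  using osup_le_iff[of A b] by (auto simp: not_le[symmetric])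

lemma countable_image_lessThan_omega1: "countable (f ` {..<(c::omega1)})"
  by (simp add: countable_lessThan_omega1)

text \<open>Continuity of addition in the right argument, phrased by elements so that limit cases
  reduce to an earlier stage.\<close>

lemma less_add_limit_iff: "is_limit c \<Longrightarrow> x < a + c \<longleftrightarrow> (\<exists>b<c. x < a + (b::omega1))"
  by (auto simp: omega1_add(3) less_osup_iff countable_image_lessThan_omega1)

lemma omega1_add_strict_mono: "b < c \<Longrightarrow> a + b < a + (c::omega1)"
proof (induction c rule: omega1_induct)
  case (osuc c)
  then show ?case
    by (auto simp: omega1_add less_osuc_iff order_le_less intro: less_osuc)
next
  case (limit c)
  then have "b < osuc b" "osuc b < c" by (auto simp: less_osuc osuc_less_limit)
  then show ?case using limit less_add_limit_iff[of c "a + b" a] by blast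
qed (simp add: omega1_not_less_zero)

lemma omega1_add_mono: "b \<le> c \<Longrightarrow> a + b \<le> a + (c::omega1)"
  using omega1_add_strict_mono[of b c a] by (auto simp: order_le_less)

lemma is_limit_add: "is_limit c \<Longrightarrow> is_limit (a + c)"
proof -
  assume c: "is_limit c"
  have "osuc x < a + c" if "x < a + c" for x
  proof -
    from that obtain b where b: "b < c" "x < a + b" using less_add_limit_iff[OF c] by blast
    then have "osuc x \<le> a + b" by (simp add: osuc_le_iff)
    also have "\<dots> < a + c" using b(1) by (rule omega1_add_strict_mono)
    finally show ?thesis .
  qed
  moreover have "a + c \<noteq> 0"
    using omega1_add_strict_mono[OF is_limit_pos[OF c], of a] omega1_not_less_zero by auto
  ultimately show ?thesis unfolding is_limit_def using less_osuc by fastforce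
qed

lemma omega1_add_assoc: "(a + b) + c = a + (b + (c::omega1))"
proof (induction c rule: omega1_induct)
  case (limit c)
  have "x < (a + b) + c \<longleftrightarrow> x < a + (b + c)" for x
  proof -
    have "x < (a + b) + c \<longleftrightarrow> (\<exists>d<c. x < a + (b + d))"
      using limit by (auto simp: less_add_limit_iff)
    also have "\<dots> \<longleftrightarrow> (\<exists>d<b + c. x < a + d)"
    proof
      assume "\<exists>d<c. x < a + (b + d)"
      then show "\<exists>d<b + c. x < a + d" using omega1_add_strict_mono by blast
    next
      assume "\<exists>d<b + c. x < a + d"
      then obtain d d' where "x < a + d" "d' < c" "d < b + d'"
        using less_add_limit_iff[OF limit(1)] by blast
      then show "\<exists>d<c. x < a + (b + d)"
        using omega1_add_strict_mono[of d "b + d'" a] by (meson order_less_trans)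
    qed
    finally show ?thesis by (simp add: less_add_limit_iff is_limit_add limit)
  qed
  then show ?case by (metis linorder_neq_iff)
qed (simp_all add: omega1_add)

lemma omega1_zero_add: "0 + a = (a::omega1)"
proof (induction a rule: omega1_induct)
  case (limit c)
  have "x < 0 + c \<longleftrightarrow> x < c" for x
    using limit osuc_less_limit[OF limit(1)] less_osuc
    by (auto simp: less_add_limit_iff) (metis)
  then show ?case by (metis linorder_neq_iff)
qed (simp_all add: omega1_add)

lemma mult_ord_of_nat_add: "a * ord_of_nat (n + m) = a * ord_of_nat n + a * ord_of_nat m"
  by (induction m) (simp_all add: omega1_mult omega1_add omega1_add_assoc)

lemma mult_ord_of_nat_one: "a * ord_of_nat (Suc 0) = a"
  by (simp add: omega1_mult omega1_zero_add)

lemma less_omega_iff: "b < omega \<longleftrightarrow> (\<exists>n. b = ord_of_nat n)"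
proof -
  have *: "b < ord_of_nat n \<Longrightarrow> \<exists>m. b = ord_of_nat m" for n
    by (induction n) (auto simp: omega1_not_less_zero less_osuc_iff order_le_less)
  have "b < omega \<longleftrightarrow> (\<exists>n. b < ord_of_nat n)"
    by (auto simp: omega_def less_osup_iff)
  then show ?thesis using * less_osuc by (metis ord_of_nat.simps(2))
qed

lemma is_limit_omega: "is_limit omega"
proof -
  have "omega \<noteq> 0"
    using less_omega_iff[of 0] omega1_not_less_zero ord_of_nat.simps(1) by metis
  moreover have "omega \<noteq> osuc b" for b
    using less_omega_iff[of b] less_omega_iff[of "osuc b"] less_osuc ord_of_nat.simps(2)
    by (metis order_less_irrefl)
  ultimately show ?thesis by (simp add: is_limit_def)
qed

lemma less_mult_omega_iff: "x < a * omega \<longleftrightarrow> (\<exists>n. x < a * ord_of_nat n)"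
  by (simp add: omega1_mult(3)[OF is_limit_omega] less_osup_iff countable_image_lessThan_omega1)
     (metis lessThan_iff less_omega_iff)

text \<open>Positivity is carried along because it makes the successor step strict: a positive power
  lies below its double, hence below the next power.\<close>

lemma le_opow_omega: "b \<le> opow omega b \<and> 0 < opow omega b"
proof (induction b rule: omega1_induct)
  case zero
  then show ?case by (simp add: opow_rec one_omega1_def less_osuc omega1_zero_le)
next
  case (osuc b)
  have "opow omega b < opow omega b + opow omega b"
    using omega1_add_strict_mono[of 0 "opow omega b" "opow omega b"] osuc by (simp add: omega1_add)
  then have "opow omega b < opow omega b * ord_of_nat 2"
    by (simp add: numeral_2_eq_2 omega1_mult omega1_zero_add)
  then have "opow omega b < opow omega (osuc b)"
    by (auto simp: opow_rec less_mult_omega_iff)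
  then show ?case using osuc by (auto simp: osuc_le_iff)
next
  case (limit c)
  have "x < opow omega c" if "x < c" for x
  proof -
    have "osuc x \<le> opow omega (osuc x)" using limit osuc_less_limit that by blast
    then have "x < opow omega (osuc x)" by (simp add: osuc_le_iff)
    then show ?thesis
      using osuc_less_limit[OF limit(1) that]
      by (auto simp: opow_rec(3)[OF limit(1)] less_osup_iff countable_image_lessThan_omega1)
  qed
  then show ?case using is_limit_pos[OF limit(1)] not_less by blast
qed

text \<open>At a successor exponent this is continuity of multiplication by \<omega>, at a limit
  exponent continuity of the power, where n = 1 suffices. It is the property of powers of \<omega>
  through which the minimal exponent is exploited.\<close>

lemma less_opow_omegaE:
  assumes "a < opow omega \<beta>" "\<beta> \<noteq> 0"
  obtains b n where "b < \<beta>" "1 \<le> n" "a < opow omega b * ord_of_nat n"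
proof (cases \<beta> rule: omega1_cases)
  case (2 b)
  then obtain n where n: "a < opow omega b * ord_of_nat n"
    using assms(1) by (auto simp: opow_rec less_mult_omega_iff)
  then have "n \<noteq> 0" by (auto simp: omega1_mult omega1_not_less_zero intro: ccontr)
  then show ?thesis using that[of b n] n 2 less_osuc by simp
next
  case 3
  then obtain b where "b < \<beta>" "a < opow omega b"
    using assms(1) by (auto simp: opow_rec less_osup_iff countable_image_lessThan_omega1)
  then show ?thesis using that[of b 1] by (simp add: omega1_mult omega1_zero_add)
qed (use assms in auto)

section \<open>Schreier families\<close>

definition hereditary :: "nat set set \<Rightarrow> bool" where
  "hereditary \<F> \<longleftrightarrow> (\<forall>F\<in>\<F>. \<forall>G. G \<subseteq> F \<longrightarrow> G \<in> \<F>)"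

definition spreading :: "nat set set \<Rightarrow> bool" where
  "spreading \<F> \<longleftrightarrow> (\<forall>F\<in>\<F>. \<forall>\<phi>. strict_mono_on F \<phi> \<longrightarrow> (\<forall>i\<in>F. i \<le> \<phi> i) \<longrightarrow> \<phi> ` F \<in> \<F>)"

text \<open>These closure properties are preserved by composition and by the limit clause, and they
  allow interval systems to be shifted and cut. Singletons make one interval an admissible system; 0
  is excluded because indices start at 1.\<close>

definition regular :: "nat set set \<Rightarrow> bool" where
  "regular \<F> \<longleftrightarrow> hereditary \<F> \<and> spreading \<F> \<and> (\<forall>F\<in>\<F>. finite F \<and> 0 \<notin> F) \<and> (\<forall>n\<ge>1. {n} \<in> \<F>)"

lemma regularD:
  assumes "regular \<F>"
  shows "F \<in> \<F> \<Longrightarrow> G \<subseteq> F \<Longrightarrow> G \<in> \<F>"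
    and "F \<in> \<F> \<Longrightarrow> strict_mono_on F \<phi> \<Longrightarrow> (\<And>i. i \<in> F \<Longrightarrow> i \<le> \<phi> i) \<Longrightarrow> \<phi> ` F \<in> \<F>"
    and "F \<in> \<F> \<Longrightarrow> finite F" and "F \<in> \<F> \<Longrightarrow> 0 \<notin> F" and "1 \<le> n \<Longrightarrow> {n} \<in> \<F>" and "{} \<in> \<F>"
  using assms unfolding regular_def hereditary_def spreading_def by (blast, blast, blast, blast, blast, blast)

text \<open>The blocks of a set in \<open>\<F>[\<G>]\<close> are indexed by their minima.\<close>

definition min_blocks :: "nat set \<Rightarrow> (nat \<Rightarrow> nat set) \<Rightarrow> bool" where
  "min_blocks H A \<longleftrightarrow> (\<forall>h\<in>H. finite (A h) \<and> h \<in> A h \<and> (\<forall>x\<in>A h. h \<le> x)) \<and>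
     (\<forall>h\<in>H. \<forall>k\<in>H. h < k \<longrightarrow> (\<forall>x\<in>A h. x < k))"

lemma min_blocksD:
  assumes "min_blocks H A" "h \<in> H"
  shows "finite (A h)" "h \<in> A h" "x \<in> A h \<Longrightarrow> h \<le> x" "Min (A h) = h"
    "k \<in> H \<Longrightarrow> h < k \<Longrightarrow> x \<in> A h \<Longrightarrow> x < k"
  using assms unfolding min_blocks_def by (auto intro!: Min_eqI)

lemma min_blocks_disjoint:
  assumes "min_blocks H A" "h \<in> H" "k \<in> H" "x \<in> A h" "x \<in> A k"
  shows "h = k"
  using min_blocksD[OF assms(1)] assms(2-) by (metis leD linorder_neqE_nat)

lemma successive_distinct: "successive Es \<Longrightarrow> distinct Es"
  unfolding successive_def
proof (induction Es)
  case (Cons E Es)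
  then have "E \<notin> set Es"
    by (metis Max_in Min_le leD list.set_intros(1) sorted_wrt.simps(2))
  with Cons show ?case by auto
qed simp

lemma successive_Min_mono:
  assumes "successive Es" "E \<in> set Es" "F \<in> set Es" "Min E < Min F"
  shows "Max E < Min F"
proof -
  obtain i j where ij: "i < length Es" "E = Es ! i" "j < length Es" "F = Es ! j"
    using assms by (metis in_set_conv_nth)
  have fin: "finite E" "E \<noteq> {}" "finite F" "F \<noteq> {}"
    using assms(1-3) unfolding successive_def by blast+
  consider "i < j" | "i = j" | "j < i" by linarith
  then show ?thesis
  proof cases
    case 1 then show ?thesis using assms(1) ij unfolding successive_def sorted_wrt_iff_nth_less by blast
  next
    case 2 then show ?thesis using ij assms(4) by simp
  next
    case 3
    then have "Max F < Min E" using assms(1) ij unfolding successive_def sorted_wrt_iff_nth_less by blast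
    then have "Min F < Min E" using fin by (meson Max_ge Min_in le_less_trans)
    then show ?thesis using assms(4) by simp
  qed
qed

lemma successive_inj_Min: "successive Es \<Longrightarrow> inj_on Min (set Es)"
proof (rule inj_onI, rule ccontr)
  fix E F :: "nat set" assume s: "successive Es" and EF: "E \<in> set Es" "F \<in> set Es" "Min E = Min F" "E \<noteq> F"
  obtain i j where ij: "i < length Es" "E = Es ! i" "j < length Es" "F = Es ! j"
    using EF by (metis in_set_conv_nth)
  have fin: "finite E" "E \<noteq> {}" "finite F" "F \<noteq> {}"
    using s EF(1,2) unfolding successive_def by blast+
  have "i \<noteq> j" using EF ij by auto
  then have "Max E < Min F \<or> Max F < Min E"
    using s ij by (metis linorder_neqE_nat sorted_wrt_iff_nth_less successive_def)
  then show False using fin EF(3) by (metis Max_ge Min_in leD)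
qed

lemma successive_map_min_blocks:
  assumes "min_blocks H A" "finite H"
  shows "successive (map A (sorted_list_of_set H))"
  unfolding successive_def sorted_wrt_map
proof
  have "finite (A h) \<and> A h \<noteq> {}" if "h \<in> H" for h
    using min_blocksD(1,2)[OF assms(1) that] by blast
  then show "\<forall>E\<in>set (map A (sorted_list_of_set H)). finite E \<and> E \<noteq> {}"
    using assms(2) by simp
  show "sorted_wrt (\<lambda>x y. Max (A x) < Min (A y)) (sorted_list_of_set H)"
  proof (rule sorted_wrt_mono_rel[OF _ strict_sorted_list_of_set])
    fix x y assume "x \<in> set (sorted_list_of_set H)" "y \<in> set (sorted_list_of_set H)" "x < y"
    then show "Max (A x) < Min (A y)"
      using min_blocksD[OF assms(1)] assms(2) by (metis Max_in empty_iff set_sorted_list_of_set)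
  qed
qed

text \<open>Since \<open>Min\<close> is injective on a successive list, the list can be replaced by
  the set H of its minima and a block function A on H. Subsets, images and regroupings of a
  composition are then handled by reindexing H.\<close>

lemma family_comp_iff:
  assumes "\<forall>F\<in>\<F>. finite F"
  shows "F \<in> family_comp \<F> \<G> \<longleftrightarrow> (\<exists>H A. H \<in> \<F> \<and> min_blocks H A \<and> (\<forall>h\<in>H. A h \<in> \<G>) \<and> F = \<Union> (A ` H))"
    (is "?L \<longleftrightarrow> ?R")
proof
  assume ?L
  then obtain Gs where Gs: "successive Gs" "set Gs \<subseteq> \<G>" "Min ` set Gs \<in> \<F>" "F = \<Union> (set Gs)"
    by (auto simp: family_comp_def)
  define A where "A = inv_into (set Gs) Min"
  have A: "A (Min G) = G" if "G \<in> set Gs" for G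
    using that successive_inj_Min[OF Gs(1)] by (simp add: A_def)
  have fin: "finite G" "G \<noteq> {}" if "G \<in> set Gs" for G
    using that Gs(1) by (auto simp: successive_def)
  have "min_blocks (Min ` set Gs) A"
    unfolding min_blocks_def
  proof (intro conjI ballI impI; elim imageE; hypsubst)
    fix G assume "G \<in> set Gs"
    then show "finite (A (Min G))" "Min G \<in> A (Min G)" "\<And>x. x \<in> A (Min G) \<Longrightarrow> Min G \<le> x"
      using A fin by auto
  next
    fix G G' x assume "G \<in> set Gs" "G' \<in> set Gs" "Min G < Min G'" "x \<in> A (Min G)"
    then show "x < Min G'"
      using A fin successive_Min_mono[OF Gs(1)] by (metis Max_ge le_less_trans)
  qed
  moreover have "A ` Min ` set Gs = set Gs" using A by (force simp: image_iff)
  ultimately show ?R using Gs A by (intro exI[of _ "Min ` set Gs"] exI[of _ A]) auto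
next
  assume ?R
  then obtain H A where HA: "H \<in> \<F>" "min_blocks H A" "\<forall>h\<in>H. A h \<in> \<G>" "F = \<Union> (A ` H)" by blast
  have "finite H" using assms HA by blast
  moreover have "Min ` A ` H = H"
    using min_blocksD(4)[OF HA(2)] by (force simp: image_iff)
  ultimately show ?L
    unfolding family_comp_def using HA successive_map_min_blocks[OF HA(2)]
    by (intro CollectI exI[of _ "map A (sorted_list_of_set H)"]) auto
qed

lemma family_compE:
  assumes "F \<in> family_comp \<F> \<G>" "regular \<F>"
  obtains H A where "H \<in> \<F>" "min_blocks H A" "\<forall>h\<in>H. A h \<in> \<G>" "F = \<Union> (A ` H)"
proof -
  have "\<forall>F\<in>\<F>. finite F" using regularD(3)[OF assms(2)] by blast
  then show ?thesis using that assms(1) family_comp_iff by metis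
qed

lemma family_compI:
  assumes "regular \<F>" "H \<in> \<F>" "min_blocks H A" "\<And>h. h \<in> H \<Longrightarrow> A h \<in> \<G>" "F = \<Union> (A ` H)"
  shows "F \<in> family_comp \<F> \<G>"
  using assms regularD(3)[OF assms(1)] by (subst family_comp_iff) blast+

lemma min_blocks_image:
  assumes "min_blocks H A" "strict_mono_on (\<Union> (A ` H)) \<phi>"
  shows "min_blocks (\<phi> ` H) (\<lambda>k. \<phi> ` A (inv_into H \<phi> k))"
    and "inj_on \<phi> H"
    and "h \<in> H \<Longrightarrow> inv_into H \<phi> (\<phi> h) = h"
proof -
  have sub: "h \<in> \<Union> (A ` H)" if "h \<in> H" for h using min_blocksD[OF assms(1)] that by blast
  have inj: "inj_on \<phi> H"
    using strict_mono_on_imp_inj_on[OF assms(2)] sub by (meson inj_on_subset subsetI)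
  then show "inj_on \<phi> H" .
  show inv: "inv_into H \<phi> (\<phi> h) = h" if "h \<in> H" for h using inj that by simp
  have le: "\<phi> x \<le> \<phi> y" if "x \<in> \<Union> (A ` H)" "y \<in> \<Union> (A ` H)" "x \<le> y" for x y
    using assms(2) that by (metis le_less strict_mono_onD)
  have lt: "x < y" if "x \<in> H" "y \<in> H" "\<phi> x < \<phi> y" for x y
    using le[of y x] that sub by (meson leD linorder_not_less)
  show "min_blocks (\<phi> ` H) (\<lambda>k. \<phi> ` A (inv_into H \<phi> k))"
    unfolding min_blocks_def
  proof (intro conjI ballI impI)
    fix h' assume "h' \<in> \<phi> ` H"
    then obtain h where h: "h \<in> H" "h' = \<phi> h" by blast
    note [simp] = h(2) inv[OF h(1)]
    show "finite (\<phi> ` A (inv_into H \<phi> h'))" "h' \<in> \<phi> ` A (inv_into H \<phi> h')"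
      using min_blocksD(1,2)[OF assms(1) h(1)] by auto
    show "h' \<le> y" if "y \<in> \<phi> ` A (inv_into H \<phi> h')" for y
      using that h min_blocksD(3)[OF assms(1) h(1)] sub[OF h(1)] by (auto intro!: le)
    fix k' assume "k' \<in> \<phi> ` H" "h' < k'"
    then obtain k where k: "k \<in> H" "k' = \<phi> k" "\<phi> h < \<phi> k" using h by auto
    show "y < k'" if "y \<in> \<phi> ` A (inv_into H \<phi> h')" for y
      using that h min_blocksD(5)[OF assms(1) h(1) k(1) lt[OF h(1) k(1,3)]] sub[OF k(1)] k(2)
      by (auto intro!: strict_mono_onD[OF assms(2)])
  qed
qed

text \<open>One transport principle for spreading a composition, for changing both of its families,
  and for the comparison with sums of ordinals. The families are tested only on subsets of F because
  \<phi> is controlled only there.\<close>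

lemma family_comp_image:
  assumes "regular \<F>" "regular \<F>'" "F \<in> family_comp \<F> \<G>" "strict_mono_on F \<phi>"
    and \<F>: "\<And>H. H \<in> \<F> \<Longrightarrow> H \<subseteq> F \<Longrightarrow> \<phi> ` H \<in> \<F>'"
    and \<G>: "\<And>A. A \<in> \<G> \<Longrightarrow> A \<subseteq> F \<Longrightarrow> \<phi> ` A \<in> \<G>'"
  shows "\<phi> ` F \<in> family_comp \<F>' \<G>'"
proof -
  obtain H A where HA: "H \<in> \<F>" "min_blocks H A" "\<forall>h\<in>H. A h \<in> \<G>" "F = \<Union> (A ` H)"
    by (rule family_compE[OF assms(3,1)])
  note mb = min_blocks_image[OF HA(2) assms(4)[unfolded HA(4)]]
  have "H \<subseteq> F" using min_blocksD[OF HA(2)] HA(4) by blast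
  then have "\<phi> ` H \<in> \<F>'" by (simp add: \<F> HA)
  then show ?thesis
  proof (rule family_compI[OF assms(2) _ mb(1)])
    show "\<phi> ` A (inv_into H \<phi> h) \<in> \<G>'" if "h \<in> \<phi> ` H" for h
    proof -
      from that obtain h' where h': "h' \<in> H" "h = \<phi> h'" by blast
      then have "A h' \<in> \<G>" "A h' \<subseteq> F" using HA by auto
      then show ?thesis using mb(3)[OF h'(1)] h'(2) \<G> by simp
    qed
    show "\<phi> ` F = \<Union> ((\<lambda>k. \<phi> ` A (inv_into H \<phi> k)) ` \<phi> ` H)"
      using mb(3) by (auto simp: HA(4))
  qed
qed

lemma family_comp_mono:
  assumes "regular \<F>" "regular \<F>'" "F \<in> family_comp \<F> \<G>"
    and "\<And>H. H \<in> \<F> \<Longrightarrow> H \<subseteq> F \<Longrightarrow> H \<in> \<F>'" and "\<And>A. A \<in> \<G> \<Longrightarrow> A \<subseteq> F \<Longrightarrow> A \<in> \<G>'"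
  shows "F \<in> family_comp \<F>' \<G>'"
  using family_comp_image[OF assms(1,2,3), of id] assms(4,5) by (simp add: strict_mono_on_def)

lemma regular_family_comp:
  assumes "regular \<F>" "regular \<G>"
  shows "regular (family_comp \<F> \<G>)"
  unfolding regular_def
proof (intro conjI)
  show "hereditary (family_comp \<F> \<G>)"
    unfolding hereditary_def
  proof (intro ballI allI impI)
    fix F G assume F: "F \<in> family_comp \<F> \<G>" and G: "G \<subseteq> F"
    obtain H A where HA: "H \<in> \<F>" "min_blocks H A" "\<forall>h\<in>H. A h \<in> \<G>" "F = \<Union> (A ` H)"
      by (rule family_compE[OF F assms(1)])
    define K where "K = {h \<in> H. A h \<inter> G \<noteq> {}}"
    \<comment> \<open>Cutting a block with G can move its minimum to the right. Heredity of \<F>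
      removes the blocks that miss G, and spreading of \<F> absorbs the shift of the remaining
      minima.\<close>
    define \<phi> where "\<phi> h = Min (A h \<inter> G)" for h
    have \<phi>: "\<phi> h \<in> A h" "\<phi> h \<in> G" "\<And>x. x \<in> A h \<Longrightarrow> x \<in> G \<Longrightarrow> \<phi> h \<le> x" if "h \<in> K" for h
    proof -
      have "finite (A h \<inter> G)" "A h \<inter> G \<noteq> {}" using that min_blocksD[OF HA(2)] by (auto simp: K_def)
      then show "\<phi> h \<in> A h" "\<phi> h \<in> G" "\<And>x. x \<in> A h \<Longrightarrow> x \<in> G \<Longrightarrow> \<phi> h \<le> x"
        unfolding \<phi>_def using Min_in by (blast, blast, auto)
    qed
    have K: "K \<in> \<F>" using regularD(1)[OF assms(1) HA(1)] by (auto simp: K_def)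
    have KH: "h \<in> H" if "h \<in> K" for h using that by (simp add: K_def)
    have sm: "strict_mono_on K \<phi>"
      using \<phi> KH min_blocksD[OF HA(2)] by (auto intro!: strict_mono_onI) (meson less_le_trans)
    have le: "h \<le> \<phi> h" if "h \<in> K" for h using \<phi> KH min_blocksD[OF HA(2)] that by blast
    have inj: "inj_on \<phi> K" using sm by (rule strict_mono_on_imp_inj_on)
    have inv: "inv_into K \<phi> (\<phi> h) = h" if "h \<in> K" for h using that inj by simp
    have lt: "x < y" if "x \<in> K" "y \<in> K" "\<phi> x < \<phi> y" for x y
      using strict_mono_on_less[OF sm that(1,2)] that(3) by blast
    have "\<phi> ` K \<in> \<F>" using regularD(2)[OF assms(1) K sm le] .
    then show "G \<in> family_comp \<F> \<G>"
    proof (rule family_compI[OF assms(1)])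
      show "min_blocks (\<phi> ` K) (\<lambda>k. A (inv_into K \<phi> k) \<inter> G)"
        unfolding min_blocks_def using inv lt \<phi> KH min_blocksD[OF HA(2)] le
        by (auto) (meson less_le_trans)
      show "A (inv_into K \<phi> h) \<inter> G \<in> \<G>" if "h \<in> \<phi> ` K" for h
      proof -
        from that obtain k where k: "k \<in> K" "h = \<phi> k" by blast
        then show ?thesis
          using regularD(1)[OF assms(2), of "A k" "A k \<inter> G"] HA(3) KH inv[OF k(1)] by simp
      qed
      show "G = (\<Union>k\<in>\<phi> ` K. A (inv_into K \<phi> k) \<inter> G)"
      proof -
        have "(\<Union>k\<in>\<phi> ` K. A (inv_into K \<phi> k) \<inter> G) = (\<Union>h\<in>K. A h \<inter> G)" using inv by simp
        also have "\<dots> = G" using G unfolding HA(4) K_def by blast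
        finally show ?thesis ..
      qed
    qed
  qed
  show "spreading (family_comp \<F> \<G>)"
    unfolding spreading_def
  proof (intro ballI allI impI)
    fix F \<phi> assume F: "F \<in> family_comp \<F> \<G>" "strict_mono_on F \<phi>" "\<forall>i\<in>F. i \<le> \<phi> i"
    show "\<phi> ` F \<in> family_comp \<F> \<G>"
    proof (rule family_comp_image[OF assms(1,1) F(1,2)])
      fix H assume "H \<in> \<F>" "H \<subseteq> F"
      then show "\<phi> ` H \<in> \<F>"
        using F(2,3) by (intro regularD(2)[OF assms(1)]) (auto simp: strict_mono_on_def subset_iff)
    next
      fix A assume "A \<in> \<G>" "A \<subseteq> F"
      then show "\<phi> ` A \<in> \<G>"
        using F(2,3) by (intro regularD(2)[OF assms(2)]) (auto simp: strict_mono_on_def subset_iff)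
    qed
  qed
  show "\<forall>F\<in>family_comp \<F> \<G>. finite F \<and> 0 \<notin> F"
  proof
    fix F assume F: "F \<in> family_comp \<F> \<G>"
    obtain H A where HA: "H \<in> \<F>" "min_blocks H A" "\<forall>h\<in>H. A h \<in> \<G>" "F = \<Union> (A ` H)"
      by (rule family_compE[OF F assms(1)])
    then show "finite F \<and> 0 \<notin> F"
      using regularD(3,4)[OF assms(2)] regularD(3)[OF assms(1) HA(1)] by auto
  qed
  show "\<forall>n\<ge>1. {n} \<in> family_comp \<F> \<G>"
  proof (intro allI impI)
    fix n :: nat assume n: "1 \<le> n"
    show "{n} \<in> family_comp \<F> \<G>"
      by (rule family_compI[OF assms(1), of "{n}" "\<lambda>h. {h}"])
         (use n regularD(5)[OF assms(1)] regularD(5)[OF assms(2)] in \<open>auto simp: min_blocks_def\<close>)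
  qed
qed

text \<open>Both directions only regroup blocks. The labels are what needs care, because each block
  has to be named by its own minimum.\<close>

lemma family_comp_assoc:
  assumes \<F>: "regular \<F>" and \<G>: "regular \<G>" and \<H>: "regular \<H>"
  shows "family_comp (family_comp \<F> \<G>) \<H> = family_comp \<F> (family_comp \<G> \<H>)"
proof (intro equalityI subsetI)
  note \<F>\<G> = regular_family_comp[OF \<F> \<G>]
  fix F assume F: "F \<in> family_comp (family_comp \<F> \<G>) \<H>"
  obtain H A where HA: "H \<in> family_comp \<F> \<G>" "min_blocks H A" "\<forall>h\<in>H. A h \<in> \<H>" "F = \<Union> (A ` H)"
    by (rule family_compE[OF F \<F>\<G>])
  obtain K B where KB: "K \<in> \<F>" "min_blocks K B" "\<forall>k\<in>K. B k \<in> \<G>" "H = \<Union> (B ` K)"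
    by (rule family_compE[OF HA(1) \<F>])
  show "F \<in> family_comp \<F> (family_comp \<G> \<H>)"
  proof (rule family_compI[OF \<F> KB(1), of "\<lambda>k. \<Union> (A ` B k)"])
    show "min_blocks K (\<lambda>k. \<Union> (A ` B k))"
      unfolding min_blocks_def
    proof (intro conjI ballI impI)
      fix k assume k: "k \<in> K"
      have BH: "h \<in> H" if "h \<in> B k" for h using that k KB(4) by blast
      show "finite (\<Union> (A ` B k))" "k \<in> \<Union> (A ` B k)"
        using min_blocksD(1,2)[OF KB(2) k] min_blocksD(1,2)[OF HA(2) BH] by auto
      show "k \<le> x" if x: "x \<in> \<Union> (A ` B k)" for x
      proof -
        obtain h where h: "h \<in> B k" "x \<in> A h" using x by blast
        then have "k \<le> h" "h \<le> x" using min_blocksD(3)[OF KB(2) k] min_blocksD(3)[OF HA(2) BH] by blast+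
        then show ?thesis by simp
      qed
      fix l assume l: "l \<in> K" "k < l"
      show "x < l" if x: "x \<in> \<Union> (A ` B k)" for x
      proof -
        obtain h where h: "h \<in> B k" "x \<in> A h" using x by blast
        have "h < l" using h k l min_blocksD[OF KB(2)] by blast
        moreover have "h \<in> H" "l \<in> H" using h k l KB(4) min_blocksD[OF KB(2)] by auto
        ultimately show ?thesis using min_blocksD(5)[OF HA(2)] h by blast
      qed
    qed
    show "\<Union> (A ` B k) \<in> family_comp \<G> \<H>" if k: "k \<in> K" for k
      by (rule family_compI[OF \<G> bspec[OF KB(3) k], of A])
         (use HA KB k in \<open>auto simp: min_blocks_def\<close>)
    show "F = (\<Union>k\<in>K. \<Union> (A ` B k))" using HA KB by auto
  qed
next
  note \<G>\<H> = regular_family_comp[OF \<G> \<H>] and \<F>\<G> = regular_family_comp[OF \<F> \<G>]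
  fix F assume F: "F \<in> family_comp \<F> (family_comp \<G> \<H>)"
  obtain K C where KC: "K \<in> \<F>" "min_blocks K C" "\<forall>k\<in>K. C k \<in> family_comp \<G> \<H>" "F = \<Union> (C ` K)"
    by (rule family_compE[OF F \<F>])
  have "\<forall>k\<in>K. \<exists>B A. B \<in> \<G> \<and> min_blocks B A \<and> (\<forall>h\<in>B. A h \<in> \<H>) \<and> C k = \<Union> (A ` B)"
    using KC(3) \<G> by (metis family_compE)
  then obtain B A where BA: "\<And>k. k \<in> K \<Longrightarrow> B k \<in> \<G>" "\<And>k. k \<in> K \<Longrightarrow> min_blocks (B k) (A k)"
      "\<And>k h. k \<in> K \<Longrightarrow> h \<in> B k \<Longrightarrow> A k h \<in> \<H>" "\<And>k. k \<in> K \<Longrightarrow> C k = \<Union> (A k ` B k)"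
    by metis
  have BC: "h \<in> C k" if "k \<in> K" "h \<in> B k" for k h
    using BA(4) that min_blocksD(2)[OF BA(2)] by blast
  \<comment> \<open>The point k is the minimum of C k. It lies in an inner block whose label is
    again a point of C k, and this label can be neither smaller nor larger than k.\<close>
  have kB: "k \<in> B k" if k: "k \<in> K" for k
  proof -
    obtain h where h: "h \<in> B k" "k \<in> A k h" using min_blocksD(2)[OF KC(2) k] BA(4)[OF k] by blast
    then have "h \<le> k" using min_blocksD(3)[OF BA(2)[OF k]] by blast
    moreover have "k \<le> h" using BC[OF k h(1)] min_blocksD(3)[OF KC(2) k] by blast
    ultimately show ?thesis using h by simp
  qed
  have mB: "min_blocks K B"
    unfolding min_blocks_def
    using kB BC KC(2) min_blocksD(3,5)[OF KC(2)] regularD(3)[OF \<G> BA(1)] by blast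
  define H where "H = \<Union> (B ` K)"
  \<comment> \<open>The sets B k are disjoint, so an inner label h determines the outer block from
    which it came.\<close>
  define \<kappa> where "\<kappa> h = (SOME k. k \<in> K \<and> h \<in> B k)" for h
  have \<kappa>: "\<kappa> h = k" if "k \<in> K" "h \<in> B k" for k h
  proof -
    have "\<kappa> h \<in> K \<and> h \<in> B (\<kappa> h)" unfolding \<kappa>_def by (rule someI[of _ k]) (use that in blast)
    then show ?thesis using that min_blocks_disjoint[OF mB] by blast
  qed
  have H: "H \<in> family_comp \<F> \<G>"
    by (rule family_compI[OF \<F> KC(1) mB BA(1) H_def])
  have Ax: "x \<in> C k" if "k \<in> K" "h \<in> B k" "x \<in> A k h" for k h x using BA(4) that by blast
  show "F \<in> family_comp (family_comp \<F> \<G>) \<H>"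
  proof (rule family_compI[OF \<F>\<G> H, of "\<lambda>h. A (\<kappa> h) h"])
    show "min_blocks H (\<lambda>h. A (\<kappa> h) h)"
      unfolding min_blocks_def
    proof (intro conjI ballI impI)
      fix h assume "h \<in> H"
      then obtain k where k: "k \<in> K" "h \<in> B k" by (auto simp: H_def)
      note [simp] = \<kappa>[OF k]
      show "finite (A (\<kappa> h) h)" "h \<in> A (\<kappa> h) h" "\<And>x. x \<in> A (\<kappa> h) h \<Longrightarrow> h \<le> x"
        using min_blocksD[OF BA(2)[OF k(1)] k(2)] by auto
      fix h' x assume "h' \<in> H" "h < h'" and x: "x \<in> A (\<kappa> h) h"
      then obtain k' where k': "k' \<in> K" "h' \<in> B k'" by (auto simp: H_def)
      consider "k = k'" | "k < k'" | "k' < k" by linarith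
      then show "x < h'"
      proof cases
        case 1
        then show ?thesis using min_blocksD(5)[OF BA(2)[OF k(1)] k(2)] k' \<open>h < h'\<close> x by simp
      next
        case 2
        then have "x < k'" using min_blocksD(5)[OF KC(2) k(1) k'(1)] Ax[OF k] x by simp
        then show ?thesis using min_blocksD(3)[OF KC(2) k'(1) BC[OF k']] by simp
      next
        case 3
        then have "h' < k" using min_blocksD(5)[OF KC(2) k'(1) k(1)] BC[OF k'] by simp
        then show ?thesis using min_blocksD(3)[OF KC(2) k(1) BC[OF k]] \<open>h < h'\<close> by simp
      qed
    qed
    show "A (\<kappa> h) h \<in> \<H>" if "h \<in> H" for h
      using that \<kappa> BA(3) by (auto simp: H_def)
    have "F = (\<Union>k\<in>K. \<Union>h\<in>B k. A k h)" using KC(4) BA(4) by simp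
    also have "\<dots> = (\<Union>h\<in>H. A (\<kappa> h) h)" using \<kappa> by (auto simp: H_def)
    finally show "F = (\<Union>h\<in>H. A (\<kappa> h) h)" .
  qed
qed

section \<open>Regularity of the Schreier families\<close>

lemma regular_schreier0: "regular schreier0"
  unfolding regular_def hereditary_def spreading_def schreier0_def
  by (auto simp: subset_singleton_iff intro: order_trans)

lemma schreier1_spread:
  assumes "F \<in> schreier1" "strict_mono_on F \<phi>" "\<And>i. i \<in> F \<Longrightarrow> i \<le> \<phi> i"
  shows "\<phi> ` F \<in> schreier1"
proof (cases "F = {}")
  case False
  then have F: "finite F" "0 \<notin> F" "card F \<le> Min F" using assms(1) by (auto simp: schreier1_def)
  have "Min F \<le> Min (\<phi> ` F)"
  proof (rule Min.boundedI)
    fix y assume "y \<in> \<phi> ` F"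
    then obtain x where "x \<in> F" "y = \<phi> x" by blast
    then show "Min F \<le> y" using F assms(3)[of x] Min_le[of F x] le_trans by blast
  qed (use F False in auto)
  moreover have "card (\<phi> ` F) \<le> card F" using F by (simp add: card_image_le)
  ultimately show ?thesis
    using F False assms(3) unfolding schreier1_def by (auto simp del: Min_ge_iff) (metis le_zero_eq)
qed (simp add: schreier1_def)

lemma schreier1_subset: "F \<in> schreier1 \<Longrightarrow> G \<subseteq> F \<Longrightarrow> G \<in> schreier1"
proof (cases "G = {}")
  case False
  assume F: "F \<in> schreier1" and G: "G \<subseteq> F"
  then have *: "finite F" "card F \<le> Min F" "0 \<notin> F" using False by (auto simp: schreier1_def)
  then have "finite G" "card G \<le> card F" "Min F \<le> Min G"
    using G False by (blast intro: finite_subset card_mono Min_antimono)+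
  then show ?thesis using * G by (auto simp: schreier1_def)
qed (simp add: schreier1_def)

lemma regular_schreier1: "regular schreier1"
  unfolding regular_def hereditary_def spreading_def
  using schreier1_spread schreier1_subset by (auto simp: schreier1_def)

lemma regular_schreier:
  assumes "ladder_system L"
  shows "regular (schreier L a)"
proof (induction a rule: omega1_induct)
  case zero
  then show ?case by (simp add: schreier_zero regular_schreier0)
next
  case (osuc a)
  then show ?case by (simp add: schreier_osuc regular_family_comp regular_schreier1)
next
  case (limit a)
  then have r: "regular (schreier L (L a n))" if "1 \<le> n" for n
    using that assms by (simp add: ladder_system_def)
  show ?case
    unfolding schreier_limit[OF assms limit(1)] regular_def hereditary_def spreading_def
  proof ((intro conjI ballI allI impI; (elim CollectE exE conjE)?), goal_cases)
    fix F G n assume "1 \<le> n" "F \<in> schreier L (L a n)" "\<forall>i\<in>F. n \<le> i" "G \<subseteq> F"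
    then show "G \<in> {F. \<exists>n\<ge>1. F \<in> schreier L (L a n) \<and> (\<forall>i\<in>F. n \<le> i)}"
      using regularD(1)[OF r] by blast
  next
    fix F \<phi> n assume "1 \<le> n" "F \<in> schreier L (L a n)" "\<forall>i\<in>F. n \<le> i" "strict_mono_on F \<phi>" "\<forall>i\<in>F. i \<le> \<phi> i"
    then show "\<phi> ` F \<in> {F. \<exists>n\<ge>1. F \<in> schreier L (L a n) \<and> (\<forall>i\<in>F. n \<le> i)}"
      using regularD(2)[OF r] by (auto intro!: exI[of _ n]) (meson order_trans)
  next
    fix F n assume "1 \<le> n" "F \<in> schreier L (L a n)"
    then show "finite F" "0 \<notin> F" using regularD(3,4)[OF r] by auto
  next
    fix n :: nat assume "1 \<le> n"
    then show "{n} \<in> {F. \<exists>n\<ge>1. F \<in> schreier L (L a n) \<and> (\<forall>i\<in>F. n \<le> i)}"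
      using regularD(5)[OF r] by (auto intro!: exI[of _ 1])
  qed
qed

section \<open>Comparison of Schreier families of different order\<close>

lemma schreier_subset_osuc:
  assumes "ladder_system L"
  shows "schreier L a \<subseteq> schreier L (osuc a)"
proof
  fix F assume F: "F \<in> schreier L a"
  note r = regular_schreier[OF assms, of a] and r1 = regular_schreier[OF assms, of "osuc a"]
  show "F \<in> schreier L (osuc a)"
  proof (cases "F = {}")
    case True
    then show ?thesis using regularD(6)[OF r1] by simp
  next
    case False
    have fin: "finite F" "0 \<notin> F" using regularD(3,4)[OF r F] by auto
    then have "1 \<le> Min F" using False Min_in[of F] by (metis One_nat_def Suc_leI gr0I)
    then show ?thesis
      unfolding schreier_osuc
      by (intro family_compI[OF regular_schreier1 regularD(5)[OF regular_schreier1], of "Min F" "\<lambda>_. F"])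
         (use fin False F in \<open>auto simp: min_blocks_def\<close>)
  qed
qed

text \<open>The blocks \<open>{n}\<close> and F have minima n and q, and the pair of these lies in
  \<open>schreier1\<close> because n is at least 2. Adding one element in front thus costs one
  successor, which is the room needed to split off the first vector of a branch.\<close>

lemma schreier_insert:
  assumes "ladder_system L" "F \<in> schreier L a" "2 \<le> n" "\<forall>i\<in>F. n < i"
  shows "insert n F \<in> schreier L (osuc a)"
proof (cases "F = {}")
  case True
  then show ?thesis using regularD(5)[OF regular_schreier[OF assms(1)], of n] assms(3) by simp
next
  case False
  note r = regular_schreier[OF assms(1), of a]
  have fin: "finite F" "0 \<notin> F" using regularD(3,4)[OF r assms(2)] by auto
  obtain q where q: "q \<in> F" "\<And>x. x \<in> F \<Longrightarrow> q \<le> x" using False fin by (metis Min_in Min_le)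
  have m: "n < q" using q assms(4) by blast
  show ?thesis
    unfolding schreier_osuc
  proof (rule family_compI[OF regular_schreier1, of "{n, q}" "\<lambda>h. if h = n then {n} else F"])
    show "{n, q} \<in> schreier1"
      using m assms(3) by (auto simp: schreier1_def)
    show "min_blocks {n, q} (\<lambda>h. if h = n then {n} else F)"
      using m fin q by (auto simp: min_blocks_def)
    show "(if h = n then {n} else F) \<in> schreier L a" for h
      using assms(2,3) regularD(5)[OF r] by auto
    show "insert n F = (\<Union>h\<in>{n, q}. if h = n then {n} else F)" using m by auto
  qed
qed

text \<open>A ladder passes a only from some stage n on, and a limit family takes over a set from
  stage n if the set starts at or after n. Hence the restriction to sets far enough to the
  right.\<close>

lemma schreier_eventually_mono:
  assumes "ladder_system L" "a \<le> b"
  shows "\<exists>m. \<forall>F\<in>schreier L a. (\<forall>i\<in>F. m \<le> i) \<longrightarrow> F \<in> schreier L b"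
  using assms(2)
proof (induction b rule: omega1_induct)
  case zero
  then show ?case using omega1_zero_le[of a] by auto
next
  case (osuc b)
  then show ?case
    using schreier_subset_osuc[OF assms(1), of b] less_osuc_iff[of a b] by (metis order_le_less subsetD)
next
  case (limit b)
  show ?case
  proof (cases "a = b")
    case False
    then have "a < b" using limit by simp
    then obtain n where n: "1 \<le> n" "a < L b n" "L b n < b"
      using assms(1) limit(1) unfolding ladder_system_def by blast
    then obtain m where m: "\<forall>F\<in>schreier L a. (\<forall>i\<in>F. m \<le> i) \<longrightarrow> F \<in> schreier L (L b n)"
      using limit(2)[OF n(3) less_imp_le[OF n(2)]] by blast
    have "F \<in> schreier L b" if "F \<in> schreier L a" "\<forall>i\<in>F. max m n \<le> i" for F
      unfolding schreier_limit[OF assms(1) limit(1)] using m that n by auto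
    then show ?thesis by blast
  qed auto
qed

text \<open>The fixed sequences chosen at the limits \<open>b\<close> and \<open>a + b\<close> are unrelated, so the two families below are
  comparable only after spreading sets by a sufficiently fast growing function \<open>h\<close>.\<close>

lemma schreier_comp_add:
  assumes L: "ladder_system L"
  shows "\<exists>h. \<forall>F\<in>family_comp (schreier L b) (schreier L a). \<forall>\<phi>. strict_mono_on F \<phi> \<longrightarrow>
    (\<forall>i\<in>F. h i \<le> \<phi> i) \<longrightarrow> \<phi> ` F \<in> schreier L (a + b)"
proof (induction b rule: omega1_induct)
  case zero
  have "\<phi> ` F \<in> schreier L a"
    if F: "F \<in> family_comp schreier0 (schreier L a)" "strict_mono_on F \<phi>" "\<forall>i\<in>F. i \<le> \<phi> i" for F \<phi>
  proof -
    obtain H A where HA: "H \<in> schreier0" "min_blocks H A"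
        "\<forall>h\<in>H. A h \<in> schreier L a" "F = \<Union> (A ` H)"
      by (rule family_compE[OF F(1) regular_schreier0])
    have "H = {} \<or> (\<exists>n. H = {n})" using HA(1) by (auto simp: schreier0_def)
    then have "F \<in> schreier L a" using HA regularD(6)[OF regular_schreier[OF L]] by auto
    then show ?thesis using regularD(2)[OF regular_schreier[OF L]] F by blast
  qed
  then show ?case by (auto simp: schreier_zero omega1_add intro!: exI[of _ "\<lambda>i. i"])
next
  case (osuc b)
  then obtain h where h: "\<And>F \<phi>. F \<in> family_comp (schreier L b) (schreier L a) \<Longrightarrow> strict_mono_on F \<phi> \<Longrightarrow>
    (\<And>i. i \<in> F \<Longrightarrow> h i \<le> \<phi> i) \<Longrightarrow> \<phi> ` F \<in> schreier L (a + b)" by blast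
  have "\<phi> ` F \<in> schreier L (a + osuc b)"
    if F: "F \<in> family_comp (schreier L (osuc b)) (schreier L a)" "strict_mono_on F \<phi>" "\<forall>i\<in>F. max i (h i) \<le> \<phi> i" for F \<phi>
  proof -
    have "F \<in> family_comp schreier1 (family_comp (schreier L b) (schreier L a))"
      using F(1) by (simp add: schreier_osuc family_comp_assoc regular_schreier1 regular_schreier[OF L])
    then show ?thesis
      unfolding omega1_add schreier_osuc
    proof (rule family_comp_image[OF regular_schreier1 regular_schreier1 _ F(2)])
      show "\<phi> ` H \<in> schreier1" if "H \<in> schreier1" "H \<subseteq> F" for H
        using that F by (intro schreier1_spread) (auto simp: strict_mono_on_def subset_iff)
      show "\<phi> ` A \<in> schreier L (a + b)" if "A \<in> family_comp (schreier L b) (schreier L a)" "A \<subseteq> F" for A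
        using that F by (intro h) (auto simp: strict_mono_on_def subset_iff)
    qed
  qed
  then show ?case by (intro exI[of _ "\<lambda>i. max i (h i)"]) blast
next
  case (limit b)
  have Lb: "L b n < b" if "1 \<le> n" for n using that L limit(1) by (simp add: ladder_system_def)
  have "\<forall>n. \<exists>h. 1 \<le> n \<longrightarrow> (\<forall>F\<in>family_comp (schreier L (L b n)) (schreier L a). \<forall>\<phi>. strict_mono_on F \<phi> \<longrightarrow>
    (\<forall>i\<in>F. h i \<le> \<phi> i) \<longrightarrow> \<phi> ` F \<in> schreier L (a + L b n))"
    using limit(2)[OF Lb] by blast
  then obtain h where h: "\<And>n F \<phi>. 1 \<le> n \<Longrightarrow> F \<in> family_comp (schreier L (L b n)) (schreier L a) \<Longrightarrow>
      strict_mono_on F \<phi> \<Longrightarrow> (\<And>i. i \<in> F \<Longrightarrow> h n i \<le> \<phi> i) \<Longrightarrow> \<phi> ` F \<in> schreier L (a + L b n)"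
    by metis
  have "\<forall>n. \<exists>m. 1 \<le> n \<longrightarrow> (\<forall>F\<in>schreier L (a + L b n). (\<forall>i\<in>F. m \<le> i) \<longrightarrow> F \<in> schreier L (a + b))"
    using schreier_eventually_mono[OF L] omega1_add_mono[OF less_imp_le[OF Lb]] by blast
  then obtain m where m: "\<And>n F. 1 \<le> n \<Longrightarrow> F \<in> schreier L (a + L b n) \<Longrightarrow> (\<And>i. i \<in> F \<Longrightarrow> m n \<le> i) \<Longrightarrow> F \<in> schreier L (a + b)"
    by metis
  \<comment> \<open>The stage n at which H enters the limit family is not known beforehand, but
    every i in F is at least n, so summing over n \<le> i covers it. The term m n pushes the image
    far enough to pass from a + L b n to a + b.\<close>
  define g where "g i = (\<Sum>n\<le>i. h n i + m n)" for i
  have g: "h n i \<le> g i" "m n \<le> g i" if "n \<le> i" for n i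
    using member_le_sum[of n "{..i}" "\<lambda>n. h n i + m n"] that by (auto simp: g_def)
  have "\<phi> ` F \<in> schreier L (a + b)"
    if F: "F \<in> family_comp (schreier L b) (schreier L a)" "strict_mono_on F \<phi>" "\<forall>i\<in>F. g i \<le> \<phi> i" for F \<phi>
  proof -
    obtain H A where HA: "H \<in> schreier L b" "min_blocks H A"
        "\<forall>h\<in>H. A h \<in> schreier L a" "F = \<Union> (A ` H)"
      by (rule family_compE[OF F(1) regular_schreier[OF L]])
    obtain n where n: "1 \<le> n" "H \<in> schreier L (L b n)" "\<forall>i\<in>H. n \<le> i"
      using HA(1) unfolding schreier_limit[OF L limit(1)] by blast
    have nF: "n \<le> i" if i: "i \<in> F" for i
      using i n(3) HA(4) min_blocksD(3)[OF HA(2)] by (auto intro: order_trans)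
    have "F \<in> family_comp (schreier L (L b n)) (schreier L a)"
      using family_compI[OF regular_schreier[OF L] n(2) HA(2) HA(3)[rule_format] HA(4)] .
    then have "\<phi> ` F \<in> schreier L (a + L b n)"
      using F(2) by (rule h[OF n(1)]) (use F(3) g nF in \<open>meson order_trans\<close>)
    then show ?thesis
    proof (rule m[OF n(1)])
      fix i assume "i \<in> \<phi> ` F"
      then obtain j where "j \<in> F" "i = \<phi> j" by blast
      then show "m n \<le> i" using F(3) g(2)[OF nF[of j]] by (auto intro: order_trans)
    qed
  qed
  then show ?case by blast
qed

lemma schreier_add_comp:
  assumes L: "ladder_system L"
  shows "\<exists>h. \<forall>F\<in>schreier L (a + b). \<forall>\<phi>. strict_mono_on F \<phi> \<longrightarrow>
    (\<forall>i\<in>F. h i \<le> \<phi> i) \<longrightarrow> \<phi> ` F \<in> family_comp (schreier L b) (schreier L a)"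
proof (induction b rule: omega1_induct)
  case zero
  have "\<phi> ` F \<in> family_comp schreier0 (schreier L a)"
    if F: "F \<in> schreier L a" "strict_mono_on F \<phi>" "\<forall>i\<in>F. i \<le> \<phi> i" for F \<phi>
  proof -
    have \<phi>F: "\<phi> ` F \<in> schreier L a" using regularD(2)[OF regular_schreier[OF L]] F by blast
    show ?thesis
    proof (cases "F = {}")
      case True
      then show ?thesis using regularD(6)[OF regular_family_comp[OF regular_schreier0 regular_schreier[OF L]]] by simp
    next
      case False
      have fin: "finite (\<phi> ` F)" "0 \<notin> \<phi> ` F" using regularD(3,4)[OF regular_schreier[OF L] \<phi>F] by auto
      then have "1 \<le> Min (\<phi> ` F)" using False Min_in[of "\<phi> ` F"] by (metis One_nat_def Suc_leI gr0I image_is_empty)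
      then show ?thesis
        by (intro family_compI[OF regular_schreier0 regularD(5)[OF regular_schreier0], of "Min (\<phi> ` F)" "\<lambda>_. \<phi> ` F"])
           (use fin False \<phi>F in \<open>auto simp: min_blocks_def\<close>)
    qed
  qed
  then show ?case by (auto simp: schreier_zero omega1_add intro!: exI[of _ "\<lambda>i. i"])
next
  case (osuc b)
  then obtain h where h: "\<And>F \<phi>. F \<in> schreier L (a + b) \<Longrightarrow> strict_mono_on F \<phi> \<Longrightarrow>
    (\<And>i. i \<in> F \<Longrightarrow> h i \<le> \<phi> i) \<Longrightarrow> \<phi> ` F \<in> family_comp (schreier L b) (schreier L a)" by blast
  have "\<phi> ` F \<in> family_comp (schreier L (osuc b)) (schreier L a)"
    if F: "F \<in> schreier L (a + osuc b)" "strict_mono_on F \<phi>" "\<forall>i\<in>F. max i (h i) \<le> \<phi> i" for F \<phi>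
  proof -
    have "F \<in> family_comp schreier1 (schreier L (a + b))" using F(1) by (simp add: schreier_osuc omega1_add)
    then have "\<phi> ` F \<in> family_comp schreier1 (family_comp (schreier L b) (schreier L a))"
    proof (rule family_comp_image[OF regular_schreier1 regular_schreier1 _ F(2)])
      show "\<phi> ` H \<in> schreier1" if "H \<in> schreier1" "H \<subseteq> F" for H
        using that F by (intro schreier1_spread) (auto simp: strict_mono_on_def subset_iff)
      show "\<phi> ` A \<in> family_comp (schreier L b) (schreier L a)" if "A \<in> schreier L (a + b)" "A \<subseteq> F" for A
        using that F by (intro h) (auto simp: strict_mono_on_def subset_iff)
    qed
    then show ?thesis
      by (simp add: schreier_osuc family_comp_assoc regular_schreier1 regular_schreier[OF L])
  qed
  then show ?case by (intro exI[of _ "\<lambda>i. max i (h i)"]) blast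
next
  case (limit b)
  have lim: "is_limit (a + b)" using limit(1) by (rule is_limit_add)
  \<comment> \<open>The ladder of a + b is unrelated to that of b, but by continuity of addition
    each of its stages lies below a + c for some c < b.\<close>
  have "\<exists>c<b. L (a + b) n \<le> a + c" if "1 \<le> n" for n
  proof -
    have "L (a + b) n < a + b" using that L lim by (simp add: ladder_system_def)
    then show ?thesis using less_add_limit_iff[OF limit(1)] less_imp_le by blast
  qed
  then obtain c where c: "\<And>n. 1 \<le> n \<Longrightarrow> c n < b" "\<And>n. 1 \<le> n \<Longrightarrow> L (a + b) n \<le> a + c n"
    by metis
  have "\<forall>n. \<exists>h. 1 \<le> n \<longrightarrow> (\<forall>F\<in>schreier L (a + c n). \<forall>\<phi>. strict_mono_on F \<phi> \<longrightarrow>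
    (\<forall>i\<in>F. h i \<le> \<phi> i) \<longrightarrow> \<phi> ` F \<in> family_comp (schreier L (c n)) (schreier L a))"
    using limit(2)[OF c(1)] by blast
  then obtain h where h: "\<And>n F \<phi>. 1 \<le> n \<Longrightarrow> F \<in> schreier L (a + c n) \<Longrightarrow> strict_mono_on F \<phi> \<Longrightarrow>
      (\<And>i. i \<in> F \<Longrightarrow> h n i \<le> \<phi> i) \<Longrightarrow> \<phi> ` F \<in> family_comp (schreier L (c n)) (schreier L a)"
    by metis
  have "\<forall>n. \<exists>m. 1 \<le> n \<longrightarrow> (\<forall>F\<in>schreier L (L (a + b) n). (\<forall>i\<in>F. m \<le> i) \<longrightarrow> F \<in> schreier L (a + c n))"
    using schreier_eventually_mono[OF L c(2)] by blast
  then obtain m where m: "\<And>n F. 1 \<le> n \<Longrightarrow> F \<in> schreier L (L (a + b) n) \<Longrightarrow> (\<And>i. i \<in> F \<Longrightarrow> m n \<le> i) \<Longrightarrow> F \<in> schreier L (a + c n)"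
    by metis
  have "\<forall>n. \<exists>m. 1 \<le> n \<longrightarrow> (\<forall>F\<in>schreier L (c n). (\<forall>i\<in>F. m \<le> i) \<longrightarrow> F \<in> schreier L b)"
    using schreier_eventually_mono[OF L less_imp_le[OF c(1)]] by blast
  then obtain l where l: "\<And>n F. 1 \<le> n \<Longrightarrow> F \<in> schreier L (c n) \<Longrightarrow> (\<And>i. i \<in> F \<Longrightarrow> l n \<le> i) \<Longrightarrow> F \<in> schreier L b"
    by metis
  \<comment> \<open>Two spreadings are composed. The first, g, moves F from stage n of the ladder of
    a + b into the family of a + c n. It is injective, so \<phi> after the inverse of g can be given
    to the induction hypothesis; this is why k below evaluates h at g i. The summand l n of k moves
    the outer family from c n to b.\<close>
  define g where "g i = i + (\<Sum>n\<le>i. m n)" for i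
  have gm: "m n \<le> g i" if "n \<le> i" for n i
    using member_le_sum[of n "{..i}" m] that by (auto simp: g_def)
  have gs: "strict_mono g"
    by (rule strict_monoI_Suc) (simp add: g_def)
  have ginj: "inj g" using gs by (simp add: strict_mono_imp_inj_on)
  define k where "k i = (\<Sum>n\<le>i. h n (g i) + l n)" for i
  have k: "h n (g i) \<le> k i" "l n \<le> k i" if "n \<le> i" for n i
    using member_le_sum[of n "{..i}" "\<lambda>n. h n (g i) + l n"] that by (auto simp: k_def)
  have "\<phi> ` F \<in> family_comp (schreier L b) (schreier L a)"
    if F: "F \<in> schreier L (a + b)" "strict_mono_on F \<phi>" "\<forall>i\<in>F. k i \<le> \<phi> i" for F \<phi>
  proof -
    obtain n where n: "1 \<le> n" "F \<in> schreier L (L (a + b) n)" "\<forall>i\<in>F. n \<le> i"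
      using F(1) unfolding schreier_limit[OF L lim] by blast
    have "g ` F \<in> schreier L (L (a + b) n)"
      by (rule regularD(2)[OF regular_schreier[OF L] n(2)])
         (use gs in \<open>auto simp: g_def strict_mono_on_def strict_mono_def\<close>)
    then have gF: "g ` F \<in> schreier L (a + c n)"
      by (rule m[OF n(1)]) (use gm n(3) in auto)
    have "(\<lambda>j. \<phi> (inv g j)) ` g ` F \<in> family_comp (schreier L (c n)) (schreier L a)"
    proof (rule h[OF n(1) gF])
      show "strict_mono_on (g ` F) (\<lambda>j. \<phi> (inv g j))"
        using F(2) ginj gs by (auto simp: strict_mono_on_def strict_mono_less)
      show "h n j \<le> \<phi> (inv g j)" if "j \<in> g ` F" for j
      proof -
        from that obtain i where i: "i \<in> F" "j = g i" by blast
        then show ?thesis using F(3) k(1)[of n i] n(3) ginj by (auto intro: order_trans)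
      qed
    qed
    then have *: "\<phi> ` F \<in> family_comp (schreier L (c n)) (schreier L a)"
      using ginj by (simp add: image_image)
    show ?thesis
    proof (rule family_comp_mono[OF regular_schreier[OF L] regular_schreier[OF L] *])
      fix H assume "H \<in> schreier L (c n)" "H \<subseteq> \<phi> ` F"
      then show "H \<in> schreier L b"
      proof (intro l[OF n(1)])
        fix i assume "i \<in> H"
        then obtain j where "j \<in> F" "i = \<phi> j" using \<open>H \<subseteq> \<phi> ` F\<close> by blast
        then show "l n \<le> i" using F(3) k(2)[of n j] n(3) by (auto intro: order_trans)
      qed
    qed
  qed
  then show ?case by blast
qed

section \<open>Block sequences and admissible sums\<close>

text \<open>An admissible sequence of intervals, given by the set \<open>G\<close> of its left endpoints and the right endpoint
  \<open>r g\<close> belonging to \<open>g\<close>.\<close>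

definition interval_system :: "nat set set \<Rightarrow> nat set \<Rightarrow> (nat \<Rightarrow> nat) \<Rightarrow> bool" where
  "interval_system \<F> G r \<longleftrightarrow> G \<in> \<F> \<and> (\<forall>g\<in>G. g \<le> r g) \<and> (\<forall>g\<in>G. \<forall>h\<in>G. g < h \<longrightarrow> r g < h)"

lemma interval_systemD:
  assumes "interval_system \<F> G r"
  shows "G \<in> \<F>" "g \<in> G \<Longrightarrow> g \<le> r g" "g \<in> G \<Longrightarrow> h \<in> G \<Longrightarrow> g < h \<Longrightarrow> r g < h"
  using assms by (auto simp: interval_system_def)

text \<open>Phrased with finitely supported coefficient sequences, so that it makes sense for any
  sequence w without coefficient functionals. Vectors and intervals both start at or after N; right
  endpoints may run past m, where the coefficients vanish.\<close>

definition upper_est :: "nat set set \<Rightarrow> (nat \<Rightarrow> 'a::real_normed_vector) \<Rightarrow> nat \<Rightarrow> real \<Rightarrow> bool" where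
  "upper_est \<F> w N t \<longleftrightarrow> (\<forall>a m G r. (\<forall>i. i < N \<or> m < i \<longrightarrow> a i = 0) \<longrightarrow> interval_system \<F> G r \<longrightarrow>
     (\<forall>g\<in>G. N \<le> g) \<longrightarrow>
     (\<Sum>g\<in>G. norm (\<Sum>i=g..r g. a i *\<^sub>R w i)) \<le> t * norm (\<Sum>i\<le>m. a i *\<^sub>R w i))"

lemma upper_estD:
  assumes "upper_est \<F> w N t" "\<And>i. i < N \<Longrightarrow> a i = 0" "\<And>i. m < i \<Longrightarrow> a i = 0" "interval_system \<F> G r"
    "\<And>g. g \<in> G \<Longrightarrow> N \<le> g"
  shows "(\<Sum>g\<in>G. norm (\<Sum>i=g..r g. a i *\<^sub>R w i)) \<le> t * norm (\<Sum>i\<le>m. a i *\<^sub>R w i)"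
  using assms unfolding upper_est_def by blast

lemma upper_est_mono:
  assumes "upper_est \<F> w N t" "N \<le> M" "t \<le> s"
  shows "upper_est \<F> w M s"
  unfolding upper_est_def
proof (intro allI impI)
  fix a :: "nat \<Rightarrow> real" and m G r
  assume *: "\<forall>i. i < M \<or> m < i \<longrightarrow> a i = 0" "interval_system \<F> G r" "\<forall>g\<in>G. M \<le> g"
  have "(\<Sum>g\<in>G. norm (\<Sum>i=g..r g. a i *\<^sub>R w i)) \<le> t * norm (\<Sum>i\<le>m. a i *\<^sub>R w i)"
    by (rule upper_estD[OF assms(1) _ _ *(2)]) (use * assms(2) in \<open>auto intro: order_trans\<close>)
  also have "\<dots> \<le> s * norm (\<Sum>i\<le>m. a i *\<^sub>R w i)" using assms(3) by (intro mult_right_mono) auto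
  finally show "(\<Sum>g\<in>G. norm (\<Sum>i=g..r g. a i *\<^sub>R w i)) \<le> s * norm (\<Sum>i\<le>m. a i *\<^sub>R w i)" .
qed

text \<open>The test is the vector w i with the single interval \<open>{i}\<close>.\<close>

lemma upper_est_ge_one:
  assumes "upper_est \<F> w N t" "regular \<F>" "N \<le> i" "1 \<le> i" "w i \<noteq> 0"
  shows "1 \<le> t"
proof -
  have "(\<Sum>g\<in>{i}. norm (\<Sum>j=g..g. (if j = i then 1 else 0) *\<^sub>R w j))
      \<le> t * norm (\<Sum>j\<le>i. (if j = i then 1 else 0) *\<^sub>R w j)"
    by (rule upper_estD[OF assms(1)])
       (use assms regularD(5)[OF assms(2,4)] in \<open>auto simp: interval_system_def\<close>)
  also have "(\<Sum>j\<le>i. (if j = i then 1 else 0) *\<^sub>R w j) = (\<Sum>j\<le>i. if j = i then w j else 0)"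
    by (rule sum.cong) auto
  finally show ?thesis using assms(5) by simp
qed

lemma span_image_sum:
  fixes w :: "'i \<Rightarrow> 'a::real_vector"
  assumes "finite F" "x \<in> span (w ` F)"
  shows "\<exists>c. x = (\<Sum>i\<in>F. c i *\<^sub>R w i)"
  using assms(2)
proof (induction rule: span_induct_alt)
  case base
  show ?case by (rule exI[of _ "\<lambda>_. 0"]) simp
next
  case (step c x y)
  then obtain i d where i: "i \<in> F" "x = w i" and d: "y = (\<Sum>i\<in>F. d i *\<^sub>R w i)" by blast
  have "c *\<^sub>R x + y = (\<Sum>j\<in>F. (if j = i then c *\<^sub>R w j else 0) + d j *\<^sub>R w j)"
    using assms(1) i d by (simp add: sum.distrib)
  also have "\<dots> = (\<Sum>j\<in>F. (d j + (if j = i then c else 0)) *\<^sub>R w j)"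
    by (rule sum.cong) (auto simp: algebra_simps)
  finally show ?case by (rule exI[of _ "\<lambda>j. d j + (if j = i then c else 0)"])
qed

text \<open>Unlike in \<open>block_basis_of\<close>, only the terms from N on are constrained, which
  is what a diagonal sequence can satisfy; p itself is still defined and increasing from 0
  on.\<close>

definition blocks :: "(nat \<Rightarrow> 'a::real_normed_vector) \<Rightarrow> (nat \<Rightarrow> 'a) \<Rightarrow> (nat \<Rightarrow> nat) \<Rightarrow> nat \<Rightarrow> bool" where
  "blocks v w p N \<longleftrightarrow> strict_mono p \<and> 1 \<le> N \<and> (\<forall>i\<ge>N. v i \<noteq> 0 \<and> v i \<in> span (w ` {p (i - 1)<..p i}))"

text \<open>\<open>v\<close> is, up to finitely many terms, a block sequence of \<open>w\<close> whose \<open>i\<close>-th block starts at or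
  after the index \<open>i\<close>.\<close>

definition sub_block :: "(nat \<Rightarrow> 'a::real_normed_vector) \<Rightarrow> (nat \<Rightarrow> 'a) \<Rightarrow> bool" where
  "sub_block v w \<longleftrightarrow> (\<exists>p N. blocks v w p N)"

lemma blocksD:
  assumes "blocks v w p N"
  shows "strict_mono p" "1 \<le> N" "N \<le> i \<Longrightarrow> v i \<noteq> 0" "N \<le> i \<Longrightarrow> v i \<in> span (w ` {p (i - 1)<..p i})"
  using assms by (auto simp: blocks_def)

lemma blocks_mono: "blocks v w p N \<Longrightarrow> N \<le> M \<Longrightarrow> blocks v w p M"
  by (auto simp: blocks_def)

lemma strict_mono_ge: "strict_mono p \<Longrightarrow> i \<le> (p i :: nat)"
  by (rule strict_mono_imp_increasing)

lemma blocks_index_unique: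
  fixes p :: "nat \<Rightarrow> nat"
  assumes "strict_mono p" "p (i - 1) < j" "j \<le> p i" "1 \<le> i"
  shows "(LEAST k. j \<le> p k) = i"
proof (rule Least_equality)
  fix k assume "j \<le> p k"
  then have "p (i - 1) < p k" using assms(2) by simp
  then show "i \<le> k" using strict_mono_less[OF assms(1)] by simp
qed (use assms in simp)

text \<open>Distinct blocks use disjoint intervals, so their coefficients combine into one sequence
  on the indices of w. The block containing j is the least k with j \<le> p k.\<close>

lemma blocks_coeffs:
  assumes "blocks v w p N"
  obtains c where "\<And>i. N \<le> i \<Longrightarrow> v i = (\<Sum>j\<in>{p (i - 1)<..p i}. c j *\<^sub>R w j)"
proof -
  have "\<forall>i. \<exists>c. N \<le> i \<longrightarrow> v i = (\<Sum>j\<in>{p (i - 1)<..p i}. c j *\<^sub>R w j)"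
    using span_image_sum[of "{p (i - 1)<..p i}" for i] blocksD(4)[OF assms] by blast
  then obtain c where c: "\<And>i. N \<le> i \<Longrightarrow> v i = (\<Sum>j\<in>{p (i - 1)<..p i}. c i j *\<^sub>R w j)"
    by metis
  show ?thesis
  proof
    fix i assume i: "N \<le> i"
    show "v i = (\<Sum>j\<in>{p (i - 1)<..p i}. c (LEAST k. j \<le> p k) j *\<^sub>R w j)"
      unfolding c[OF i] using blocks_index_unique[of p i] blocksD(1,2)[OF assms] i
      by (intro sum.cong) auto
  qed
qed

text \<open>The blocks from g to h cover the interval from Suc (p (g - 1)) to p h of w, so a
  combination of v expands into one of w with corresponding restrictions. Estimates for w are read
  off for v in this way.\<close>

lemma blocks_transfer:
  fixes v w :: "nat \<Rightarrow> 'a::real_normed_vector"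
  assumes bl: "blocks v w p N" and N': "N \<le> N'" and a: "\<And>i. i < N' \<Longrightarrow> a i = 0" "\<And>i. m < i \<Longrightarrow> a i = 0"
  obtains b where "\<And>g h. 1 \<le> g \<Longrightarrow> (\<Sum>i=g..h. a i *\<^sub>R v i) = (\<Sum>j=Suc (p (g - 1))..p h. b j *\<^sub>R w j)"
    "\<And>j. j \<le> p (N' - 1) \<Longrightarrow> b j = 0" "\<And>j. p m < j \<Longrightarrow> b j = 0"
    "(\<Sum>i\<le>m. a i *\<^sub>R v i) = (\<Sum>j\<le>p m. b j *\<^sub>R w j)"
proof -
  note sm = blocksD(1)[OF bl] and N1 = blocksD(2)[OF bl]
  obtain c where c: "\<And>i. N \<le> i \<Longrightarrow> v i = (\<Sum>j\<in>{p (i - 1)<..p i}. c j *\<^sub>R w j)"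
    using blocks_coeffs[OF bl] by blast
  define idx where "idx j = (LEAST k. j \<le> p k)" for j
  define b where "b j = a (idx j) * c j" for j
  have one: "a i *\<^sub>R v i = (\<Sum>j\<in>{p (i - 1)<..p i}. b j *\<^sub>R w j)" if "1 \<le> i" for i
  proof -
    have "(\<Sum>j\<in>{p (i - 1)<..p i}. b j *\<^sub>R w j) = (\<Sum>j\<in>{p (i - 1)<..p i}. a i *\<^sub>R c j *\<^sub>R w j)"
      using blocks_index_unique[OF sm _ _ that] by (intro sum.cong) (auto simp: b_def idx_def)
    also have "\<dots> = a i *\<^sub>R v i"
      using c[of i] a(1)[of i] N' by (cases "N' \<le> i") (auto simp: scaleR_sum_right)
    finally show ?thesis ..
  qed
  have sum: "(\<Sum>i=g..h. a i *\<^sub>R v i) = (\<Sum>j=Suc (p (g - 1))..p h. b j *\<^sub>R w j)" if g: "1 \<le> g" for g h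
  proof (induction h)
    case 0
    then show ?case using g strict_mono_less_eq[OF sm, of 0 "g - 1"] by simp
  next
    case (Suc h)
    show ?case
    proof (cases "g \<le> Suc h")
      case True
      have le: "p (g - 1) \<le> p h" "p h < p (Suc h)"
        using True strict_mono_less_eq[OF sm] strict_mono_less[OF sm] by auto
      have "{Suc (p (g - 1))..p (Suc h)} = {Suc (p (g - 1))..p h} \<union> {p h<..p (Suc h)}"
        using le by auto
      then have "(\<Sum>j=Suc (p (g - 1))..p (Suc h). b j *\<^sub>R w j) =
          (\<Sum>j=Suc (p (g - 1))..p h. b j *\<^sub>R w j) + (\<Sum>j\<in>{p h<..p (Suc h)}. b j *\<^sub>R w j)"
        by (simp add: sum.union_disjoint ivl_disj_int(2) disjoint_iff)
      then show ?thesis using True Suc one[of "Suc h"] by simp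
    next
      case False
      then have "p (Suc h) \<le> p (g - 1)" using strict_mono_less_eq[OF sm] by simp
      then show ?thesis using False by simp
    qed
  qed
  have b0: "b j = 0" if "j \<le> p (N' - 1)" for j
  proof -
    have "idx j \<le> N' - 1" unfolding idx_def using that by (rule Least_le)
    then show ?thesis using a(1)[of "idx j"] N' N1 by (simp add: b_def)
  qed
  have bm: "b j = 0" if "p m < j" for j
  proof -
    have "j \<le> p (idx j)" unfolding idx_def by (rule LeastI[of _ j]) (rule strict_mono_ge[OF sm])
    then have "m < idx j" using that strict_mono_less[OF sm, of m "idx j"] by simp
    then show ?thesis using a(2) by (simp add: b_def)
  qed
  have "(\<Sum>i\<le>m. a i *\<^sub>R v i) = (\<Sum>i=1..m. a i *\<^sub>R v i)"
    using a(1) N' N1 by (intro sum.mono_neutral_right) (auto simp: not_le Suc_le_eq)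
  also have "\<dots> = (\<Sum>j=Suc (p 0)..p m. b j *\<^sub>R w j)" using sum[of 1 m] by simp
  also have "\<dots> = (\<Sum>j\<le>p m. b j *\<^sub>R w j)"
  proof (rule sum.mono_neutral_left)
    have "p 0 \<le> p (N' - 1)" using strict_mono_less_eq[OF sm] by simp
    then show "\<forall>i\<in>{..p m} - {Suc (p 0)..p m}. b i *\<^sub>R w i = 0" using b0 by auto
  qed auto
  finally show ?thesis using that sum b0 bm by blast
qed

text \<open>The left endpoint Suc (p (g - 1)) reflects that blocks are half open on the left. The
  sum is reindexed for arbitrary f so that one system serves both norms of partial sums and norms of
  projections.\<close>

lemma interval_system_blocks:
  assumes isys: "interval_system \<F>' G r" and sm: "strict_mono p" and g1: "\<And>g. g \<in> G \<Longrightarrow> 1 \<le> g"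
    and F: "(\<lambda>g. Suc (p (g - 1))) ` G \<in> \<F>"
  shows "\<exists>R. interval_system \<F> ((\<lambda>g. Suc (p (g - 1))) ` G) R \<and> (\<forall>f :: nat \<Rightarrow> nat \<Rightarrow> real.
    (\<Sum>k\<in>(\<lambda>g. Suc (p (g - 1))) ` G. f k (R k)) = (\<Sum>g\<in>G. f (Suc (p (g - 1))) (p (r g))))"
proof -
  define \<phi> where "\<phi> g = Suc (p (g - 1))" for g
  have \<phi>: "\<phi> g < \<phi> h" if "g \<in> G" "h \<in> G" "g < h" for g h
    using that g1[OF that(1)] strict_mono_less[OF sm] by (simp add: \<phi>_def)
  have inj: "inj_on \<phi> G" using \<phi> by (metis (no_types, lifting) inj_onI linorder_neqE_nat order_less_irrefl)
  define R where "R k = p (r (inv_into G \<phi> k))" for k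
  have R: "R (\<phi> g) = p (r g)" if "g \<in> G" for g using that inj by (simp add: R_def)
  have 1: "interval_system \<F> (\<phi> ` G) R"
    unfolding interval_system_def
  proof (intro conjI ballI impI)
    show "\<phi> ` G \<in> \<F>" using F unfolding \<phi>_def .
    fix k assume "k \<in> \<phi> ` G"
    then obtain g where g: "g \<in> G" "k = \<phi> g" by blast
    have "g - 1 < r g" using interval_systemD(2)[OF isys g(1)] g1[OF g(1)] by simp
    then show "k \<le> R k" using g R strict_mono_less[OF sm] by (simp add: \<phi>_def Suc_le_eq)
    fix l assume l: "l \<in> \<phi> ` G" "k < l"
    then obtain h where h: "h \<in> G" "l = \<phi> h" by blast
    have "g < h" using \<phi>[OF h(1) g(1)] l(2) g h by (metis linorder_neqE_nat order_less_asym)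
    then have "r g \<le> h - 1" using interval_systemD(3)[OF isys g(1) h(1)] by simp
    then show "R k < l" using g h R strict_mono_less_eq[OF sm] by (simp add: \<phi>_def less_Suc_eq_le)
  qed
  have 2: "(\<Sum>k\<in>\<phi> ` G. f k (R k)) = (\<Sum>g\<in>G. f (\<phi> g) (p (r g)))" for f :: "nat \<Rightarrow> nat \<Rightarrow> real"
    using inj R by (simp add: sum.reindex)
  show ?thesis
  proof (intro exI[of _ R] conjI allI)
    show "interval_system \<F> ((\<lambda>g. Suc (p (g - 1))) ` G) R" using 1 unfolding \<phi>_def .
    show "(\<Sum>k\<in>(\<lambda>g. Suc (p (g - 1))) ` G. f k (R k)) = (\<Sum>g\<in>G. f (Suc (p (g - 1))) (p (r g)))" for f :: "nat \<Rightarrow> nat \<Rightarrow> real"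
      using 2[of f] unfolding \<phi>_def .
  qed
qed

text \<open>Left endpoints move from g to Suc (p (g - 1)), so it is enough that this shift carries
  \<F>' into \<F>. With equal families this is spreading; with a sparse p it exchanges the family of
  an ordinal sum for a composition, or conversely.\<close>

lemma upper_est_blocks:
  assumes bl: "blocks v w p N" and u: "upper_est \<F> w M t" and N': "N \<le> N'" "M \<le> Suc (p (N' - 1))"
    and F: "\<And>G. G \<in> \<F>' \<Longrightarrow> (\<And>g. g \<in> G \<Longrightarrow> N' \<le> g) \<Longrightarrow> (\<lambda>g. Suc (p (g - 1))) ` G \<in> \<F>"
  shows "upper_est \<F>' v N' t"
  unfolding upper_est_def
proof (intro allI impI)
  fix a :: "nat \<Rightarrow> real" and m G r
  assume *: "\<forall>i. i < N' \<or> m < i \<longrightarrow> a i = 0" "interval_system \<F>' G r" "\<forall>g\<in>G. N' \<le> g"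
  note sm = blocksD(1)[OF bl] and N1 = blocksD(2)[OF bl]
  obtain b where b: "\<And>g h. 1 \<le> g \<Longrightarrow> (\<Sum>i=g..h. a i *\<^sub>R v i) = (\<Sum>j=Suc (p (g - 1))..p h. b j *\<^sub>R w j)"
    "\<And>j. j \<le> p (N' - 1) \<Longrightarrow> b j = 0" "\<And>j. p m < j \<Longrightarrow> b j = 0"
    "(\<Sum>i\<le>m. a i *\<^sub>R v i) = (\<Sum>j\<le>p m. b j *\<^sub>R w j)"
    by (rule blocks_transfer[OF bl N'(1), of a m]) (use * in blast)+
  have g1: "1 \<le> g" if "g \<in> G" for g using that *(3) N1 N' by force
  have FG: "(\<lambda>g. Suc (p (g - 1))) ` G \<in> \<F>" using F[OF interval_systemD(1)[OF *(2)]] *(3) by blast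
  from interval_system_blocks[OF *(2) sm g1 FG]
  obtain R where "interval_system \<F> ((\<lambda>g. Suc (p (g - 1))) ` G) R \<and> (\<forall>f :: nat \<Rightarrow> nat \<Rightarrow> real.
    (\<Sum>k\<in>(\<lambda>g. Suc (p (g - 1))) ` G. f k (R k)) = (\<Sum>g\<in>G. f (Suc (p (g - 1))) (p (r g))))" ..
  note R = conjunct1[OF this] spec[OF conjunct2[OF this]]
  have "(\<Sum>g\<in>G. norm (\<Sum>i=g..r g. a i *\<^sub>R v i)) = (\<Sum>g\<in>G. norm (\<Sum>j=Suc (p (g - 1))..p (r g). b j *\<^sub>R w j))"
    using b(1)[OF g1] by simp
  also have "\<dots> = (\<Sum>k\<in>(\<lambda>g. Suc (p (g - 1))) ` G. norm (\<Sum>j=k..R k. b j *\<^sub>R w j))"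
    using R(2)[of "\<lambda>k l. norm (\<Sum>j=k..l. b j *\<^sub>R w j)"] by simp
  also have "\<dots> \<le> t * norm (\<Sum>j\<le>p m. b j *\<^sub>R w j)"
  proof (rule upper_estD[OF u _ _ R(1)])
    show "b i = 0" if "i < M" for i using that b(2) N' by simp
    show "M \<le> k" if k: "k \<in> (\<lambda>g. Suc (p (g - 1))) ` G" for k
    proof -
      from k obtain g where g: "g \<in> G" "k = Suc (p (g - 1))" by blast
      have "p (N' - 1) \<le> p (g - 1)"
        using *(3) g(1) strict_mono_less_eq[OF sm, of "N' - 1" "g - 1"] by (simp add: diff_le_mono)
      then show ?thesis using N'(2) g(2) by simp
    qed
  qed (use b in auto)
  finally show "(\<Sum>g\<in>G. norm (\<Sum>i=g..r g. a i *\<^sub>R v i)) \<le> t * norm (\<Sum>i\<le>m. a i *\<^sub>R v i)"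
    using b(4) by simp
qed

lemma regular_spread_blocks:
  assumes "regular \<F>" "strict_mono p" "G \<in> \<F>"
  shows "(\<lambda>g. Suc (p (g - 1))) ` G \<in> \<F>"
proof (rule regularD(2)[OF assms(1,3)])
  have "1 \<le> g" if "g \<in> G" for g using that regularD(4)[OF assms(1,3)] by (metis One_nat_def Suc_leI gr0I)
  then show "strict_mono_on G (\<lambda>g. Suc (p (g - 1)))"
    using strict_mono_less[OF assms(2)] by (auto simp: strict_mono_on_def) (metis One_nat_def diff_less_mono)
  show "i \<le> Suc (p (i - 1))" for i using strict_mono_ge[OF assms(2), of "i - 1"] by simp
qed

lemma upper_est_sub_block:
  assumes "sub_block v w" "upper_est \<F> w M t" "regular \<F>"
  shows "\<exists>N. upper_est \<F> v N t"
proof -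
  obtain p N where bl: "blocks v w p N" using assms(1) by (auto simp: sub_block_def)
  have "max N M - 1 \<le> p (max N M - 1)" by (rule strict_mono_ge[OF blocksD(1)[OF bl]])
  then have "M \<le> Suc (p (max N M - 1))" by linarith
  then have "upper_est \<F> v (max N M) t"
    by (intro upper_est_blocks[OF bl assms(2)])
       (simp_all only: max.cobounded1 regular_spread_blocks[OF assms(3) blocksD(1)[OF bl]])
  then show ?thesis ..
qed

lemma upper_est_eventually_subset:
  assumes "upper_est \<G> w N t" "\<And>G. G \<in> \<F> \<Longrightarrow> (\<And>i. i \<in> G \<Longrightarrow> m \<le> i) \<Longrightarrow> G \<in> \<G>"
  shows "\<exists>N. upper_est \<F> w N t"
proof -
  have "upper_est \<F> w (max N m) t"
    unfolding upper_est_def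
  proof (intro allI impI)
    fix a :: "nat \<Rightarrow> real" and k G r
    assume *: "\<forall>i. i < max N m \<or> k < i \<longrightarrow> a i = 0" "interval_system \<F> G r" "\<forall>g\<in>G. max N m \<le> g"
    then have "interval_system \<G> G r" using assms(2) by (auto simp: interval_system_def)
    then show "(\<Sum>g\<in>G. norm (\<Sum>i=g..r g. a i *\<^sub>R w i)) \<le> t * norm (\<Sum>i\<le>k. a i *\<^sub>R w i)"
      using * by (intro upper_estD[OF assms(1)]) auto
  qed
  then show ?thesis ..
qed

section \<open>Block sequences up to finitely many terms: transitivity, diagonal sequences,
  stabilisation\<close>

lemma sub_block_refl: "(\<And>i. N \<le> i \<Longrightarrow> w i \<noteq> 0) \<Longrightarrow> sub_block w w"
proof -
  assume *: "\<And>i. N \<le> i \<Longrightarrow> w i \<noteq> 0"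
  have "blocks w w (\<lambda>i. i) (max 1 N)"
    unfolding blocks_def using * by (auto simp: strict_mono_def intro!: span_base)
  then show ?thesis by (auto simp: sub_block_def)
qed

lemma sub_block_refl': "sub_block v w \<Longrightarrow> sub_block v v"
  unfolding sub_block_def[of v w] using blocksD(3) sub_block_refl by metis

lemma blocks_trans:
  assumes "blocks u v p N" "blocks v w q M"
  shows "blocks u w (q \<circ> p) (max N M)"
  unfolding blocks_def
proof (intro conjI allI impI)
  show "strict_mono (q \<circ> p)"
    using blocksD(1)[OF assms(1)] blocksD(1)[OF assms(2)] by (simp add: strict_mono_o)
  show "1 \<le> max N M" using blocksD(2)[OF assms(1)] by simp
  fix i assume i: "max N M \<le> i"
  then show "u i \<noteq> 0" using blocksD(3)[OF assms(1)] by simp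
  have "v ` {p (i - 1)<..p i} \<subseteq> span (w ` {(q \<circ> p) (i - 1)<..(q \<circ> p) i})"
  proof
    fix x assume "x \<in> v ` {p (i - 1)<..p i}"
    then obtain j where j: "x = v j" "p (i - 1) < j" "j \<le> p i" by auto
    have "i - 1 \<le> p (i - 1)" by (rule strict_mono_ge[OF blocksD(1)[OF assms(1)]])
    moreover have "N \<le> i" "M \<le> i" using i by auto
    ultimately have "M \<le> j" using j blocksD(2)[OF assms(1)] by linarith
    then have "v j \<in> span (w ` {q (j - 1)<..q j})" by (rule blocksD(4)[OF assms(2)])
    moreover have "q (p (i - 1)) \<le> q (j - 1)" "q j \<le> q (p i)"
      using j strict_mono_less_eq[OF blocksD(1)[OF assms(2)]] by auto
    then have "span (w ` {q (j - 1)<..q j}) \<subseteq> span (w ` {(q \<circ> p) (i - 1)<..(q \<circ> p) i})"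
      by (intro span_mono image_mono) auto
    ultimately show "x \<in> span (w ` {(q \<circ> p) (i - 1)<..(q \<circ> p) i})" using j by auto
  qed
  then have "span (v ` {p (i - 1)<..p i}) \<subseteq> span (w ` {(q \<circ> p) (i - 1)<..(q \<circ> p) i})"
    by (simp add: span_minimal)
  then show "u i \<in> span (w ` {(q \<circ> p) (i - 1)<..(q \<circ> p) i})"
    using blocksD(4)[OF assms(1)] i by auto
qed

lemma sub_block_trans [trans]: "sub_block u v \<Longrightarrow> sub_block v w \<Longrightarrow> sub_block u w"
  unfolding sub_block_def using blocks_trans by blast

lemma blocks_subseq:
  assumes "strict_mono q" "1 \<le> N" "\<And>i. N \<le> i \<Longrightarrow> w (q i) \<noteq> 0"
  shows "blocks (w \<circ> q) w q N"
  unfolding blocks_def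
proof (intro conjI allI impI)
  fix i assume "N \<le> i"
  then have "q (i - 1) < q i" using assms strict_mono_less[OF assms(1)] by simp
  then show "(w \<circ> q) i \<in> span (w ` {q (i - 1)<..q i})" by (auto intro: span_base)
qed (use assms in auto)

lemma sub_block_subseq:
  assumes "sub_block v w" "strict_mono q"
  shows "sub_block (v \<circ> q) v"
proof -
  obtain p N where bl: "blocks v w p N" using assms(1) by (auto simp: sub_block_def)
  have "blocks (v \<circ> q) v q N"
    using blocksD(2,3)[OF bl] strict_mono_ge[OF assms(2)] by (intro blocks_subseq[OF assms(2)]) (auto intro: order_trans)
  then show ?thesis by (auto simp: sub_block_def)
qed

text \<open>The k-th vector is taken from W k, so far out that it lies beyond the previous ones with
  respect to the earlier W j. It is shown to be a block sequence of W j from index j + 2 on, which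
  is enough because \<open>sub_block\<close> neglects finitely many terms.\<close>

lemma sub_block_diagonal:
  assumes "\<And>k. sub_block (W (Suc k)) (W k)"
  obtains v where "\<And>j. sub_block v (W j)"
proof -
  have "\<exists>p N. j < k \<longrightarrow> blocks (W k) (W j) p N" for j k
  proof (induction k)
    case (Suc k)
    then show ?case
      using assms[of k] blocks_trans[of "W (Suc k)" "W k" _ _ "W j"] unfolding sub_block_def
      by (metis less_antisym)
  qed auto
  then obtain p n where pn: "\<And>j k. j < k \<Longrightarrow> blocks (W k) (W j) (p j k) (n j k)" by metis
  \<comment> \<open>The next index exceeds the right ends of the vector chosen last, measured in all
    W j with j < k, and also the indices from which W (Suc k) is known to be a block sequence of the
    W j with j \<le> k.\<close>
  define q where "q = rec_nat 0 (\<lambda>k x. Suc (x + (\<Sum>j<k. p j k x) + (\<Sum>j\<le>k. n j (Suc k))))"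
  have q: "q 0 = 0" "q (Suc k) = Suc (q k + (\<Sum>j<k. p j k (q k)) + (\<Sum>j\<le>k. n j (Suc k)))" for k
    by (simp_all add: q_def)
  have qk: "k \<le> q k" for k by (induction k) (auto simp: q)
  have qp: "p j k (q k) < q (Suc k)" if "j < k" for j k
    using member_le_sum[of j "{..<k}" "\<lambda>j. p j k (q k)"] that by (simp add: q)
  have qn: "n j k \<le> q k" if jk: "j < k" for j k
  proof -
    obtain l where l: "k = Suc l" using jk by (cases k) auto
    show ?thesis using member_le_sum[of j "{..l}" "\<lambda>j. n j (Suc l)"] jk by (simp add: q l)
  qed
  define v where "v k = W k (q k)" for k
  have "sub_block v (W j)" for j
  proof -
    \<comment> \<open>The values up to j are fillers that keep P increasing; only the later ones are
      ends of blocks.\<close>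
    define P where "P k = (if k \<le> j then k else p j k (q k))" for k
    note sm = blocksD(1)[OF pn]
    have "strict_mono P"
    proof (rule strict_monoI_Suc)
      fix k
      consider "Suc k \<le> j" | "k = j" | "j < k" by linarith
      then show "P k < P (Suc k)"
      proof cases
        case 2
        have "q (Suc j) \<le> p j (Suc j) (q (Suc j))" by (rule strict_mono_ge[OF sm]) simp
        moreover have "Suc j \<le> q (Suc j)" by (rule qk)
        ultimately show ?thesis using 2 by (simp add: P_def)
      next
        case 3
        have "q (Suc k) \<le> p j (Suc k) (q (Suc k))" by (rule strict_mono_ge[OF sm]) (use 3 in simp)
        then show ?thesis using qp[OF 3] 3 by (simp add: P_def)
      qed (simp add: P_def)
    qed
    moreover have "v i \<noteq> 0 \<and> v i \<in> span (W j ` {P (i - 1)<..P i})" if i: "Suc (Suc j) \<le> i" for i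
    proof -
      obtain k where k: "i = Suc k" "j < k" using i by (cases i) auto
      have ji: "j < i" using i by simp
      have "v i \<noteq> 0" "v i \<in> span (W j ` {p j i (q i - 1)<..p j i (q i)})"
        using blocksD(3,4)[OF pn[OF ji] qn[OF ji]] by (simp_all add: v_def)
      moreover have "P (i - 1) \<le> p j i (q i - 1)"
        using qp[OF k(2)] strict_mono_ge[OF sm[OF ji], of "q i - 1"] k by (simp add: P_def)
      then have "span (W j ` {p j i (q i - 1)<..p j i (q i)}) \<subseteq> span (W j ` {P (i - 1)<..P i})"
        using ji by (intro span_mono image_mono) (auto simp: P_def)
      ultimately show ?thesis by blast
    qed
    ultimately have "blocks v (W j) P (Suc (Suc j))" by (simp add: blocks_def)
    then show ?thesis by (auto simp: sub_block_def)
  qed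
  then show ?thesis using that by blast
qed

text \<open>W (Suc k) is chosen so that f is within 1 / (k + 1) of its infimum below W k. A diagonal
  v lies below every W k, so f v \<le> f u + 1 / (k + 1) for every u below v and every k.\<close>

lemma sub_block_stabilise_one:
  fixes f :: "(nat \<Rightarrow> 'a::real_normed_vector) \<Rightarrow> real"
  assumes "sub_block w x"
    and mono: "\<And>u v. sub_block u v \<Longrightarrow> sub_block v w \<Longrightarrow> f u \<le> f v"
    and ge: "\<And>u. sub_block u w \<Longrightarrow> 0 \<le> f u"
  obtains v where "sub_block v w" "\<And>u. sub_block u v \<Longrightarrow> f u = f v"
proof -
  define I where "I x = Inf (f ` {u. sub_block u x})" for x
  have bdd: "bdd_below (f ` {u. sub_block u x})" if "sub_block x w" for x
    using ge sub_block_trans[OF _ that] by (intro bdd_belowI[of _ 0]) auto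
  have "\<exists>W. \<forall>k. sub_block (W k) w \<and> (sub_block (W (Suc k)) (W k) \<and> f (W (Suc k)) \<le> I (W k) + inverse (real (Suc k)))"
  proof (rule dependent_nat_choice)
    show "\<exists>y. sub_block y w" using sub_block_refl'[OF assms(1)] by blast
    fix y k assume y: "sub_block y w"
    have ne: "f ` {u. sub_block u y} \<noteq> {}" using sub_block_refl'[OF y] by blast
    have "I y < I y + inverse (real (Suc k))" by simp
    then obtain u where "sub_block u y" "f u < I y + inverse (real (Suc k))"
      unfolding I_def cInf_less_iff[OF ne bdd[OF y]] by blast
    then show "\<exists>z. sub_block z w \<and> sub_block z y \<and> f z \<le> I y + inverse (real (Suc k))"
      using sub_block_trans[OF _ y] less_imp_le by blast
  qed
  then obtain W where W: "\<And>k. sub_block (W k) w" "\<And>k. sub_block (W (Suc k)) (W k)"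
    "\<And>k. f (W (Suc k)) \<le> I (W k) + inverse (real (Suc k))" by blast
  obtain v where v: "\<And>j. sub_block v (W j)" using sub_block_diagonal[of W] W(2) by blast
  have vw: "sub_block v w" using sub_block_trans[OF v W(1)] .
  show ?thesis
  proof (rule that[OF vw])
    fix u assume u: "sub_block u v"
    have "f v \<le> f u + inverse (real (Suc k))" for k
    proof -
      have "f v \<le> f (W (Suc k))" by (rule mono[OF v W(1)])
      also note W(3)
      also have "I (W k) \<le> f u"
        unfolding I_def using sub_block_trans[OF u v] by (intro cInf_lower bdd W(1)) blast
      finally show ?thesis by simp
    qed
    then have "f v \<le> f u"
      using LIMSEQ_le_const[OF LIMSEQ_inverse_real_of_nat_add[of "f u"]] by blast
    then show "f u = f v" using mono[OF u vw] by simp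
  qed
qed

text \<open>Constancy of one functional below a block sequence is inherited by everything below it.
  The functionals can therefore be stabilised one after another, and a diagonal sequence keeps all
  of them constant.\<close>

lemma sub_block_stabilise:
  fixes f :: "nat \<Rightarrow> (nat \<Rightarrow> 'a::real_normed_vector) \<Rightarrow> real"
  assumes "sub_block w x"
    and mono: "\<And>n u v. sub_block u v \<Longrightarrow> sub_block v w \<Longrightarrow> f n u \<le> f n v"
    and ge: "\<And>n u. sub_block u w \<Longrightarrow> 0 \<le> f n u"
  shows "\<exists>v. sub_block v w \<and> (\<forall>n u. sub_block u v \<longrightarrow> f n u = f n v)"
proof -
  have "\<exists>W. \<forall>k. sub_block (W k) w \<and> (sub_block (W (Suc k)) (W k) \<and> (\<forall>u. sub_block u (W (Suc k)) \<longrightarrow> f k u = f k (W (Suc k))))"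
  proof (rule dependent_nat_choice)
    show "\<exists>y. sub_block y w" using sub_block_refl'[OF assms(1)] by blast
    fix y k assume y: "sub_block y w"
    obtain z where "sub_block z y" "\<And>u. sub_block u z \<Longrightarrow> f k u = f k z"
      by (rule sub_block_stabilise_one[OF y, of "f k"]) (use mono ge sub_block_trans[OF _ y] in blast)+
    then show "\<exists>z. sub_block z w \<and> sub_block z y \<and> (\<forall>u. sub_block u z \<longrightarrow> f k u = f k z)"
      using sub_block_trans[OF _ y] by blast
  qed
  then obtain W where W: "\<And>k. sub_block (W k) w" "\<And>k. sub_block (W (Suc k)) (W k)"
    "\<And>k u. sub_block u (W (Suc k)) \<Longrightarrow> f k u = f k (W (Suc k))" by blast
  obtain v where v: "\<And>j. sub_block v (W j)" using sub_block_diagonal[of W] W(2) by blast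
  have "f n u = f n v" if "sub_block u v" for n u
    using W(3)[OF sub_block_trans[OF that v]] W(3)[OF v] by simp
  then show ?thesis using sub_block_trans[OF v W(1)] by blast
qed

section \<open>Optimal constants of upper estimates\<close>

definition est_const :: "nat set set \<Rightarrow> (nat \<Rightarrow> 'a::real_normed_vector) \<Rightarrow> real" where
  "est_const \<F> w = Inf {t. \<exists>N. upper_est \<F> w N t}"

text \<open>Guards \<open>est_const\<close>, since \<open>Inf\<close> of the empty set of reals
  carries no information. Both notions allow any tail, which makes them insensitive to finitely many
  terms and monotone under \<open>sub_block\<close>.\<close>

definition finite_est :: "nat set set \<Rightarrow> (nat \<Rightarrow> 'a::real_normed_vector) \<Rightarrow> bool" where
  "finite_est \<F> w \<longleftrightarrow> (\<exists>N t. upper_est \<F> w N t)"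

lemma upper_est_ge_one':
  assumes "sub_block w x" "regular \<F>" "upper_est \<F> w N t"
  shows "1 \<le> t"
proof -
  obtain p M where "blocks w x p M" using assms(1) by (auto simp: sub_block_def)
  then show ?thesis
    using upper_est_ge_one[OF assms(3,2), of "max N M"] blocksD(2,3) by (metis max.cobounded1 max.cobounded2 order_trans)
qed

lemma est_const_le:
  assumes "sub_block w x" "regular \<F>" "upper_est \<F> w N t"
  shows "est_const \<F> w \<le> t"
  unfolding est_const_def
  by (rule cInf_lower) (use assms upper_est_ge_one'[OF assms(1,2)] in \<open>auto intro!: bdd_belowI[of _ 1]\<close>)

lemma est_const_ge_one:
  assumes "sub_block w x" "regular \<F>" "finite_est \<F> w"
  shows "1 \<le> est_const \<F> w"
  unfolding est_const_def
  by (rule cInf_greatest) (use assms upper_est_ge_one'[OF assms(1,2)] in \<open>auto simp: finite_est_def\<close>)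

lemma est_const_less:
  assumes "finite_est \<F> w" "est_const \<F> w < t"
  obtains N where "upper_est \<F> w N t"
proof -
  have "{t. \<exists>N. upper_est \<F> w N t} \<noteq> {}" using assms(1) by (auto simp: finite_est_def)
  then obtain s where "\<exists>N. upper_est \<F> w N s" "s < t"
    using cInf_lessD[OF _ assms(2)[unfolded est_const_def]] by blast
  then show ?thesis using that upper_est_mono[of \<F> w _ s _ t] by (metis less_imp_le order_refl)
qed

lemma finite_est_sub_block:
  assumes "sub_block v w" "regular \<F>" "finite_est \<F> w"
  shows "finite_est \<F> v"
  using assms upper_est_sub_block unfolding finite_est_def by blast

lemma est_const_sub_block:
  assumes "sub_block v w" "regular \<F>" "finite_est \<F> w"
  shows "est_const \<F> v \<le> est_const \<F> w"
proof (rule field_le_epsilon)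
  fix \<epsilon> :: real assume "0 < \<epsilon>"
  then have "est_const \<F> w < est_const \<F> w + \<epsilon>" by simp
  then obtain N where "upper_est \<F> w N (est_const \<F> w + \<epsilon>)" by (rule est_const_less[OF assms(3)])
  then obtain M where "upper_est \<F> v M (est_const \<F> w + \<epsilon>)" using upper_est_sub_block[OF assms(1) _ assms(2)] by blast
  then show "est_const \<F> v \<le> est_const \<F> w + \<epsilon>" by (rule est_const_le[OF assms(1,2)])
qed

text \<open>The inner intervals that belong to one h lie in a single outer interval, which ends with
  the last of them. The estimate for \<G> is applied to the restriction of the vector to this outer
  interval, the estimate for \<F> to the outer intervals, and the constants multiply.\<close>

lemma upper_est_family_comp:
  assumes u\<F>: "upper_est \<F> w N s" and u\<G>: "upper_est \<G> w N t" and reg: "regular \<F>" "regular \<G>" and t: "0 \<le> t"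
  shows "upper_est (family_comp \<F> \<G>) w N (s * t)"
  unfolding upper_est_def
proof (intro allI impI)
  fix a :: "nat \<Rightarrow> real" and m K r
  assume *: "\<forall>i. i < N \<or> m < i \<longrightarrow> a i = 0" "interval_system (family_comp \<F> \<G>) K r" "\<forall>g\<in>K. N \<le> g"
  obtain H A where HA: "H \<in> \<F>" "min_blocks H A" "\<forall>h\<in>H. A h \<in> \<G>" "K = \<Union> (A ` H)"
    by (rule family_compE[OF interval_systemD(1)[OF *(2)] reg(1)])
  define R where "R h = r (Max (A h))" for h
  have Mx: "Max (A h) \<in> A h" "\<And>g. g \<in> A h \<Longrightarrow> g \<le> Max (A h)" if "h \<in> H" for h
    using min_blocksD(1,2)[OF HA(2) that] by (auto intro: Max_in)
  have AK: "g \<in> K" if "h \<in> H" "g \<in> A h" for g h using that HA(4) by blast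
  have rR: "r g \<le> R h" if "h \<in> H" "g \<in> A h" for g h
  proof (cases "g = Max (A h)")
    case False
    then have "g < Max (A h)" using Mx(2)[OF that] by simp
    then have "r g < Max (A h)" by (rule interval_systemD(3)[OF *(2) AK[OF that] AK[OF that(1) Mx(1)[OF that(1)]]])
    also have "\<dots> \<le> R h" unfolding R_def by (rule interval_systemD(2)[OF *(2) AK[OF that(1) Mx(1)[OF that(1)]]])
    finally show ?thesis by simp
  qed (simp add: R_def)
  have "interval_system \<F> H R"
    unfolding interval_system_def
  proof (intro conjI ballI impI HA(1))
    fix h assume h: "h \<in> H"
    show "h \<le> R h"
      using rR[OF h min_blocksD(2)[OF HA(2) h]] interval_systemD(2)[OF *(2) AK[OF h min_blocksD(2)[OF HA(2) h]]] by simp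
    fix k assume k: "k \<in> H" "h < k"
    have "Max (A h) < k" by (rule min_blocksD(5)[OF HA(2) h k Mx(1)[OF h]])
    then show "R h < k" unfolding R_def
      by (rule interval_systemD(3)[OF *(2) AK[OF h Mx(1)[OF h]] AK[OF k(1) min_blocksD(2)[OF HA(2) k(1)]]])
  qed
  then have 1: "(\<Sum>h\<in>H. norm (\<Sum>i=h..R h. a i *\<^sub>R w i)) \<le> s * norm (\<Sum>i\<le>m. a i *\<^sub>R w i)"
  proof (intro upper_estD[OF u\<F>])
    show "N \<le> h" if "h \<in> H" for h using *(3) AK[OF that min_blocksD(2)[OF HA(2) that]] by blast
  qed (use *(1) in auto)
  have 2: "(\<Sum>g\<in>A h. norm (\<Sum>i=g..r g. a i *\<^sub>R w i)) \<le> t * norm (\<Sum>i=h..R h. a i *\<^sub>R w i)" if h: "h \<in> H" for h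
  proof -
    define b where "b i = (if i \<in> {h..R h} then a i else 0)" for i
    have "(\<Sum>g\<in>A h. norm (\<Sum>i=g..r g. b i *\<^sub>R w i)) \<le> t * norm (\<Sum>i\<le>R h. b i *\<^sub>R w i)"
    proof (rule upper_estD[OF u\<G>])
      show "interval_system \<G> (A h) r"
        using HA(3) h interval_systemD(2,3)[OF *(2)] AK[OF h] by (simp add: interval_system_def)
      show "b i = 0" if "i < N" for i using that *(1) by (simp add: b_def)
      show "b i = 0" if "R h < i" for i using that by (simp add: b_def)
      show "N \<le> g" if "g \<in> A h" for g using AK[OF h that] *(3) by blast
    qed
    also have "(\<Sum>i\<le>R h. b i *\<^sub>R w i) = (\<Sum>i=h..R h. a i *\<^sub>R w i)"
      by (intro sum.mono_neutral_cong_right) (auto simp: b_def)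
    also have "(\<Sum>g\<in>A h. norm (\<Sum>i=g..r g. b i *\<^sub>R w i)) = (\<Sum>g\<in>A h. norm (\<Sum>i=g..r g. a i *\<^sub>R w i))"
    proof (intro sum.cong refl arg_cong[where f = norm])
      fix g i assume g: "g \<in> A h" and i: "i \<in> {g..r g}"
      then have "h \<le> i" "i \<le> R h" using min_blocksD(3)[OF HA(2) h g] rR[OF h g] by auto
      then show "b i *\<^sub>R w i = a i *\<^sub>R w i" by (simp add: b_def)
    qed
    finally show ?thesis .
  qed
  have "(\<Sum>g\<in>K. norm (\<Sum>i=g..r g. a i *\<^sub>R w i)) = (\<Sum>h\<in>H. \<Sum>g\<in>A h. norm (\<Sum>i=g..r g. a i *\<^sub>R w i))"
    unfolding HA(4)
    by (rule sum.UNION_disjoint)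
       (use regularD(3)[OF reg(1) HA(1)] min_blocksD(1)[OF HA(2)] min_blocks_disjoint[OF HA(2)] in \<open>auto simp: disjoint_iff\<close>)
  also have "\<dots> \<le> t * (\<Sum>h\<in>H. norm (\<Sum>i=h..R h. a i *\<^sub>R w i))"
    unfolding sum_distrib_left by (rule sum_mono) (rule 2)
  also have "\<dots> \<le> t * (s * norm (\<Sum>i\<le>m. a i *\<^sub>R w i))"
    using 1 t by (rule mult_left_mono)
  finally show "(\<Sum>g\<in>K. norm (\<Sum>i=g..r g. a i *\<^sub>R w i)) \<le> s * t * norm (\<Sum>i\<le>m. a i *\<^sub>R w i)"
    by (simp add: mult_ac)
qed

text \<open>The reverse of the splitting in \<open>upper_est_family_comp\<close>: inner systems
  confined to successive windows from lo g to hi g form one system of the composed family. An inner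
  system may be empty or start later than g; heredity of \<F> discards the empty ones and spreading
  allows the late starts.\<close>

lemma interval_system_union:
  assumes reg: "regular \<F>" "regular \<G>" and G: "G \<in> \<F>"
    and lo: "\<And>g. g \<in> G \<Longrightarrow> g \<le> lo g" "\<And>g h. g \<in> G \<Longrightarrow> h \<in> G \<Longrightarrow> g < h \<Longrightarrow> hi g < lo h"
    and H: "\<And>g. g \<in> G \<Longrightarrow> interval_system \<G> (H g) (s g)" "\<And>g h. g \<in> G \<Longrightarrow> h \<in> H g \<Longrightarrow> lo g \<le> h"
      "\<And>g h. g \<in> G \<Longrightarrow> h \<in> H g \<Longrightarrow> s g h \<le> hi g"
  shows "\<exists>S. interval_system (family_comp \<F> \<G>) (\<Union> (H ` G)) S \<and> (\<forall>f :: nat \<Rightarrow> nat \<Rightarrow> real.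
    (\<Sum>h\<in>\<Union> (H ` G). f h (S h)) = (\<Sum>g\<in>G. \<Sum>h\<in>H g. f h (s g h)))"
proof -
  have fin: "finite (H g)" if "g \<in> G" for g
    using regularD(3)[OF reg(2) interval_systemD(1)[OF H(1)[OF that]]] .
  have hs: "h \<le> s g h" if "g \<in> G" "h \<in> H g" for g h using interval_systemD(2)[OF H(1)] that by blast
  have sep: "s g h < k" if "g \<in> G" "g' \<in> G" "g < g'" "h \<in> H g" "k \<in> H g'" for g g' h k
    using H(3)[OF that(1,4)] lo(2)[OF that(1,2,3)] H(2)[OF that(2,5)] by simp
  have uniq: "g = g'" if "g \<in> G" "g' \<in> G" "h \<in> H g" "h \<in> H g'" for g g' h
    using sep[of g g' h h] sep[of g' g h h] hs that by (metis leD linorder_neqE_nat)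
  define \<kappa> where "\<kappa> h = (SOME g. g \<in> G \<and> h \<in> H g)" for h
  have \<kappa>: "\<kappa> h = g" if "g \<in> G" "h \<in> H g" for g h
  proof -
    have "\<kappa> h \<in> G \<and> h \<in> H (\<kappa> h)" unfolding \<kappa>_def by (rule someI[of _ g]) (use that in blast)
    then show ?thesis using uniq that by blast
  qed
  define G0 where "G0 = {g \<in> G. H g \<noteq> {}}"
  define \<mu> where "\<mu> g = Min (H g)" for g
  have \<mu>: "\<mu> g \<in> H g" "\<And>h. h \<in> H g \<Longrightarrow> \<mu> g \<le> h" "g \<in> G" if g: "g \<in> G0" for g
  proof -
    have *: "g \<in> G" "H g \<noteq> {}" using g unfolding G0_def by blast+
    show "\<mu> g \<in> H g" unfolding \<mu>_def by (rule Min_in[OF fin[OF *(1)] *(2)])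
    show "\<And>h. h \<in> H g \<Longrightarrow> \<mu> g \<le> h" unfolding \<mu>_def by (rule Min_le[OF fin[OF *(1)]])
    show "g \<in> G" by fact
  qed
  have \<mu>\<kappa>: "\<kappa> (\<mu> g) = g" if "g \<in> G0" for g using \<kappa> \<mu>[OF that] by blast
  have lt: "h < k" if "g \<in> G0" "g' \<in> G0" "g < g'" "h \<in> H g" "k \<in> H g'" for g g' h k
    using sep[OF \<mu>(3)[OF that(1)] \<mu>(3)[OF that(2)] that(3,4,5)] hs[OF \<mu>(3)[OF that(1)] that(4)] by simp
  have "G0 \<in> \<F>" by (rule regularD(1)[OF reg(1) G]) (auto simp: G0_def)
  then have K: "\<mu> ` G0 \<in> \<F>"
  proof (rule regularD(2)[OF reg(1)])
    show "strict_mono_on G0 \<mu>"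
    proof (rule strict_mono_onI)
      fix g g' assume *: "g \<in> G0" "g' \<in> G0" "g < g'"
      show "\<mu> g < \<mu> g'" by (rule lt[OF * \<mu>(1)[OF *(1)] \<mu>(1)[OF *(2)]])
    qed
    show "g \<le> \<mu> g" if "g \<in> G0" for g using lo(1)[OF \<mu>(3)[OF that]] H(2)[OF \<mu>(3)[OF that] \<mu>(1)[OF that]] by simp
  qed
  have comp: "\<Union> (H ` G) \<in> family_comp \<F> \<G>"
  proof (rule family_compI[OF reg(1) K, of "\<lambda>k. H (\<kappa> k)"])
    show "min_blocks (\<mu> ` G0) (\<lambda>k. H (\<kappa> k))"
      unfolding min_blocks_def
    proof (intro conjI ballI impI)
      fix k assume "k \<in> \<mu> ` G0"
      then obtain g where g: "g \<in> G0" "k = \<mu> g" by blast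
      note [simp] = g(2) \<mu>\<kappa>[OF g(1)]
      show "finite (H (\<kappa> k))" "k \<in> H (\<kappa> k)" "\<And>x. x \<in> H (\<kappa> k) \<Longrightarrow> k \<le> x"
        using \<mu>[OF g(1)] fin[OF \<mu>(3)[OF g(1)]] by simp_all
      fix l x assume "l \<in> \<mu> ` G0" "k < l" and x: "x \<in> H (\<kappa> k)"
      then obtain g' where g': "g' \<in> G0" "l = \<mu> g'" "\<mu> g < \<mu> g'" using g by auto
      have "g < g'" using g'(3) lt[OF g'(1) g(1) _ \<mu>(1)[OF g'(1)] \<mu>(1)[OF g(1)]] by (metis linorder_neqE_nat order_less_asym)
      then show "x < l" using lt[OF g(1) g'(1) _ _ \<mu>(1)[OF g'(1)]] x g'(2) by simp
    qed
    show "H (\<kappa> k) \<in> \<G>" if "k \<in> \<mu> ` G0" for k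
    proof -
      from that obtain g where g: "g \<in> G0" "k = \<mu> g" by blast
      show ?thesis using interval_systemD(1)[OF H(1)[OF \<mu>(3)[OF g(1)]]] \<mu>\<kappa>[OF g(1)] g(2) by simp
    qed
    show "\<Union> (H ` G) = (\<Union>k\<in>\<mu> ` G0. H (\<kappa> k))"
    proof -
      have "(\<Union>k\<in>\<mu> ` G0. H (\<kappa> k)) = \<Union> (H ` G0)" using \<mu>\<kappa> by simp
      also have "\<dots> = \<Union> (H ` G)" unfolding G0_def by blast
      finally show ?thesis ..
    qed
  qed
  define S where "S h = s (\<kappa> h) h" for h
  have "interval_system (family_comp \<F> \<G>) (\<Union> (H ` G)) S"
    unfolding interval_system_def
  proof (intro conjI ballI impI comp)
    fix h assume "h \<in> \<Union> (H ` G)"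
    then obtain g where g: "g \<in> G" "h \<in> H g" by blast
    show "h \<le> S h" using hs[OF g] \<kappa>[OF g] by (simp add: S_def)
    fix k assume "k \<in> \<Union> (H ` G)" and hk: "h < k"
    then obtain g' where g': "g' \<in> G" "k \<in> H g'" by blast
    consider "g = g'" | "g < g'" | "g' < g" by linarith
    then show "S h < k"
    proof cases
      case 1
      then show ?thesis using interval_systemD(3)[OF H(1)[OF g(1)] g(2)] g' hk \<kappa>[OF g] by (simp add: S_def)
    next
      case 2
      then show ?thesis using sep[OF g(1) g'(1) _ g(2) g'(2)] \<kappa>[OF g] by (simp add: S_def)
    next
      case 3
      then show ?thesis using sep[OF g'(1) g(1) _ g'(2) g(2)] hs[OF g'] hk by simp
    qed
  qed
  moreover have "(\<Sum>h\<in>\<Union> (H ` G). f h (S h)) = (\<Sum>g\<in>G. \<Sum>h\<in>H g. f h (s g h))" for f :: "nat \<Rightarrow> nat \<Rightarrow> real"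
  proof -
    have "(\<Sum>h\<in>\<Union> (H ` G). f h (S h)) = (\<Sum>g\<in>G. \<Sum>h\<in>H g. f h (S h))"
    proof (rule sum.UNION_disjoint)
      show "\<forall>g\<in>G. \<forall>g'\<in>G. g \<noteq> g' \<longrightarrow> H g \<inter> H g' = {}" using uniq by (meson disjoint_iff)
    qed (use fin regularD(3)[OF reg(1) G] in blast)+
    also have "\<dots> = (\<Sum>g\<in>G. \<Sum>h\<in>H g. f h (s g h))"
      by (intro sum.cong refl) (simp add: S_def \<kappa>)
    finally show ?thesis .
  qed
  ultimately show ?thesis by blast
qed

text \<open>Here \<open>f g h\<close> stands for the norm of the restriction to \<open>{g..h}\<close> of a vector supported in \<open>{s..e}\<close>.\<close>

lemma interval_system_cut:
  assumes isys: "interval_system \<F> G r" and reg: "regular \<F>"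
  shows "\<exists>G' r'. interval_system \<F> G' r' \<and> (\<forall>g\<in>G'. s \<le> g \<and> r' g \<le> e) \<and>
    (\<forall>f :: nat \<Rightarrow> nat \<Rightarrow> real. (\<forall>g h. 1 \<le> g \<longrightarrow> g \<le> h \<longrightarrow>
        f g h = (if max g s \<le> min h e then f (max g s) (min h e) else 0)) \<longrightarrow>
        (\<Sum>g\<in>G. f g (r g)) = (\<Sum>g\<in>G'. f g (r' g)))"
proof -
  define G0 where "G0 = {g \<in> G. max g s \<le> min (r g) e}"
  \<comment> \<open>Left endpoints before s are moved up to s. A surviving interval ends at or after
    s, so the next one starts after s; hence \<phi> stays strictly increasing on the survivors and
    spreading keeps the endpoints in \<F>.\<close>
  define \<phi> where "\<phi> g = max g s" for g
  have G0: "g \<in> G" "\<phi> g \<le> r g" "\<phi> g \<le> e" if "g \<in> G0" for g using that by (auto simp: G0_def \<phi>_def)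
  have \<phi>: "r g < \<phi> h" "\<phi> g < \<phi> h" if "g \<in> G0" "h \<in> G0" "g < h" for g h
  proof -
    have "r g < h" using interval_systemD(3)[OF isys] G0 that by blast
    then show "r g < \<phi> h" "\<phi> g < \<phi> h" using G0(2)[OF that(1)] by (auto simp: \<phi>_def)
  qed
  have sm: "strict_mono_on G0 \<phi>" using \<phi>(2) by (auto simp: strict_mono_on_def)
  have inj: "inj_on \<phi> G0" by (rule strict_mono_on_imp_inj_on[OF sm])
  define r' where "r' k = min (r (inv_into G0 \<phi> k)) e" for k
  have r': "r' (\<phi> g) = min (r g) e" if "g \<in> G0" for g using that inj by (simp add: r'_def)
  have "G0 \<in> \<F>" by (rule regularD(1)[OF reg interval_systemD(1)[OF isys]]) (auto simp: G0_def)
  then have "\<phi> ` G0 \<in> \<F>" by (rule regularD(2)[OF reg _ sm]) (simp add: \<phi>_def)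
  then have 1: "interval_system \<F> (\<phi> ` G0) r'"
    unfolding interval_system_def
  proof (intro conjI ballI impI)
    fix k assume "k \<in> \<phi> ` G0"
    then obtain g where g: "g \<in> G0" "k = \<phi> g" by blast
    then show "k \<le> r' k" using r' G0 by simp
    fix l assume l: "l \<in> \<phi> ` G0" "k < l"
    then obtain h where h: "h \<in> G0" "l = \<phi> h" by blast
    have "g < h" using \<phi>(2)[OF h(1) g(1)] l(2) g h by (metis linorder_neqE_nat order_less_asym)
    then show "r' k < l" using \<phi>(1)[OF g(1) h(1)] g h r' by simp
  qed
  have fin: "finite G" "0 \<notin> G" using regularD(3,4)[OF reg interval_systemD(1)[OF isys]] by auto
  show ?thesis
  proof (intro exI[of _ "\<phi> ` G0"] exI[of _ r'] conjI allI impI 1)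
    show "\<forall>g\<in>\<phi> ` G0. s \<le> g \<and> r' g \<le> e" using r' by (auto simp: \<phi>_def)
    fix f :: "nat \<Rightarrow> nat \<Rightarrow> real"
    assume f: "\<forall>g h. 1 \<le> g \<longrightarrow> g \<le> h \<longrightarrow> f g h = (if max g s \<le> min h e then f (max g s) (min h e) else 0)"
    have f': "f g (r g) = (if max g s \<le> min (r g) e then f (max g s) (min (r g) e) else 0)" if "g \<in> G" for g
    proof -
      have "1 \<le> g" using that fin(2) by (metis One_nat_def Suc_leI gr0I)
      then show ?thesis using f interval_systemD(2)[OF isys that] by blast
    qed
    have "(\<Sum>g\<in>G. f g (r g)) = (\<Sum>g\<in>G0. f (\<phi> g) (min (r g) e))"
      using fin(1) f' by (intro sum.mono_neutral_cong_right) (auto simp: G0_def \<phi>_def)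
    also have "\<dots> = (\<Sum>g\<in>\<phi> ` G0. f g (r' g))" using inj r' by (simp add: sum.reindex)
    finally show "(\<Sum>g\<in>G. f g (r g)) = (\<Sum>g\<in>\<phi> ` G0. f g (r' g))" .
  qed
qed

section \<open>Projections of a Schauder basis\<close>

lemma expansion_coeffs:
  assumes "schauder_basis e"
  shows "expansion e (coeffs_wrt e x) x" and "expansion e a x \<Longrightarrow> coeffs_wrt e x = a"
proof -
  have ex1: "\<exists>!a. expansion e a x" using assms by (simp add: schauder_basis_def)
  show "expansion e (coeffs_wrt e x) x" unfolding coeffs_wrt_def by (rule theI'[OF ex1])
  show "expansion e a x \<Longrightarrow> coeffs_wrt e x = a" unfolding coeffs_wrt_def by (rule the1_equality[OF ex1])
qed

lemma expansion_finite:
  assumes "a 0 = 0" "\<And>i. m < i \<Longrightarrow> a i = 0"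
  shows "expansion e a (\<Sum>i\<le>m. a i *\<^sub>R e i)"
  unfolding expansion_def
proof
  have "\<forall>\<^sub>F n in sequentially. (\<Sum>i=1..n. a i *\<^sub>R e i) = (\<Sum>i\<le>m. a i *\<^sub>R e i)"
    using eventually_ge_at_top[of m]
  proof eventually_elim
    case (elim n)
    have "(\<Sum>i=1..n. a i *\<^sub>R e i) = (\<Sum>i=1..m. a i *\<^sub>R e i)"
      using elim assms(2) by (intro sum.mono_neutral_right) (auto simp: not_le)
    also have "\<dots> = (\<Sum>i\<le>m. a i *\<^sub>R e i)"
      using assms(1) by (intro sum.mono_neutral_left) (auto simp: not_le Suc_le_eq)
    finally show ?case .
  qed
  then show "(\<lambda>n. \<Sum>i=1..n. a i *\<^sub>R e i) \<longlonglongrightarrow> (\<Sum>i\<le>m. a i *\<^sub>R e i)"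
    by (simp add: tendsto_eventually)
qed (rule assms(1))

locale schauder =
  fixes e :: "nat \<Rightarrow> 'a::banach"
  assumes basis: "schauder_basis e"
begin

abbreviation c where "c \<equiv> coeffs_wrt e"

definition P :: "nat \<Rightarrow> 'a \<Rightarrow> 'a" where
  "P n x = (\<Sum>i=1..n. c x i *\<^sub>R e i)"

lemma P_tendsto: "(\<lambda>n. P n x) \<longlonglongrightarrow> x"
  using expansion_coeffs(1)[OF basis, of x] by (simp add: expansion_def P_def)

lemma c_zero_index: "c x 0 = 0"
  using expansion_coeffs(1)[OF basis, of x] by (simp add: expansion_def)

lemma coeffs_eqI: "a 0 = 0 \<Longrightarrow> (\<lambda>n. \<Sum>i=1..n. a i *\<^sub>R e i) \<longlonglongrightarrow> x \<Longrightarrow> c x = a"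
  by (rule expansion_coeffs(2)[OF basis]) (simp add: expansion_def)

lemma coeffs_finite: "a 0 = 0 \<Longrightarrow> (\<And>i. m < i \<Longrightarrow> a i = 0) \<Longrightarrow> c (\<Sum>i\<le>m. a i *\<^sub>R e i) = a"
  by (rule expansion_coeffs(2)[OF basis expansion_finite])

lemma c_add: "c (x + y) i = c x i + c y i"
proof -
  have "c (x + y) = (\<lambda>i. c x i + c y i)"
    using tendsto_add[OF P_tendsto[of x] P_tendsto[of y]]
    by (intro coeffs_eqI) (simp_all add: c_zero_index P_def scaleR_add_left sum.distrib)
  then show ?thesis by simp
qed

lemma c_scale: "c (r *\<^sub>R x) i = r * c x i"
proof -
  have "c (r *\<^sub>R x) = (\<lambda>i. r * c x i)"
    using tendsto_scaleR[OF tendsto_const P_tendsto[of x], of r]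
    by (intro coeffs_eqI) (simp_all add: c_zero_index P_def scaleR_sum_right)
  then show ?thesis by simp
qed

lemma linear_P: "linear (P n)"
  by (rule linearI) (simp_all add: P_def c_add c_scale scaleR_add_left sum.distrib scaleR_sum_right)

lemma P_diff: "P n (x - y) = P n x - P n y"
  using linear_diff[OF linear_P] .

lemma P_scale: "P n (r *\<^sub>R x) = r *\<^sub>R P n x"
  using linear_cmul[OF linear_P] .

lemma P_Suc: "P (Suc n) x = P n x + c x (Suc n) *\<^sub>R e (Suc n)"
  by (simp add: P_def)

lemma c_e: "1 \<le> i \<Longrightarrow> c (e i) = (\<lambda>j. if j = i then 1 else 0)"
proof -
  assume i: "1 \<le> i"
  have "c (\<Sum>j\<le>i. (if j = i then 1 else 0) *\<^sub>R e j) = (\<lambda>j. if j = i then 1 else 0)"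
    by (rule coeffs_finite) (use i in auto)
  moreover have "(\<Sum>j\<le>i. (if j = i then 1 else 0) *\<^sub>R e j) = (\<Sum>j\<le>i. if j = i then e j else 0)"
    by (rule sum.cong) auto
  ultimately show ?thesis by simp
qed

lemma e_nonzero: "1 \<le> i \<Longrightarrow> e i \<noteq> 0"
proof
  assume i: "1 \<le> i" and "e i = 0"
  then have "e i = 0 *\<^sub>R e i" by simp
  then have "c (e i) i = 0 * c (e i) i" by (metis c_scale)
  then show False using c_e[OF i] by simp
qed

lemma P_e: "1 \<le> i \<Longrightarrow> P n (e i) = (if i \<le> n then e i else 0)"
proof -
  assume i: "1 \<le> i"
  have "P n (e i) = (\<Sum>j=1..n. if j = i then e j else 0)"
    unfolding P_def c_e[OF i] by (rule sum.cong) auto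
  then show ?thesis using i by simp
qed

lemma P_span: "P n x \<in> span (e ` {1..n})"
  unfolding P_def by (intro span_sum span_scale span_base) auto

text \<open>The Baire category step and the series argument of the open mapping theorem, carried out for the norm
  \<open>sup\<^sub>n \<parallel>P n x\<parallel>\<close>.\<close>

lemma P_approx:
  obtains M where "0 < M" "\<And>y \<epsilon>. 0 < \<epsilon> \<Longrightarrow> \<exists>z. (\<forall>n. norm (P n z) \<le> M * norm y) \<and> norm (y - z) < \<epsilon>"
proof -
  define B where "B k = {x. \<forall>n. norm (P n x) \<le> real k}" for k
  have Bx: "\<exists>k. x \<in> B k" for x
  proof -
    have "Bseq (\<lambda>n. P n x)" by (rule convergent_imp_Bseq[OF convergentI[OF P_tendsto]])
    then obtain r where r: "\<And>n. norm (P n x) \<le> r" unfolding Bseq_def by auto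
    obtain k where "r \<le> real k" using real_arch_simple by metis
    then have "x \<in> B k" unfolding B_def using r by (auto intro: order_trans)
    then show ?thesis ..
  qed
  have UB: "(\<Union>k. closure (B k)) = UNIV"
  proof (rule UNIV_eq_I[symmetric])
    fix x
    obtain k where "x \<in> B k" using Bx[of x] by (elim exE)
    then have "x \<in> closure (B k)" by (rule subsetD[OF closure_subset])
    then show "x \<in> (\<Union>k. closure (B k))" by (rule UN_I[OF UNIV_I])
  qed
  have "\<exists>k. interior (closure (B k)) \<noteq> {}"
  proof (rule ccontr)
    assume *: "\<not> ?thesis"
    have "euclidean interior_of \<Union> (range (\<lambda>k. closure (B k))) = {}"
      by (rule Baire_category_alt) (use * in \<open>auto simp: completely_metrizable_space_euclidean\<close>)
    then show False using UB interior_of_topspace[of euclidean] by simp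
  qed
  then obtain k x0 where "x0 \<in> interior (closure (B k))" by blast
  then obtain r where r: "0 < r" "ball x0 r \<subseteq> closure (B k)"
    by (meson mem_interior)
  have small: "\<exists>z. (\<forall>n. norm (P n z) \<le> 2 * real k) \<and> norm (y - z) < \<epsilon>" if y: "norm y < r" and \<epsilon>: "0 < \<epsilon>" for y \<epsilon>
  proof -
    have "x0 + y \<in> closure (B k)" "x0 \<in> closure (B k)" using r y by (auto simp: dist_norm subset_iff)
    then obtain u v where uv: "u \<in> B k" "dist u (x0 + y) < \<epsilon> / 2" "v \<in> B k" "dist v x0 < \<epsilon> / 2"
      using \<epsilon> half_gt_zero unfolding closure_approachable by metis
    have "norm (y - (u - v)) = norm (((x0 + y) - u) - (x0 - v))" by (simp add: algebra_simps)
    also have "\<dots> \<le> dist u (x0 + y) + dist v x0"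
      using norm_triangle_ineq4[of "(x0 + y) - u" "x0 - v"] by (simp add: dist_norm norm_minus_commute)
    finally have "norm (y - (u - v)) < \<epsilon>" using uv by simp
    moreover have "norm (P n (u - v)) \<le> 2 * real k" for n
      using uv(1,3) norm_triangle_ineq4[of "P n u" "P n v"] unfolding B_def P_diff
      by (smt (verit) mem_Collect_eq)
    ultimately show ?thesis by blast
  qed
  have zero: "P n 0 = 0" for n by (rule linear_0[OF linear_P])
  \<comment> \<open>Scaling y to norm r / 2, applying \<open>small\<close> with its bound 2 k and
    scaling back gives the factor 4 k / r. The summand 1 makes M positive.\<close>
  define M where "M = 4 * real k / r + 1"
  have "0 < M" using r by (simp add: M_def add_nonneg_pos)
  moreover have "\<exists>z. (\<forall>n. norm (P n z) \<le> M * norm y) \<and> norm (y - z) < \<epsilon>" if \<epsilon>: "0 < \<epsilon>" for y \<epsilon>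
  proof (cases "y = 0")
    case True
    then show ?thesis using \<epsilon> zero by (intro exI[of _ 0]) simp
  next
    case False
    define s where "s = r / (2 * norm y)"
    have s: "0 < s" using r False by (simp add: s_def)
    have "norm (s *\<^sub>R y) < r" using r False by (simp add: s_def)
    then obtain z where z: "\<And>n. norm (P n z) \<le> 2 * real k" "norm (s *\<^sub>R y - z) < s * \<epsilon>"
      using small s \<epsilon> by (metis mult_pos_pos)
    have "norm (P n (inverse s *\<^sub>R z)) \<le> M * norm y" for n
    proof -
      have "norm (P n (inverse s *\<^sub>R z)) = inverse s * norm (P n z)" using s by (simp add: P_scale)
      also have "\<dots> \<le> inverse s * (2 * real k)" using s z(1) by (intro mult_left_mono) auto
      also have "\<dots> = 4 * real k / r * norm y" by (simp add: s_def)
      also have "\<dots> \<le> M * norm y" by (simp add: M_def distrib_right)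
      finally show ?thesis .
    qed
    moreover have "y - inverse s *\<^sub>R z = inverse s *\<^sub>R (s *\<^sub>R y - z)"
      using s by (simp add: scaleR_diff_right)
    then have "norm (y - inverse s *\<^sub>R z) = inverse s * norm (s *\<^sub>R y - z)"
      using s by simp
    then have "norm (y - inverse s *\<^sub>R z) < \<epsilon>"
      using mult_strict_left_mono[OF z(2), of "inverse s"] s by (simp add: mult.assoc[symmetric])
    ultimately show ?thesis by blast
  qed
  ultimately show ?thesis using that by blast
qed

lemma P_bounded:
  obtains K where "1 \<le> K" "\<And>n x. norm (P n x) \<le> K * norm x"
proof -
  obtain M where M: "0 < M" "\<And>y \<epsilon>. 0 < \<epsilon> \<Longrightarrow> \<exists>z. (\<forall>n. norm (P n z) \<le> M * norm y) \<and> norm (y - z) < \<epsilon>"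
    using P_approx by blast
  have "norm (P n x) \<le> (2 * M) * norm x" if x: "x \<noteq> 0" for n x
  proof -
    define b where "b = norm x"
    have b: "0 < b" using x by (simp add: b_def)
    have "\<forall>y \<epsilon>. \<exists>z. 0 < \<epsilon> \<longrightarrow> (\<forall>n. norm (P n z) \<le> M * norm y) \<and> norm (y - z) < \<epsilon>" using M(2) by blast
    then obtain Z where Z: "\<And>y \<epsilon> n. 0 < \<epsilon> \<Longrightarrow> norm (P n (Z y \<epsilon>)) \<le> M * norm y" "\<And>y \<epsilon>. 0 < \<epsilon> \<Longrightarrow> norm (y - Z y \<epsilon>) < \<epsilon>"
      by metis
    \<comment> \<open>R k is the error left after k approximations. Halving its bound each time
      makes the approximants z k a series with sum x whose projections are bounded by M b / 2^k,
      uniformly in n.\<close>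
    define R where "R = rec_nat x (\<lambda>k y. y - Z y ((1/2) ^ Suc k * b))"
    define z where "z k = Z (R k) ((1/2) ^ Suc k * b)" for k
    have R: "R 0 = x" "R (Suc k) = R k - z k" for k by (simp_all add: R_def z_def)
    have Rn: "norm (R k) \<le> (1/2) ^ k * b" for k
    proof (cases k)
      case (Suc j)
      show ?thesis unfolding Suc R(2) z_def using Z(2)[of "(1/2) ^ Suc j * b" "R j"] b by (simp add: less_imp_le)
    qed (simp add: R b_def)
    have zP: "norm (P n (z k)) \<le> M * b * (1/2) ^ k" for n k
    proof -
      have "norm (P n (z k)) \<le> M * norm (R k)" unfolding z_def using Z(1) b by simp
      also have "\<dots> \<le> M * ((1/2) ^ k * b)" using Rn M(1) by (intro mult_left_mono) auto
      finally show ?thesis by (simp add: mult_ac)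
    qed
    have zn: "norm (z k) \<le> M * b * (1/2) ^ k" for k
      by (rule LIMSEQ_le_const2[OF tendsto_norm[OF P_tendsto]]) (use zP in blast)
    have geo: "summable (\<lambda>k. C * (1/2::real) ^ k)" for C by (intro summable_mult summable_geometric) simp
    have sumR: "(\<Sum>k<n. z k) = x - R n" for n by (induction n) (simp_all add: R)
    have "R \<longlonglongrightarrow> 0"
    proof (rule Lim_null_comparison)
      show "\<forall>\<^sub>F k in sequentially. norm (R k) \<le> (1/2) ^ k * b" using Rn by simp
      show "(\<lambda>k. (1/2) ^ k * b) \<longlonglongrightarrow> 0" by (intro tendsto_mult_left_zero LIMSEQ_power_zero) simp
    qed
    then have zs: "z sums x" unfolding sums_def sumR using tendsto_diff[OF tendsto_const[of x]] by force
    have cs: "summable (\<lambda>k. c (z k) i)" for i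
    proof (cases i)
      case (Suc j)
      show ?thesis
      proof (rule summable_comparison_test'[OF geo[of "2 * M * b / norm (e i)"], of 0])
        fix k
        have "c (z k) i *\<^sub>R e i = P i (z k) - P j (z k)" by (simp add: Suc P_Suc)
        then have "\<bar>c (z k) i\<bar> * norm (e i) \<le> norm (P i (z k)) + norm (P j (z k))"
          by (metis norm_scaleR norm_triangle_ineq4)
        also have "\<dots> \<le> 2 * (M * b * (1/2) ^ k)" using zP[of i k] zP[of j k] by simp
        finally show "norm (c (z k) i) \<le> 2 * M * b / norm (e i) * (1/2) ^ k"
          using e_nonzero[of i] Suc by (simp add: field_simps)
      qed
    qed (simp add: c_zero_index)
    define a where "a i = (\<Sum>k. c (z k) i)" for i
    have Psm: "summable (\<lambda>k. P n (z k))" for n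
      by (rule summable_comparison_test'[OF geo[of "M * b"], of 0]) (rule zP)
    have y: "(\<Sum>i=1..n. a i *\<^sub>R e i) = (\<Sum>k. P n (z k))" for n
    proof -
      have "(\<Sum>k. P n (z k)) = (\<Sum>i=1..n. \<Sum>k. c (z k) i *\<^sub>R e i)"
        unfolding P_def by (rule suminf_sum) (rule summable_scaleR_left[OF cs])
      also have "\<dots> = (\<Sum>i=1..n. a i *\<^sub>R e i)"
        unfolding a_def by (rule sum.cong[OF refl]) (rule suminf_scaleR_left[OF cs, symmetric])
      finally show ?thesis ..
    qed
    \<comment> \<open>The limit in n and the sum over k are interchanged by Tannery's theorem, with
      the summable majorant 2 M b / 2^k.\<close>
    have lim: "(\<lambda>n. (\<Sum>k. P n (z k)) - x) \<longlonglongrightarrow> 0"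
    proof (rule Lim_null_comparison)
      define g where "g k n = norm (P n (z k) - z k)" for k n
      have gb: "norm (g k n) \<le> 2 * (M * b) * (1/2) ^ k" for k n
        using zP[of n k] zn[of k] norm_triangle_ineq4[of "P n (z k)" "z k"] by (simp add: g_def)
      have gs: "summable (\<lambda>k. g k n)" for n
        by (rule summable_comparison_test'[OF geo[of "2 * (M * b)"], of 0]) (rule gb)
      show "\<forall>\<^sub>F n in sequentially. norm ((\<Sum>k. P n (z k)) - x) \<le> (\<Sum>k. g k n)"
      proof (rule always_eventually, rule allI)
        fix n
        have "(\<Sum>k. P n (z k)) - x = (\<Sum>k. P n (z k) - z k)"
          using suminf_diff[OF Psm sums_summable[OF zs]] sums_unique[OF zs] by simp
        also have "norm \<dots> \<le> (\<Sum>k. g k n)"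
          unfolding g_def by (rule summable_norm) (use gs in \<open>simp add: g_def\<close>)
        finally show "norm ((\<Sum>k. P n (z k)) - x) \<le> (\<Sum>k. g k n)" .
      qed
      have "(g k \<longlongrightarrow> 0) sequentially" for k
        unfolding g_def using tendsto_norm_zero[OF LIM_zero[OF P_tendsto[of "z k"]]] .
      then have "(\<lambda>n. \<Sum>k. g k n) \<longlonglongrightarrow> (\<Sum>k. 0)"
        using tannerys_theorem[of g "\<lambda>_. 0" sequentially "\<lambda>k. 2 * (M * b) * (1/2) ^ k"] gb geo[of "2 * (M * b)"]
        by (simp add: always_eventually case_prod_unfold)
      then show "(\<lambda>n. \<Sum>k. g k n) \<longlonglongrightarrow> 0" by simp
    qed
    have "c x = a"
    proof (rule coeffs_eqI)
      show "a 0 = 0" by (simp add: a_def c_zero_index)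
      show "(\<lambda>n. \<Sum>i=1..n. a i *\<^sub>R e i) \<longlonglongrightarrow> x" unfolding y by (rule LIM_zero_cancel[OF lim])
    qed
    then have "P n x = (\<Sum>k. P n (z k))" using y[of n] by (simp add: P_def)
    also have "norm \<dots> \<le> (\<Sum>k. M * b * (1/2) ^ k)"
      by (rule norm_suminf_le[OF zP geo])
    also have "\<dots> = M * b * 2" using suminf_mult[OF summable_geometric[of "1/2::real"], of "M * b"] suminf_geometric[of "1/2::real"] by simp
    finally show ?thesis by (simp add: b_def mult_ac)
  qed
  then have "norm (P n x) \<le> (2 * M + 1) * norm x" for n x
    using M(1) linear_0[OF linear_P] by (cases "x = 0") (auto simp: distrib_right intro: add_increasing2)
  then show ?thesis using that[of "2 * M + 1"] M(1) by simp
qed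

end

section \<open>Restrictions along block sequences as differences of basis projections\<close>

lemma span_tail_sum:
  fixes w :: "nat \<Rightarrow> 'a::real_vector"
  assumes "x \<in> span (w ` {N..})"
  obtains a m where "\<And>i. i < N \<Longrightarrow> a i = 0" "\<And>i. m < i \<Longrightarrow> a i = 0" "x = (\<Sum>i\<le>m. a i *\<^sub>R w i)"
proof -
  have "\<exists>a m. (\<forall>i. i < N \<or> m < i \<longrightarrow> a i = 0) \<and> x = (\<Sum>i\<le>m. a i *\<^sub>R w i)"
    using assms
  proof (induction rule: span_induct_alt)
    case base
    show ?case by (intro exI[of _ "\<lambda>_. 0"] exI[of _ 0]) simp
  next
    case (step c x y)
    then obtain i where i: "N \<le> i" "x = w i" by auto
    from step obtain a m where a: "\<And>i. i < N \<or> m < i \<Longrightarrow> a i = 0" "y = (\<Sum>i\<le>m. a i *\<^sub>R w i)" by blast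
    define b where "b j = a j + (if j = i then c else 0)" for j
    have "(\<Sum>j\<le>max m i. b j *\<^sub>R w j) = (\<Sum>j\<le>max m i. a j *\<^sub>R w j) + (\<Sum>j\<le>max m i. if j = i then c *\<^sub>R w j else 0)"
      unfolding sum.distrib[symmetric] by (rule sum.cong) (auto simp: b_def scaleR_add_left)
    also have "(\<Sum>j\<le>max m i. a j *\<^sub>R w j) = y"
      unfolding a(2) by (rule sum.mono_neutral_right) (use a(1) in auto)
    finally have "c *\<^sub>R x + y = (\<Sum>j\<le>max m i. b j *\<^sub>R w j)" using i by simp
    moreover have "b j = 0" if "j < N \<or> max m i < j" for j using that a(1) i by (auto simp: b_def)
    ultimately show ?case by blast
  qed
  then show ?thesis using that by blast
qed

lemma sum_in_span_tail:
  fixes w :: "nat \<Rightarrow> 'a::real_vector"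
  shows
  "(\<And>i. i < N \<Longrightarrow> a i = 0) \<Longrightarrow> (\<Sum>i\<in>A. a i *\<^sub>R w i) \<in> span (w ` {N..})"
proof (rule span_sum)
  fix i assume "\<And>i. i < N \<Longrightarrow> a i = 0"
  then show "a i *\<^sub>R w i \<in> span (w ` {N..})"
    by (cases "i < N") (simp_all add: span_zero span_scale span_base)
qed

lemma subspace_closure:
  fixes S :: "'a::real_normed_vector set"
  assumes "subspace S"
  shows "subspace (closure S)"
proof (rule subspaceI)
  show "0 \<in> closure S" using closure_subset subspace_0[OF assms] by blast
  fix x y assume "x \<in> closure S" "y \<in> closure S"
  then obtain f g where fg: "\<And>n. f n \<in> S" "f \<longlonglongrightarrow> x" "\<And>n. g n \<in> S" "g \<longlonglongrightarrow> y"
    by (auto simp: closure_sequential)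
  then show "x + y \<in> closure S"
    using tendsto_add[OF fg(2,4)] subspace_add[OF assms fg(1,3)]
    unfolding closure_sequential by (intro exI[of _ "\<lambda>n. f n + g n"]) simp
  show "c *\<^sub>R x \<in> closure S" for c
    using tendsto_scaleR[OF tendsto_const fg(2), of c] subspace_scale[OF assms fg(1)]
    unfolding closure_sequential by (intro exI[of _ "\<lambda>n. c *\<^sub>R f n"]) simp
qed

locale schauder_bound = schauder +
  fixes K :: real
  assumes K1: "1 \<le> K" and P_bound: "norm (P n x) \<le> K * norm x"
begin

lemma P_sum: "P n (sum f A) = (\<Sum>i\<in>A. P n (f i))"
  by (rule linear_sum[OF linear_P])

lemma P_add: "P n (x + y) = P n x + P n y"
  by (rule linear_add[OF linear_P])

lemma P_zero: "P n 0 = 0"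
  by (rule linear_0[OF linear_P])

lemma bounded_linear_P: "bounded_linear (P n)"
  by (rule bounded_linear_intro[of _ K]) (use P_bound P_add P_scale in \<open>auto simp: mult.commute\<close>)

lemma continuous_P: "isCont (P n) x"
  using linear_continuous_at[OF bounded_linear_P] .

lemma P_fix: "x \<in> span (e ` A) \<Longrightarrow> (\<And>i. i \<in> A \<Longrightarrow> 1 \<le> i \<and> i \<le> n) \<Longrightarrow> P n x = x"
proof (induction rule: span_induct_alt)
  case (step c x y)
  then show ?case by (auto simp: P_add P_scale P_e)
qed (simp add: P_zero)

lemma P_vanish: "x \<in> span (e ` A) \<Longrightarrow> (\<And>i. i \<in> A \<Longrightarrow> n < i) \<Longrightarrow> P n x = 0"
proof (induction rule: span_induct_alt)
  case (step c x y)
  then obtain i where "i \<in> A" "x = e i" by blast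
  then have "P n x = 0" using step.prems[of i] P_e[of i n] by simp
  then show ?case using step by (simp add: P_add P_scale)
qed (simp add: P_zero)

lemma P_block:
  assumes "blocks w e p N" "N \<le> i"
  shows "p i \<le> n \<Longrightarrow> P n (w i) = w i" "n \<le> p (i - 1) \<Longrightarrow> P n (w i) = 0"
  using P_fix[OF blocksD(4)[OF assms]] P_vanish[OF blocksD(4)[OF assms]]
  by (auto simp: Suc_le_eq intro!: P_fix[OF blocksD(4)[OF assms]])

lemma P_block_sum:
  assumes bl: "blocks w e p N" and a: "\<And>i. i < N \<Longrightarrow> a i = 0" "\<And>i. m < i \<Longrightarrow> a i = 0"
  shows "P (p h) (\<Sum>i\<le>m. a i *\<^sub>R w i) = (\<Sum>i\<le>h. a i *\<^sub>R w i)"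
proof -
  have "a i *\<^sub>R P (p h) (w i) = (if i \<le> h then a i *\<^sub>R w i else 0)" for i
  proof (cases "N \<le> i")
    case True
    show ?thesis
    proof (cases "i \<le> h")
      case True
      then have "p i \<le> p h" using strict_mono_less_eq[OF blocksD(1)[OF bl]] by simp
      then show ?thesis using True P_block(1)[OF bl \<open>N \<le> i\<close>] by simp
    next
      case False
      then have "p h \<le> p (i - 1)" using strict_mono_less_eq[OF blocksD(1)[OF bl]] by simp
      then show ?thesis using False P_block(2)[OF bl \<open>N \<le> i\<close>] by simp
    qed
  qed (use a in simp)
  then have "P (p h) (\<Sum>i\<le>m. a i *\<^sub>R w i) = (\<Sum>i\<le>m. if i \<le> h then a i *\<^sub>R w i else 0)"
    by (simp add: P_sum P_scale)
  also have "\<dots> = (\<Sum>i\<in>{..m} \<inter> {..h}. a i *\<^sub>R w i)"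
    by (simp only: sum.inter_restrict finite_atMost atMost_iff)
  also have "\<dots> = (\<Sum>i\<le>h. a i *\<^sub>R w i)"
    by (rule sum.mono_neutral_left) (use a in auto)
  finally show ?thesis .
qed

text \<open>The restriction to the blocks g to h of a block sequence with interval ends p, expressed
  by projections of the basis e. As a bounded operator on the whole space it applies to closed spans
  without any expansion along the block sequence.\<close>

definition Q :: "(nat \<Rightarrow> nat) \<Rightarrow> nat \<Rightarrow> nat \<Rightarrow> 'a \<Rightarrow> 'a" where
  "Q p g h x = P (p h) x - P (p (g - 1)) x"

lemma bounded_linear_Q: "bounded_linear (Q p g h)"
  unfolding Q_def by (intro bounded_linear_sub bounded_linear_P)

lemma Q_add: "Q p g h (x + y) = Q p g h x + Q p g h y"
  and Q_diff: "Q p g h (x - y) = Q p g h x - Q p g h y"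
  and Q_scale: "Q p g h (r *\<^sub>R x) = r *\<^sub>R Q p g h x"
  by (simp_all add: Q_def P_add P_diff P_scale algebra_simps)

lemma Q_block_sum:
  assumes bl: "blocks w e p N" and a: "\<And>i. i < N \<Longrightarrow> a i = 0" "\<And>i. m < i \<Longrightarrow> a i = 0" and gh: "1 \<le> g" "g \<le> h"
  shows "Q p g h (\<Sum>i\<le>m. a i *\<^sub>R w i) = (\<Sum>i=g..h. a i *\<^sub>R w i)"
proof -
  have "{..h} = {..g - 1} \<union> {g..h}" using gh by auto
  then have "(\<Sum>i\<le>h. a i *\<^sub>R w i) = (\<Sum>i\<le>g - 1. a i *\<^sub>R w i) + (\<Sum>i=g..h. a i *\<^sub>R w i)"
    using gh by (simp add: sum.union_disjoint disjoint_iff)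
  then show ?thesis using P_block_sum[OF bl a] by (simp add: Q_def)
qed

lemma upper_est_Q:
  assumes bl: "blocks w e p N" and u: "upper_est \<F> w M t" and NM: "N \<le> M"
    and x: "x \<in> span (w ` {M..})" and isys: "interval_system \<F> G r" "\<And>g. g \<in> G \<Longrightarrow> M \<le> g"
  shows "(\<Sum>g\<in>G. norm (Q p g (r g) x)) \<le> t * norm x"
proof -
  obtain a m where a: "\<And>i. i < M \<Longrightarrow> a i = 0" "\<And>i. m < i \<Longrightarrow> a i = 0" "x = (\<Sum>i\<le>m. a i *\<^sub>R w i)"
    using span_tail_sum[OF x] by blast
  have "Q p g (r g) x = (\<Sum>i=g..r g. a i *\<^sub>R w i)" if g: "g \<in> G" for g
    unfolding a(3)
    by (rule Q_block_sum[OF bl])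
       (use a isys(2)[OF g] NM blocksD(2)[OF bl] interval_systemD(2)[OF isys(1) g] in auto)
  then show ?thesis using upper_estD[OF u a(1,2) isys] by (simp add: a(3))
qed

text \<open>A tail is the vector minus one of its projections. The factor 1 + K enters only where a
  constant has to be finite, whatever its size.\<close>

lemma tail_bound:
  assumes bl: "blocks w e p N" and a: "\<And>i. i < N \<Longrightarrow> a i = 0" "\<And>i. m < i \<Longrightarrow> a i = 0" and s: "1 \<le> s"
  shows "norm (\<Sum>i=s..m. a i *\<^sub>R w i) \<le> (1 + K) * norm (\<Sum>i\<le>m. a i *\<^sub>R w i)"
proof -
  let ?x = "\<Sum>i\<le>m. a i *\<^sub>R w i"
  have "(\<Sum>i=s..m. a i *\<^sub>R w i) = ?x - P (p (s - 1)) ?x"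
  proof (cases "s \<le> m")
    case True
    have "Q p s m ?x = (\<Sum>i=s..m. a i *\<^sub>R w i)" by (rule Q_block_sum[OF bl a s True])
    moreover have "P (p m) ?x = ?x" by (rule P_block_sum[OF bl a])
    ultimately show ?thesis by (simp add: Q_def)
  next
    case False
    have "P (p (s - 1)) ?x = (\<Sum>i\<le>s - 1. a i *\<^sub>R w i)" by (rule P_block_sum[OF bl a])
    also have "\<dots> = ?x" using False a(2) by (intro sum.mono_neutral_right) auto
    finally show ?thesis using False by simp
  qed
  also have "norm \<dots> \<le> norm ?x + K * norm ?x"
    using norm_triangle_ineq4[of ?x "P (p (s - 1)) ?x"] P_bound[of "p (s - 1)" ?x] by linarith
  finally show ?thesis by (simp add: distrib_right)
qed

text \<open>The difference of P (p i) and P (p (i - 1)) fixes w i and annihilates every other block,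
  so these operators act as a biorthogonal system.\<close>

lemma blocks_inj_independent:
  assumes bl: "blocks w e p N"
  shows "inj_on w {N..}" "independent (w ` {N..})"
proof -
  have R: "P (p i) (w j) - P (p (i - 1)) (w j) = (if i = j then w j else 0)" if ij: "N \<le> i" "N \<le> j" for i j
  proof -
    consider "i = j" | "i < j" | "j < i" by linarith
    then show ?thesis
    proof cases
      case 1
      then show ?thesis using P_block[OF bl ij(2)] by simp
    next
      case 2
      then have "p i \<le> p (j - 1)" "p (i - 1) \<le> p (j - 1)"
        using strict_mono_less_eq[OF blocksD(1)[OF bl]] by auto
      then show ?thesis using 2 P_block(2)[OF bl ij(2)] by simp
    next
      case 3
      then have "p j \<le> p i" "p j \<le> p (i - 1)"
        using strict_mono_less_eq[OF blocksD(1)[OF bl]] by auto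
      then show ?thesis using 3 P_block(1)[OF bl ij(2)] by simp
    qed
  qed
  show "inj_on w {N..}"
    by (rule inj_onI) (metis R atLeast_iff blocksD(3)[OF bl])
  show "independent (w ` {N..})"
    unfolding dependent_def
  proof clarsimp
    fix i assume i: "N \<le> i" and *: "w i \<in> span (w ` {N..} - {w i})"
    have "P (p i) x - P (p (i - 1)) x = 0" if "x \<in> span (w ` {N..} - {w i})" for x
      using that
    proof (induction rule: span_induct_alt)
      case (step c x y)
      then obtain j where "N \<le> j" "x = w j" "i \<noteq> j" by auto
      then have "P (p i) x - P (p (i - 1)) x = 0" using R[OF i] by simp
      then show ?case using step by (simp add: P_add P_scale)
    qed (simp add: P_zero)
    then have "w i = 0" using * R[OF i i] by simp
    then show False using blocksD(3)[OF bl i] by simp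
  qed
qed

lemma infdim_block_span:
  assumes bl: "blocks w e p N" and M: "N \<le> M"
  shows "infdim_subspace (closure (span (w ` {M..})))"
  unfolding infdim_subspace_def
proof (intro conjI notI)
  show "subspace (closure (span (w ` {M..})))" by (intro subspace_closure subspace_span)
  show "closed (closure (span (w ` {M..})))" by simp
  assume "\<exists>B. finite B \<and> span B = closure (span (w ` {M..}))"
  then obtain B where B: "finite B" "span B = closure (span (w ` {M..}))" by blast
  note ii = blocks_inj_independent[OF blocks_mono[OF bl M]]
  have "w ` {M..} \<subseteq> span B" unfolding B(2) by (rule subset_trans[OF span_superset closure_subset])
  then have "finite (w ` {M..})" using independent_span_bound[OF B(1) ii(2)] by simp
  then show False using finite_imageD[OF _ ii(1)] infinite_Ici by blast
qed

lemma closure_eq_zeroI: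
  assumes "x \<in> closure S" "\<And>y. y \<in> S \<Longrightarrow> P n y = 0"
  shows "P n x = 0"
proof -
  obtain f where f: "\<And>k. f k \<in> S" "f \<longlonglongrightarrow> x" using assms(1) by (auto simp: closure_sequential)
  have "(\<lambda>k. P n (f k)) \<longlonglongrightarrow> P n x" by (rule isCont_tendsto_compose[OF continuous_P f(2)])
  then show ?thesis using assms(2)[OF f(1)] by (simp add: LIMSEQ_const_iff)
qed

text \<open>\<open>restr_wrt\<close> refers to the unique expansion along w, so w has to be
  recognised as a basic sequence. The one-block projections of x supply coefficients, telescope to
  projections of e and hence converge to x; applied to any other expansion they recover the same
  coefficients.\<close>

lemma restr_wrt_block:
  assumes bl: "blocks w e p 1" and x: "x \<in> clspan_from w 1" and gh: "1 \<le> g" "g \<le> h"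
  shows "restr_wrt w {g..h} x = Q p g h x"
proof -
  note sm = blocksD(1)[OF bl]
  have xc: "x \<in> closure (span (w ` {1..}))" using x by (simp add: clspan_from_def)
  have R: "\<exists>\<alpha>. Q p i i x = \<alpha> *\<^sub>R w i" if i: "1 \<le> i" for i
  proof -
    \<comment> \<open>On the linear span of w the operator Q p i i has values in the line of w i.
      Closedness of that line extends this to limits.\<close>
    have cl: "closed (range (\<lambda>\<alpha>. \<alpha> *\<^sub>R w i))"
    proof (rule complete_imp_closed)
      have "0 < norm (w i)" using blocksD(3)[OF bl i] by simp
      then show "complete (range (\<lambda>\<alpha>. \<alpha> *\<^sub>R w i))"
        by (rule complete_isometric_image) (auto simp: bounded_linear_scaleR_left mult.commute complete_UNIV)
    qed
    obtain f where f: "\<And>k. f k \<in> span (w ` {1..})" "f \<longlonglongrightarrow> x" using xc by (auto simp: closure_sequential)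
    have "Q p i i (f k) \<in> range (\<lambda>\<alpha>. \<alpha> *\<^sub>R w i)" for k
    proof -
      obtain a m where a: "\<And>i. i < 1 \<Longrightarrow> a i = 0" "\<And>i. m < i \<Longrightarrow> a i = 0" "f k = (\<Sum>i\<le>m. a i *\<^sub>R w i)"
        using span_tail_sum[OF f(1)] by blast
      have "Q p i i (f k) = a i *\<^sub>R w i"
        unfolding a(3) using Q_block_sum[OF bl a(1) a(2) i order_refl] by simp
      then show ?thesis by blast
    qed
    moreover have "(\<lambda>k. Q p i i (f k)) \<longlonglongrightarrow> Q p i i x"
      using bounded_linear.tendsto[OF bounded_linear_Q f(2)] .
    ultimately have "Q p i i x \<in> range (\<lambda>\<alpha>. \<alpha> *\<^sub>R w i)" by (rule closed_sequentially[OF cl])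
    then show ?thesis by blast
  qed
  then obtain \<alpha> where \<alpha>: "\<And>i. 1 \<le> i \<Longrightarrow> Q p i i x = \<alpha> i *\<^sub>R w i" by metis
  define a where "a i = (if i = 0 then 0 else \<alpha> i)" for i
  have a: "a i *\<^sub>R w i = Q p i i x" if "1 \<le> i" for i using \<alpha>[OF that] that by (simp add: a_def)
  have tele: "(\<Sum>i=g..h. a i *\<^sub>R w i) = P (p h) x - P (p (g - 1)) x" if "1 \<le> g" "g \<le> Suc h" for g h
    using that(2)
  proof (induction h)
    case 0
    then show ?case using that(1) a[of 1] by (cases "g = 1") (auto simp: Q_def)
  next
    case (Suc h)
    then show ?case using a[of "Suc h"] that(1) by (cases "g = Suc (Suc h)") (auto simp: Q_def)
  qed
  have P0: "P (p 0) x = 0"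
  proof (rule closure_eq_zeroI[OF xc])
    fix y assume "y \<in> span (w ` {1..})"
    then show "P (p 0) y = 0"
    proof (induction rule: span_induct_alt)
      case (step c x y)
      then obtain i where i: "1 \<le> i" "x = w i" by auto
      have "p 0 \<le> p (i - 1)" using strict_mono_less_eq[OF sm] by simp
      then show ?case using step P_block(2)[OF bl i(1)] i(2) by (simp add: P_add P_scale)
    qed (rule P_zero)
  qed
  have ex: "expansion w a x"
    unfolding expansion_def
  proof
    have "(\<lambda>n. \<Sum>i=1..n. a i *\<^sub>R w i) = (\<lambda>n. P n x) \<circ> p"
      using tele[of 1] P0 by (auto simp: fun_eq_iff)
    then show "(\<lambda>n. \<Sum>i=1..n. a i *\<^sub>R w i) \<longlonglongrightarrow> x"
      using LIMSEQ_subseq_LIMSEQ[OF P_tendsto sm] by simp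
  qed (simp add: a_def)
  have uni: "b = a" if b: "expansion w b x" for b
  proof
    fix n
    have b0: "b 0 = 0" and lim: "(\<lambda>k. \<Sum>i=1..k. b i *\<^sub>R w i) \<longlonglongrightarrow> x" using b by (auto simp: expansion_def)
    show "b n = a n"
    proof (cases "n = 0")
      case False
      then have n: "1 \<le> n" by simp
      have lim1: "(\<lambda>k. Q p n n (\<Sum>i=1..k. b i *\<^sub>R w i)) \<longlonglongrightarrow> Q p n n x"
        by (rule bounded_linear.tendsto[OF bounded_linear_Q lim])
      have lim2: "\<forall>\<^sub>F k in sequentially. Q p n n (\<Sum>i=1..k. b i *\<^sub>R w i) = b n *\<^sub>R w n"
        using eventually_ge_at_top[of n]
      proof eventually_elim
        case (elim k)
        define d where "d i = (if i \<le> k then b i else 0)" for i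
        have "(\<Sum>i=1..k. b i *\<^sub>R w i) = (\<Sum>i\<le>k. d i *\<^sub>R w i)"
          by (rule sum.mono_neutral_cong_left) (auto simp: d_def b0 not_le Suc_le_eq)
        moreover have "Q p n n (\<Sum>i\<le>k. d i *\<^sub>R w i) = (\<Sum>i=n..n. d i *\<^sub>R w i)"
          by (rule Q_block_sum[OF bl]) (use n in \<open>auto simp: d_def b0\<close>)
        ultimately show ?case using elim by (simp add: d_def)
      qed
      have "Q p n n x = b n *\<^sub>R w n"
        by (rule LIMSEQ_unique[OF lim1 tendsto_eventually[OF lim2]])
      then have "b n *\<^sub>R w n = a n *\<^sub>R w n" using a[OF n] by auto
      moreover have "w n \<noteq> 0" by (rule blocksD(3)[OF bl n])
      ultimately show ?thesis by auto
    qed (simp add: a_def b0)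
  qed
  have "coeffs_wrt w x = a"
    unfolding coeffs_wrt_def by (rule the_equality) (fact ex, rule uni)
  then show ?thesis using tele[of g h] gh by (simp add: restr_wrt_def Q_def)
qed

end

section \<open>Finiteness of the constants\<close>

context schauder_bound
begin

lemma blocks_self: "blocks e e (\<lambda>i. i) 1"
  unfolding blocks_def using e_nonzero by (auto simp: strict_mono_def intro!: span_base)

text \<open>The intervals of a system may leave gaps, so each is extended up to the next left
  endpoint. The extended pieces y g add up to a tail of the vector, at the cost 1 + K, and the
  original pieces are projections of them, at the cost K. The asymptotic inequality is applied to
  the y g.\<close>

lemma upper_est_schreier1:
  assumes "asymptotic_l1 e"
  shows "\<exists>t. upper_est schreier1 e 1 t"
proof -
  obtain C where C: "0 < C" "\<And>n x. 1 \<le> n \<Longrightarrow> (\<And>i. i \<in> {1..n} \<Longrightarrow> x i \<noteq> 0 \<and> finite (supp_wrt e (x i))) \<Longrightarrow>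
     n \<le> Min (supp_wrt e (x 1)) \<Longrightarrow>
     (\<And>i. i \<in> {1..<n} \<Longrightarrow> Max (supp_wrt e (x i)) < Min (supp_wrt e (x (Suc i)))) \<Longrightarrow>
     norm (\<Sum>i=1..n. x i) \<ge> (1 / C) * (\<Sum>i=1..n. norm (x i))"
    using assms unfolding asymptotic_l1_def by blast
  have "upper_est schreier1 e 1 (K * C * (1 + K))"
    unfolding upper_est_def
  proof (intro allI impI)
    fix a :: "nat \<Rightarrow> real" and m G r
    assume a: "\<forall>i. i < 1 \<or> m < i \<longrightarrow> a i = 0" and isys: "interval_system schreier1 G r" and G1: "\<forall>g\<in>G. 1 \<le> g"
    have G: "finite G" "G \<noteq> {} \<Longrightarrow> card G \<le> Min G"
      using interval_systemD(1)[OF isys] by (auto simp: schreier1_def)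
    define B where "B g = {i. g \<le> i \<and> i \<le> m \<and> (\<forall>h\<in>G. h \<le> i \<longrightarrow> h \<le> g)}" for g
    define b where "b g i = (if i \<in> B g then a i else 0)" for g i
    define y where "y g = (\<Sum>i\<le>m. b g i *\<^sub>R e i)" for g
    have b0: "b g i = 0" if "i < 1 \<or> m < i" for g i using a that by (auto simp: b_def)
    have P: "(\<Sum>i=g..r g. a i *\<^sub>R e i) = P (r g) (y g)" if g: "g \<in> G" for g
    proof -
      have "P (r g) (y g) = (\<Sum>i\<le>r g. b g i *\<^sub>R e i)"
        unfolding y_def by (rule P_block_sum[OF blocks_self]) (use b0 in auto)
      also have "\<dots> = (\<Sum>i=g..r g. a i *\<^sub>R e i)"
      proof (rule sum.mono_neutral_cong_right)
        show "b g i *\<^sub>R e i = a i *\<^sub>R e i" if i: "i \<in> {g..r g}" for i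
        proof -
          have "h \<le> g" if "h \<in> G" "h \<le> i" for h
            using interval_systemD(3)[OF isys g that(1)] that(2) i by (meson atLeastAtMost_iff leD le_less_trans linorder_not_less)
          then show ?thesis using i a by (cases "i \<le> m") (auto simp: b_def B_def)
        qed
      qed (auto simp: b_def B_def)
      finally show ?thesis ..
    qed
    have supp: "supp_wrt e (y g) = {i \<in> B g. a i \<noteq> 0}" for g
      unfolding supp_wrt_def y_def using coeffs_finite[of "b g" m] b0 by (auto simp: b_def)
    have finB: "finite (B g)" for g by (rule finite_subset[of _ "{..m}"]) (auto simp: B_def)
    have supp_ne: "supp_wrt e (y g) \<noteq> {}" if "y g \<noteq> 0" for g
    proof
      assume "supp_wrt e (y g) = {}"
      then have "b g i = 0" for i unfolding supp by (auto simp: b_def)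
      then show False using that by (simp add: y_def)
    qed
    have sep: "i < j" if "g \<in> G" "h \<in> G" "g < h" "i \<in> B g" "j \<in> B h" for g h i j
      using that unfolding B_def by (metis (mono_tags, lifting) linorder_not_less mem_Collect_eq order_less_le_trans)
    \<comment> \<open>The asymptotic inequality is available for nonzero vectors only.\<close>
    define G' where "G' = {g \<in> G. y g \<noteq> 0}"
    have finG': "finite G'" using G by (simp add: G'_def)
    define n where "n = card G'"
    define l where "l = sorted_list_of_set G'"
    have l: "length l = n" "set l = G'" "sorted_wrt (<) l" "distinct l"
      using finG' by (simp_all add: l_def n_def)
    have main: "(\<Sum>g\<in>G'. norm (y g)) \<le> C * norm (\<Sum>g\<in>G'. y g)"
    proof (cases "n = 0")
      case True
      then have "G' = {}" using finG' by (simp add: n_def)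
      then show ?thesis by simp
    next
      case False
      have lG: "l ! i \<in> G'" if "i < n" for i using that l(1,2) nth_mem by blast
      define x where "x i = y (l ! (i - 1))" for i
      have "norm (\<Sum>i=1..n. x i) \<ge> (1 / C) * (\<Sum>i=1..n. norm (x i))"
      proof (rule C(2))
        show "1 \<le> n" using False by simp
        show "x i \<noteq> 0 \<and> finite (supp_wrt e (x i))" if "i \<in> {1..n}" for i
        proof -
          have "i - 1 < n" using that by auto
          then show ?thesis using lG[of "i - 1"] finB unfolding x_def supp by (auto simp: G'_def)
        qed
        have g: "l ! 0 \<in> G" "y (l ! 0) \<noteq> 0" using lG[of 0] False by (auto simp: G'_def)
        have "n \<le> card G" unfolding n_def by (rule card_mono) (use G in \<open>auto simp: G'_def\<close>)
        also have "\<dots> \<le> Min G" using G g by blast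
        also have "\<dots> \<le> l ! 0" using G g by simp
        also have "\<dots> \<le> Min (supp_wrt e (x 1))"
          using supp_ne[OF g(2)] finB[of "l ! 0"] by (auto simp: x_def supp B_def)
        finally show "n \<le> Min (supp_wrt e (x 1))" .
        show "Max (supp_wrt e (x i)) < Min (supp_wrt e (x (Suc i)))" if i: "i \<in> {1..<n}" for i
        proof -
          have g: "l ! (i - 1) \<in> G'" "l ! i \<in> G'" using lG i by auto
          have lt: "l ! (i - 1) < l ! i" using l(3,1) i by (auto simp: sorted_wrt_iff_nth_less)
          have ne: "finite (supp_wrt e (x i))" "supp_wrt e (x i) \<noteq> {}" "finite (supp_wrt e (x (Suc i)))" "supp_wrt e (x (Suc i)) \<noteq> {}"
            using g supp_ne finB by (simp_all add: x_def G'_def supp)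
          have "Max (supp_wrt e (x i)) \<in> supp_wrt e (x i)" "Min (supp_wrt e (x (Suc i))) \<in> supp_wrt e (x (Suc i))"
            by (rule Max_in[OF ne(1,2)], rule Min_in[OF ne(3,4)])
          then show ?thesis using sep[of "l ! (i - 1)" "l ! i"] g lt by (auto simp: x_def supp G'_def)
        qed
      qed
      moreover have re: "(\<Sum>i=1..n. f (x i)) = (\<Sum>g\<in>G'. f (y g))" for f :: "'a \<Rightarrow> 'c::comm_monoid_add"
      proof -
        have "(\<Sum>i=1..n. f (x i)) = (\<Sum>i<n. f (y (l ! i)))"
          by (simp add: sum.atLeast1_atMost_eq x_def)
        also have "\<dots> = (\<Sum>g\<in>G'. f (y g))"
          using sum.reindex_bij_betw[OF bij_betw_nth[OF l(4) refl refl], of "\<lambda>g. f (y g)"] l(1,2)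
          by (simp add: lessThan_atLeast0)
        finally show ?thesis .
      qed
      ultimately show ?thesis using C(1) re[of norm] re[of "\<lambda>x. x"] by (simp add: field_simps)
    qed
    have union: "(\<Union>g\<in>G. B g) = {Min G..m}" if "G \<noteq> {}"
    proof (intro equalityI subsetI)
      fix i assume "i \<in> (\<Union>g\<in>G. B g)"
      then show "i \<in> {Min G..m}" using G(1) by (auto simp: B_def intro: Min.coboundedI[THEN order_trans])
    next
      fix i assume i: "i \<in> {Min G..m}"
      let ?H = "{g \<in> G. g \<le> i}"
      have H: "finite ?H" "Min G \<in> ?H" using G(1) that i by auto
      then have "Max ?H \<in> ?H" by (metis (no_types, lifting) Max_in empty_iff)
      moreover have "\<forall>h\<in>G. h \<le> i \<longrightarrow> h \<le> Max ?H" using H(1) by simp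
      ultimately have "i \<in> B (Max ?H)" using i by (auto simp: B_def)
      then show "i \<in> (\<Union>g\<in>G. B g)" using \<open>Max ?H \<in> ?H\<close> by blast
    qed
    have sumy: "(\<Sum>g\<in>G. y g) = (\<Sum>i=Min G..m. a i *\<^sub>R e i)" if "G \<noteq> {}"
    proof -
      have "y g = (\<Sum>i\<in>B g. a i *\<^sub>R e i)" for g
        unfolding y_def by (rule sum.mono_neutral_cong_right) (auto simp: b_def B_def)
      then have "(\<Sum>g\<in>G. y g) = (\<Sum>g\<in>G. \<Sum>i\<in>B g. a i *\<^sub>R e i)" by simp
      also have "\<dots> = (\<Sum>i\<in>(\<Union>g\<in>G. B g). a i *\<^sub>R e i)"
      proof (rule sum.UNION_disjoint[symmetric])
        show "\<forall>g\<in>G. \<forall>h\<in>G. g \<noteq> h \<longrightarrow> B g \<inter> B h = {}"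
          using sep by (metis disjoint_iff linorder_neqE_nat order_less_irrefl)
      qed (use G finB in auto)
      finally show ?thesis using union[OF that] by simp
    qed
    show "(\<Sum>g\<in>G. norm (\<Sum>i=g..r g. a i *\<^sub>R e i)) \<le> K * C * (1 + K) * norm (\<Sum>i\<le>m. a i *\<^sub>R e i)"
    proof (cases "G = {}")
      case False
      have "(\<Sum>g\<in>G. norm (\<Sum>i=g..r g. a i *\<^sub>R e i)) \<le> (\<Sum>g\<in>G. K * norm (y g))"
        by (rule sum_mono) (use P P_bound in simp)
      also have "\<dots> = K * (\<Sum>g\<in>G'. norm (y g))"
        unfolding sum_distrib_left[symmetric]
        by (rule arg_cong[where f = "(*) K"], rule sum.mono_neutral_right) (use G in \<open>auto simp: G'_def\<close>)
      also have "\<dots> \<le> K * (C * norm (\<Sum>g\<in>G'. y g))"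
        using main K1 by (intro mult_left_mono) auto
      also have "(\<Sum>g\<in>G'. y g) = (\<Sum>g\<in>G. y g)"
        by (rule sum.mono_neutral_left) (use G in \<open>auto simp: G'_def\<close>)
      also have "\<dots> = (\<Sum>i=Min G..m. a i *\<^sub>R e i)" by (rule sumy[OF False])
      also have "norm \<dots> \<le> (1 + K) * norm (\<Sum>i\<le>m. a i *\<^sub>R e i)"
        by (rule tail_bound[OF blocks_self]) (use a G1 G False in auto)
      finally show ?thesis using K1 C(1) by (simp add: mult_ac mult_left_mono)
    qed (use K1 C(1) in simp)
  qed
  then show ?thesis ..
qed

text \<open>A member of the limit family belongs to some stage n of the ladder with n at most its
  minimum. A diagonal sequence handles all stages at once, and as t is the same for all of them,
  only the index from which stage n is valid has to be controlled.\<close>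

lemma finite_est_limit:
  assumes L: "ladder_system L" and lim: "is_limit \<kappa>" and x0: "sub_block x0 e" and t: "0 \<le> t"
    and ex: "\<And>a x. a < \<kappa> \<Longrightarrow> sub_block x x0 \<Longrightarrow> \<exists>y. sub_block y x \<and> (\<exists>N. upper_est (schreier L a) y N t)"
  shows "\<exists>y. sub_block y x0 \<and> finite_est (schreier L \<kappa>) y"
proof -
  have La: "L \<kappa> (Suc k) < \<kappa>" for k using L lim by (simp add: ladder_system_def)
  have "\<exists>W. \<forall>k. sub_block (W k) x0 \<and> (sub_block (W (Suc k)) (W k) \<and>
      (\<exists>N. upper_est (schreier L (L \<kappa> (Suc k))) (W (Suc k)) N t))"
  proof (rule dependent_nat_choice)
    show "\<exists>y. sub_block y x0" using sub_block_refl'[OF x0] by blast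
    fix x k assume "sub_block x x0"
    then show "\<exists>y. sub_block y x0 \<and> sub_block y x \<and> (\<exists>N. upper_est (schreier L (L \<kappa> (Suc k))) y N t)"
      using ex[OF La[of k]] sub_block_trans by blast
  qed
  then obtain W where W: "\<And>k. sub_block (W k) x0" "\<And>k. sub_block (W (Suc k)) (W k)"
    "\<And>k. \<exists>N. upper_est (schreier L (L \<kappa> (Suc k))) (W (Suc k)) N t" by blast
  obtain v where v: "\<And>j. sub_block v (W j)" using sub_block_diagonal[of W] W(2) by blast
  have "\<exists>N. upper_est (schreier L (L \<kappa> n)) v N t" if n: "1 \<le> n" for n
  proof -
    obtain k where "n = Suc k" using n by (cases n) auto
    then show ?thesis using W(3)[of k] upper_est_sub_block[OF v _ regular_schreier[OF L]] by blast
  qed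
  then obtain M where M: "\<And>n. 1 \<le> n \<Longrightarrow> upper_est (schreier L (L \<kappa> n)) v (M n) t" by metis
  \<comment> \<open>On this subsequence the estimate of stage n holds from index n on, because its
    starting index M n is at most Suc (q (s - 1)) whenever n \<le> s.\<close>
  define q where "q j = j + (\<Sum>n\<le>Suc j. M n)" for j
  have qs: "strict_mono q" by (rule strict_monoI_Suc) (simp add: q_def)
  have qM: "M n \<le> Suc (q (s - 1))" if "n \<le> s" for n s
  proof -
    have "M n \<le> sum M {..Suc (s - 1)}" using that by (intro member_le_sum) auto
    then show ?thesis unfolding q_def by linarith
  qed
  have vx: "sub_block v x0" using sub_block_trans[OF v W(1)] .
  obtain p N where bl: "blocks v e p N" using sub_block_trans[OF vx x0] by (auto simp: sub_block_def)
  have bq: "blocks (v \<circ> q) v q N"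
    using blocksD(2,3)[OF bl] strict_mono_ge[OF qs] by (intro blocks_subseq[OF qs]) (auto intro: order_trans)
  have bqe: "blocks (v \<circ> q) e (p \<circ> q) N" using blocks_trans[OF bq bl] by simp
  have "upper_est (schreier L \<kappa>) (v \<circ> q) N (t * (1 + K))"
    unfolding upper_est_def
  proof (intro allI impI)
    fix a :: "nat \<Rightarrow> real" and m G r
    assume a: "\<forall>i. i < N \<or> m < i \<longrightarrow> a i = 0" and isys: "interval_system (schreier L \<kappa>) G r" and GN: "\<forall>g\<in>G. N \<le> g"
    show "(\<Sum>g\<in>G. norm (\<Sum>i=g..r g. a i *\<^sub>R (v \<circ> q) i)) \<le> t * (1 + K) * norm (\<Sum>i\<le>m. a i *\<^sub>R (v \<circ> q) i)"
    proof (cases "G = {}")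
      case False
      obtain n where n: "1 \<le> n" "G \<in> schreier L (L \<kappa> n)" "\<forall>i\<in>G. n \<le> i"
        using interval_systemD(1)[OF isys] unfolding schreier_limit[OF L lim] by blast
      have fin: "finite G" by (rule regularD(3)[OF regular_schreier[OF L] n(2)])
      define s where "s = Min G"
      have s: "s \<in> G" "\<And>g. g \<in> G \<Longrightarrow> s \<le> g" using fin False by (auto simp: s_def)
      \<comment> \<open>The estimate of the stage is used for vectors starting at the first left
        endpoint s; removing the head costs the factor 1 + K.\<close>
      define b where "b i = (if s \<le> i then a i else 0)" for i
      have "upper_est (schreier L (L \<kappa> n)) (v \<circ> q) s t"
      proof (rule upper_est_blocks[OF bq M[OF n(1)]])
        show "N \<le> s" using s(1) GN by blast
        show "M n \<le> Suc (q (s - 1))" using qM s(1) n(3) by blast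
        show "(\<lambda>g. Suc (q (g - 1))) ` H \<in> schreier L (L \<kappa> n)" if "H \<in> schreier L (L \<kappa> n)" for H
          by (rule regular_spread_blocks[OF regular_schreier[OF L] qs that])
      qed
      then have "(\<Sum>g\<in>G. norm (\<Sum>i=g..r g. b i *\<^sub>R (v \<circ> q) i)) \<le> t * norm (\<Sum>i\<le>m. b i *\<^sub>R (v \<circ> q) i)"
        by (rule upper_estD) (use a s n isys in \<open>auto simp: b_def interval_system_def\<close>)
      also have "(\<Sum>g\<in>G. norm (\<Sum>i=g..r g. b i *\<^sub>R (v \<circ> q) i)) = (\<Sum>g\<in>G. norm (\<Sum>i=g..r g. a i *\<^sub>R (v \<circ> q) i))"
        by (intro sum.cong refl arg_cong[where f = norm]) (use s(2) in \<open>auto simp: b_def intro: order_trans\<close>)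
      also have "(\<Sum>i\<le>m. b i *\<^sub>R (v \<circ> q) i) = (\<Sum>i=s..m. a i *\<^sub>R (v \<circ> q) i)"
        by (rule sum.mono_neutral_cong_right) (auto simp: b_def)
      also have "t * norm \<dots> \<le> t * ((1 + K) * norm (\<Sum>i\<le>m. a i *\<^sub>R (v \<circ> q) i))"
        by (intro mult_left_mono t tail_bound[OF bqe]) (use a s(1) GN blocksD(2)[OF bl] in force)+
      finally show ?thesis by (simp add: mult_ac)
    qed (use t K1 in simp)
  qed
  moreover have "sub_block (v \<circ> q) x0" using sub_block_trans[OF sub_block_subseq[OF vx qs] vx] .
  ultimately show ?thesis unfolding finite_est_def by blast
qed

end

section \<open>Embedding of the space of summable sequences\<close>

text \<open>Finite combinations with rational coefficients give separability. It lets the vectors of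
  a tree be drawn from a countable set, against which the uncountably many ordinals can be played by
  pigeonhole.\<close>

lemma (in schauder) countable_dense:
  shows "\<exists>C. countable C \<and> (\<forall>(x::'a) \<epsilon>. 0 < \<epsilon> \<longrightarrow> (\<exists>z\<in>C. norm (z - x) < \<epsilon>))"
proof -
  define f where "f q = (\<Sum>i<length q. real_of_rat (q ! i) *\<^sub>R e (Suc i))" for q :: "rat list"
  have "\<exists>z\<in>range f. norm (z - x) < \<epsilon>" if \<epsilon>: "0 < \<epsilon>" for x \<epsilon>
  proof -
    have "0 < \<epsilon> / 2" using \<epsilon> by simp
    then obtain n where n: "norm (P n x - x) < \<epsilon> / 2" using LIMSEQ_D[OF P_tendsto[of x]] by blast
    define d where "d i = \<epsilon> / (2 * (real n + 1) * (norm (e i) + 1))" for i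
    have d: "0 < d i" "d i * norm (e i) \<le> \<epsilon> / (2 * (real n + 1))" for i
    proof -
      show "0 < d i" using \<epsilon> norm_ge_zero[of "e i"] unfolding d_def by (intro divide_pos_pos mult_pos_pos add_nonneg_pos) auto
      have "d i * norm (e i) = \<epsilon> / (2 * (real n + 1)) * (norm (e i) / (norm (e i) + 1))" by (simp add: d_def)
      also have "\<dots> \<le> \<epsilon> / (2 * (real n + 1)) * 1"
        using \<epsilon> by (intro mult_left_mono) (auto simp: divide_le_eq add_nonneg_pos)
      finally show "d i * norm (e i) \<le> \<epsilon> / (2 * (real n + 1))" by simp
    qed
    have "\<exists>q. c x i < real_of_rat q \<and> real_of_rat q < c x i + d i" for i
      by (rule of_rat_dense) (use d in simp)
    then obtain q where q: "\<And>i. c x i < real_of_rat (q i)" "\<And>i. real_of_rat (q i) < c x i + d i" by metis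
    let ?z = "f (map q [1..<Suc n])"
    have "?z = (\<Sum>i=1..n. real_of_rat (q i) *\<^sub>R e i)"
      by (simp add: f_def sum.atLeast1_atMost_eq del: upt_Suc)
    then have "?z - P n x = (\<Sum>i=1..n. (real_of_rat (q i) - c x i) *\<^sub>R e i)"
      by (simp add: P_def sum_subtractf[symmetric] scaleR_diff_left)
    also have "norm \<dots> \<le> (\<Sum>i=1..n. \<epsilon> / (2 * (real n + 1)))"
    proof (rule sum_norm_le)
      fix i
      have "norm ((real_of_rat (q i) - c x i) *\<^sub>R e i) \<le> d i * norm (e i)"
        using q(1,2)[of i] by (auto intro!: mult_right_mono)
      then show "norm ((real_of_rat (q i) - c x i) *\<^sub>R e i) \<le> \<epsilon> / (2 * (real n + 1))" using d(2)[of i] by linarith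
    qed
    also have "\<dots> = \<epsilon> / 2 * (real n / (real n + 1))" by simp
    also have "\<dots> \<le> \<epsilon> / 2 * 1" using \<epsilon> by (intro mult_left_mono) (auto simp: divide_le_eq)
    finally have "norm (?z - P n x) \<le> \<epsilon> / 2" by simp
    then have "norm (?z - x) < \<epsilon>" using n norm_triangle_ineq[of "?z - P n x" "P n x - x"] by simp
    then show ?thesis by blast
  qed
  then show ?thesis by (intro exI[of _ "range f"]) (simp add: countable_image)
qed

text \<open>A substitute for an ordinal index of T: for every countable ordinal, T contains a copy
  of the Schreier sets beyond some N, ordered by end extension. With countably many possible vectors
  this forces an infinite branch.\<close>

definition big_tree :: "(omega1 \<Rightarrow> nat \<Rightarrow> omega1) \<Rightarrow> 'c list set \<Rightarrow> bool" where
  "big_tree L T \<longleftrightarrow> (\<forall>\<beta>. \<exists>y N. \<forall>F\<in>schreier L \<beta>. (\<forall>i\<in>F. N \<le> i) \<longrightarrow> map y (sorted_list_of_set F) \<in> T)"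

text \<open>The first vector of the branch is found by pigeonhole: uncountably many \<open>\<beta>\<close> have to share it.\<close>

lemma big_tree_extend:
  assumes L: "ladder_system L" and big: "big_tree L T" and C: "countable C" "T \<subseteq> lists C"
  obtains v where "v \<in> C" "big_tree L {s. v # s \<in> T}"
proof -
  have "\<forall>\<beta>. \<exists>y N. \<forall>F\<in>schreier L (osuc \<beta>). (\<forall>i\<in>F. N \<le> i) \<longrightarrow> map y (sorted_list_of_set F) \<in> T"
    using big unfolding big_tree_def by blast
  then obtain y N where "\<forall>\<beta>. \<forall>F\<in>schreier L (osuc \<beta>). (\<forall>i\<in>F. N \<beta> \<le> i) \<longrightarrow>
      map (y \<beta>) (sorted_list_of_set F) \<in> T"
    by metis
  then have yN: "\<And>\<beta> F. F \<in> schreier L (osuc \<beta>) \<Longrightarrow> (\<And>i. i \<in> F \<Longrightarrow> N \<beta> \<le> i) \<Longrightarrow>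
      map (y \<beta>) (sorted_list_of_set F) \<in> T" by blast
  \<comment> \<open>The index of the first vector is at least 2 so that
    \<open>schreier_insert\<close> can put it in front of a set; the passage from \<beta> to its
    successor above provides the room.\<close>
  define k where "k \<beta> = max 2 (N \<beta>)" for \<beta>
  define V where "V \<beta> = y \<beta> (k \<beta>)" for \<beta>
  have VC: "V \<beta> \<in> C" for \<beta>
  proof -
    have "{k \<beta>} \<in> schreier L (osuc \<beta>)" by (rule regularD(5)[OF regular_schreier[OF L]]) (simp add: k_def)
    then have "map (y \<beta>) (sorted_list_of_set {k \<beta>}) \<in> T" by (rule yN) (simp add: k_def)
    then show ?thesis using C(2) by (auto simp: V_def)
  qed
  have "\<exists>v. \<forall>\<gamma>. \<exists>\<beta>\<ge>\<gamma>. V \<beta> = v"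
  proof (rule ccontr)
    assume "\<not> ?thesis"
    then obtain \<gamma> where \<gamma>: "\<And>v \<beta>. \<gamma> v \<le> \<beta> \<Longrightarrow> V \<beta> \<noteq> v" by metis
    \<comment> \<open>If each v occurred only before some \<gamma> v, the countably many \<gamma> v
      would have a common bound b, and V b would occur beyond its own bound.\<close>
    obtain b where "\<forall>a\<in>\<gamma> ` C. a < b" using countable_imp_bounded_omega1[of "\<gamma> ` C"] C(1) by auto
    then have "\<gamma> (V b) \<le> b" using VC less_imp_le by blast
    then show False using \<gamma> by blast
  qed
  then obtain v where v: "\<And>\<gamma>. \<exists>\<beta>\<ge>\<gamma>. V \<beta> = v" by blast
  have "big_tree L {s. v # s \<in> T}"
    unfolding big_tree_def
  proof
    fix \<gamma>
    obtain \<beta> where \<beta>: "\<gamma> \<le> \<beta>" "V \<beta> = v" using v by blast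
    obtain m where m: "\<And>F. F \<in> schreier L \<gamma> \<Longrightarrow> (\<And>i. i \<in> F \<Longrightarrow> m \<le> i) \<Longrightarrow> F \<in> schreier L \<beta>"
      using schreier_eventually_mono[OF L \<beta>(1)] by blast
    have "v # map (y \<beta>) (sorted_list_of_set F) \<in> T"
      if F: "F \<in> schreier L \<gamma>" "\<forall>i\<in>F. max m (Suc (k \<beta>)) \<le> i" for F
    proof -
      have fin: "finite F" by (rule regularD(3)[OF regular_schreier[OF L] F(1)])
      have lt: "\<forall>i\<in>F. k \<beta> < i" using F(2) by auto
      have "F \<in> schreier L \<beta>" using m F by simp
      then have "insert (k \<beta>) F \<in> schreier L (osuc \<beta>)"
        by (rule schreier_insert[OF L]) (use lt in \<open>simp_all add: k_def\<close>)
      then have "map (y \<beta>) (sorted_list_of_set (insert (k \<beta>) F)) \<in> T"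
        by (rule yN) (use lt in \<open>auto simp: k_def\<close>)
      moreover have "sorted_list_of_set (insert (k \<beta>) F) = k \<beta> # sorted_list_of_set F"
      proof -
        have "k \<beta> \<notin> F" using lt by blast
        then show ?thesis using fin lt by (simp add: insort_is_Cons less_imp_le)
      qed
      ultimately show ?thesis using \<beta>(2) by (simp add: V_def)
    qed
    then show "\<exists>y N. \<forall>F\<in>schreier L \<gamma>. (\<forall>i\<in>F. N \<le> i) \<longrightarrow> map y (sorted_list_of_set F) \<in> {s. v # s \<in> T}"
      by blast
  qed
  then show ?thesis using that VC v by metis
qed

text \<open>Bigness passes to the continuations of a suitable vector, so the choice can be repeated
  forever. Every set of continuations contains the empty list because the empty set belongs to all
  Schreier families.\<close>

lemma big_tree_branch:
  assumes L: "ladder_system L" and big: "big_tree L T" and C: "countable C" "T \<subseteq> lists C"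
  obtains v :: "nat \<Rightarrow> 'c" where "\<And>n. map v [0..<n] \<in> T"
proof -
  have "\<exists>U. \<forall>k. (big_tree L (U k) \<and> U k \<subseteq> lists C \<and> (k = 0 \<longrightarrow> U k = T)) \<and> (\<exists>v. U (Suc k) = {s. v # s \<in> U k})"
  proof (rule dependent_nat_choice)
    show "\<exists>U. big_tree L U \<and> U \<subseteq> lists C \<and> (0 = (0::nat) \<longrightarrow> U = T)" using big C by blast
    fix U and k :: nat assume U: "big_tree L U \<and> U \<subseteq> lists C \<and> (k = 0 \<longrightarrow> U = T)"
    obtain v where "v \<in> C" "big_tree L {s. v # s \<in> U}"
      using big_tree_extend[OF L _ C(1), of U] U by blast
    moreover have "{s. v # s \<in> U} \<subseteq> lists C" using U by auto
    ultimately show "\<exists>V. (big_tree L V \<and> V \<subseteq> lists C \<and> (Suc k = 0 \<longrightarrow> V = T)) \<and> (\<exists>v. V = {s. v # s \<in> U})"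
      by blast
  qed
  then obtain U where U: "\<And>k. big_tree L (U k)" "U 0 = T" "\<And>k. \<exists>v. U (Suc k) = {s. v # s \<in> U k}" by blast
  then obtain v where v: "\<And>k. U (Suc k) = {s. v k # s \<in> U k}" by metis
  have "s \<in> U n \<longleftrightarrow> map v [0..<n] @ s \<in> T" for n s
  proof (induction n arbitrary: s)
    case (Suc n)
    have "s \<in> U (Suc n) \<longleftrightarrow> v n # s \<in> U n" by (simp add: v)
    then show ?case using Suc by simp
  qed (simp add: U(2))
  moreover have "[] \<in> U n" for n
    using U(1)[of n] regularD(6)[OF regular_schreier[OF L]] unfolding big_tree_def by fastforce
  ultimately show ?thesis using that by (metis append_Nil2)
qed

text \<open>By the two bounds, the map T that sends a to the sum of all a i v i is an isomorphism
  onto its range. The range is closed because it is complete, and the completeness of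
  \<open>ell1\<close> is proved here through coordinatewise limits.\<close>

lemma contains_ell1I:
  fixes v :: "nat \<Rightarrow> 'a::banach"
  assumes v: "\<And>i. norm (v i) \<le> b" and c: "0 < c" "\<And>n a. c * (\<Sum>i<n. \<bar>a i\<bar>) \<le> norm (\<Sum>i<n. a i *\<^sub>R v i)"
  shows "contains_ell1 (UNIV :: 'a set)"
proof -
  have b: "0 \<le> b" using v[of 0] norm_ge_zero order_trans by blast
  define T where "T a = (\<Sum>i. a i *\<^sub>R v i)" for a
  define \<nu> where "\<nu> a = (\<Sum>i. \<bar>a i :: real\<bar>)" for a
  have bnd: "norm (a i *\<^sub>R v i) \<le> \<bar>a i\<bar> * b" for a i using v by (simp add: mult_left_mono)
  have sm: "summable (\<lambda>i. a i *\<^sub>R v i)" if "a \<in> ell1" for a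
    by (rule summable_comparison_test'[of "\<lambda>i. \<bar>a i\<bar> * b" 0])
       (use that bnd in \<open>auto simp: ell1_def intro: summable_mult2\<close>)
  have add: "(\<lambda>i. a i + a' i) \<in> ell1" if "a \<in> ell1" "a' \<in> ell1" for a a'
  proof -
    have "summable (\<lambda>i. \<bar>a i\<bar> + \<bar>a' i\<bar>)" using that by (auto simp: ell1_def intro: summable_add)
    then have "summable (\<lambda>i. \<bar>a i + a' i\<bar>)"
      by (rule summable_comparison_test'[where N = 0]) (simp add: abs_triangle_ineq)
    then show ?thesis by (simp add: ell1_def)
  qed
  have scale: "(\<lambda>i. r * a i) \<in> ell1" if "a \<in> ell1" for a r
    using that by (auto simp: ell1_def abs_mult intro: summable_mult)
  have Tadd: "T (\<lambda>i. a i + a' i) = T a + T a'" if "a \<in> ell1" "a' \<in> ell1" for a a'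
    using suminf_add[OF sm[OF that(1)] sm[OF that(2)]] by (simp add: T_def scaleR_add_left)
  have Tscale: "T (\<lambda>i. r * a i) = r *\<^sub>R T a" if "a \<in> ell1" for a r
    using suminf_scaleR_right[OF sm[OF that], of r] by (simp add: T_def)
  have upper: "norm (T a) \<le> b * \<nu> a" if a: "a \<in> ell1" for a
  proof -
    have s: "summable (\<lambda>i. \<bar>a i\<bar> * b)" using a by (auto simp: ell1_def intro: summable_mult2)
    have "norm (T a) \<le> (\<Sum>i. \<bar>a i\<bar> * b)" unfolding T_def by (rule norm_suminf_le[OF _ s]) (rule bnd)
    also have "\<dots> = b * \<nu> a" using suminf_mult2[of "\<lambda>i. \<bar>a i\<bar>" b] a by (simp add: ell1_def \<nu>_def mult.commute)
    finally show ?thesis .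
  qed
  have lower: "c * \<nu> a \<le> norm (T a)" if a: "a \<in> ell1" for a
  proof -
    have "(\<lambda>n. c * (\<Sum>i<n. \<bar>a i\<bar>)) \<longlonglongrightarrow> c * \<nu> a"
      using a unfolding \<nu>_def ell1_def by (intro tendsto_mult tendsto_const summable_LIMSEQ) simp
    moreover have "(\<lambda>n. norm (\<Sum>i<n. a i *\<^sub>R v i)) \<longlonglongrightarrow> norm (T a)"
      unfolding T_def by (intro tendsto_norm summable_LIMSEQ sm a)
    ultimately show ?thesis by (rule LIMSEQ_le) (use c(2) in blast)
  qed
  have \<nu>_ge: "\<bar>a i\<bar> \<le> \<nu> a" if "a \<in> ell1" for a i
    using sum_le_suminf[of "\<lambda>i. \<bar>a i\<bar>" "{i}"] that by (simp add: ell1_def \<nu>_def)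
  have zero: "(\<lambda>i. 0) \<in> ell1" "T (\<lambda>i. 0) = 0" by (simp_all add: ell1_def T_def)
  have diff: "(\<lambda>i. a i - a' i) \<in> ell1" "T (\<lambda>i. a i - a' i) = T a - T a'" if "a \<in> ell1" "a' \<in> ell1" for a a'
    using add[OF that(1) scale[OF that(2), of "-1"]] Tadd[OF that(1) scale[OF that(2), of "-1"]] Tscale[OF that(2), of "-1"]
    by simp_all
  have inj: "inj_on T ell1"
  proof (rule inj_onI)
    fix a a' assume *: "a \<in> ell1" "a' \<in> ell1" "T a = T a'"
    have "c * \<nu> (\<lambda>i. a i - a' i) \<le> 0" using lower[OF diff(1)[OF *(1,2)]] diff(2)[OF *(1,2)] *(3) by simp
    then have "\<nu> (\<lambda>i. a i - a' i) \<le> 0" using c(1) by (simp add: mult_le_0_iff)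
    then have "a i - a' i = 0" for i using \<nu>_ge[OF diff(1)[OF *(1,2)], of i] by simp
    then show "a = a'" by (simp add: fun_eq_iff)
  qed
  let ?Y = "T ` ell1"
  have sub: "subspace ?Y"
  proof (rule subspaceI)
    show "0 \<in> ?Y" using zero by (metis imageI)
    show "x + y \<in> ?Y" if "x \<in> ?Y" "y \<in> ?Y" for x y using that add Tadd by (auto simp: image_iff) metis
    show "r *\<^sub>R x \<in> ?Y" if "x \<in> ?Y" for r x using that scale Tscale by (auto simp: image_iff) metis
  qed
  have cl: "closed ?Y"
    unfolding closed_sequential_limits
  proof (intro allI impI, elim conjE)
    fix f x assume f: "\<forall>n. f n \<in> ?Y" "f \<longlonglongrightarrow> x"
    then have "\<forall>n. \<exists>a. a \<in> ell1 \<and> f n = T a" by blast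
    then obtain A where "\<forall>n. A n \<in> ell1 \<and> f n = T (A n)" by (rule choice[THEN exE])
    then have A: "\<And>n. A n \<in> ell1" "\<And>n. f n = T (A n)" by simp_all
    have dist: "\<nu> (\<lambda>i. A n i - A m i) \<le> norm (f n - f m) / c" for n m
      using lower[OF diff(1)[OF A(1) A(1)], of n m] diff(2)[OF A(1) A(1), of n m] c(1) by (simp add: A(2) field_simps)
    have C: "\<exists>M. \<forall>n\<ge>M. \<forall>m\<ge>M. \<nu> (\<lambda>i. A n i - A m i) < \<epsilon>" if "0 < \<epsilon>" for \<epsilon>
    proof -
      have "Cauchy f" by (rule LIMSEQ_imp_Cauchy[OF f(2)])
      then have "\<exists>M. \<forall>m\<ge>M. \<forall>n\<ge>M. norm (f m - f n) < \<epsilon> * c" using that c(1) by (intro CauchyD) auto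
      then obtain M where M: "\<And>m n. M \<le> m \<Longrightarrow> M \<le> n \<Longrightarrow> norm (f m - f n) < \<epsilon> * c" by blast
      have "\<nu> (\<lambda>i. A n i - A m i) < \<epsilon>" if "M \<le> n" "M \<le> m" for n m
      proof -
        have "norm (f n - f m) / c < \<epsilon>" using M[OF that] c(1) by (simp add: pos_divide_less_eq)
        then show ?thesis using dist[of n m] by linarith
      qed
      then show ?thesis by blast
    qed
    have "Cauchy (\<lambda>n. A n i)" for i
    proof (rule CauchyI)
      fix \<epsilon> :: real assume "0 < \<epsilon>"
      from C[OF this] obtain M where M: "\<And>n m. M \<le> n \<Longrightarrow> M \<le> m \<Longrightarrow> \<nu> (\<lambda>i. A n i - A m i) < \<epsilon>" by blast
      have "norm (A m i - A n i) < \<epsilon>" if "M \<le> m" "M \<le> n" for m n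
        using \<nu>_ge[OF diff(1)[OF A(1)[of m] A(1)[of n]], of i] M[OF that] by simp
      then show "\<exists>M. \<forall>m\<ge>M. \<forall>n\<ge>M. norm (A m i - A n i) < \<epsilon>" by blast
    qed
    then have "\<forall>i. \<exists>l. (\<lambda>n. A n i) \<longlonglongrightarrow> l" using Cauchy_convergent convergent_def by blast
    then obtain a where a: "\<And>i. (\<lambda>n. A n i) \<longlonglongrightarrow> a i" by metis
    \<comment> \<open>Finite partial sums pass to the coordinatewise limit; the bound for the whole
      series follows from their uniform bound.\<close>
    have fin: "(\<Sum>i<k. \<bar>A n i - a i\<bar>) \<le> \<epsilon>" if n: "\<forall>m\<ge>M. \<nu> (\<lambda>i. A n i - A m i) < \<epsilon>" for n k M \<epsilon>
    proof (rule LIMSEQ_le_const2)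
      show "(\<lambda>m. \<Sum>i<k. \<bar>A n i - A m i\<bar>) \<longlonglongrightarrow> (\<Sum>i<k. \<bar>A n i - a i\<bar>)"
        by (intro tendsto_sum tendsto_rabs tendsto_diff tendsto_const a)
      have "(\<Sum>i<k. \<bar>A n i - A m i\<bar>) \<le> \<nu> (\<lambda>i. A n i - A m i)" for m
        unfolding \<nu>_def by (rule sum_le_suminf) (use diff(1)[OF A(1) A(1)] in \<open>auto simp: ell1_def\<close>)
      then show "\<exists>N. \<forall>m\<ge>N. (\<Sum>i<k. \<bar>A n i - A m i\<bar>) \<le> \<epsilon>" using n by (meson less_imp_le order_trans)
    qed
    have da: "(\<lambda>i. A n i - a i) \<in> ell1 \<and> \<nu> (\<lambda>i. A n i - a i) \<le> \<epsilon>"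
      if n: "\<forall>m\<ge>M. \<nu> (\<lambda>i. A n i - A m i) < \<epsilon>" for n M \<epsilon>
    proof -
      have s: "summable (\<lambda>i. \<bar>A n i - a i\<bar>)"
        by (rule summableI_nonneg_bounded[of _ \<epsilon>]) (use fin[OF n] in auto)
      then show ?thesis using suminf_le_const[OF s fin[OF n]] by (simp add: ell1_def \<nu>_def)
    qed
    obtain M where "\<forall>n\<ge>M. \<forall>m\<ge>M. \<nu> (\<lambda>i. A n i - A m i) < 1" using C[of 1] by auto
    then have "(\<lambda>i. A M i - a i) \<in> ell1" using da[of M M 1] by blast
    then have ael: "a \<in> ell1" using diff(1)[OF A(1)[of M]] by force
    have "f \<longlonglongrightarrow> T a"
    proof (rule LIMSEQ_I)
      fix \<epsilon> :: real assume \<epsilon>: "0 < \<epsilon>"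
      then have e': "0 < \<epsilon> / (b + 1)" using b by simp
      obtain M where M: "\<forall>n\<ge>M. \<forall>m\<ge>M. \<nu> (\<lambda>i. A n i - A m i) < \<epsilon> / (b + 1)" using C[OF e'] by blast
      have "norm (f n - T a) < \<epsilon>" if "n \<ge> M" for n
      proof -
        have n: "(\<lambda>i. A n i - a i) \<in> ell1" "\<nu> (\<lambda>i. A n i - a i) \<le> \<epsilon> / (b + 1)" using da[of M n] M that by blast+
        have "norm (f n - T a) \<le> b * \<nu> (\<lambda>i. A n i - a i)"
          using upper[OF n(1)] diff(2)[OF A(1) ael] A(2) by simp
        also have "\<dots> \<le> b * (\<epsilon> / (b + 1))" using n(2) b by (rule mult_left_mono)
        also have "\<dots> < \<epsilon>" using b \<epsilon> by (simp add: field_simps)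
        finally show ?thesis .
      qed
      then show "\<exists>M. \<forall>n\<ge>M. norm (f n - T a) < \<epsilon>" by blast
    qed
    then show "x \<in> ?Y" using f(2) LIMSEQ_unique ael by blast
  qed
  define u :: "nat \<Rightarrow> nat \<Rightarrow> real" where "u j = (\<lambda>i. if i = j then 1 else 0)" for j
  have Tu: "u j \<in> ell1" "T (u j) = v j" for j
  proof -
    have "(\<lambda>i. \<bar>u j i\<bar>) = u j" by (auto simp: u_def)
    then show "u j \<in> ell1" using summable_single[of j "\<lambda>_. 1::real"] by (simp add: ell1_def u_def)
    have "(\<lambda>i. u j i *\<^sub>R v i) = (\<lambda>i. if i = j then v i else 0)" by (auto simp: u_def)
    then show "T (u j) = v j" using sums_unique[OF sums_single[of j v]] by (simp add: T_def)
  qed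
  have inf: "\<not> (\<exists>B. finite B \<and> span B = ?Y)"
  proof
    assume "\<exists>B. finite B \<and> span B = ?Y"
    then obtain B where B: "finite B" "span B = ?Y" by blast
    have lin: "(\<Sum>i<n. a i *\<^sub>R v i) = 0 \<Longrightarrow> i < n \<Longrightarrow> a i = 0" for a n i
    proof -
      assume *: "(\<Sum>i<n. a i *\<^sub>R v i) = 0" "i < n"
      have "c * (\<Sum>i<n. \<bar>a i\<bar>) \<le> 0" using c(2)[of a n] *(1) by simp
      then have "(\<Sum>i<n. \<bar>a i\<bar>) \<le> 0" using c(1) by (simp add: mult_le_0_iff)
      then have "\<bar>a i\<bar> \<le> 0" using member_le_sum[of i "{..<n}" "\<lambda>i. \<bar>a i\<bar>"] *(2) by simp
      then show "a i = 0" by simp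
    qed
    have injv: "inj v"
      by (rule injI) (metis Tu inj inj_onD u_def zero_neq_one)
    have "independent (v ` {..<n})" for n
      unfolding independent_explicit_finite_subsets
    proof (intro allI impI ballI)
      fix S h x assume S: "S \<subseteq> v ` {..<n}" "finite S" "(\<Sum>x\<in>S. h x *\<^sub>R x) = 0" "x \<in> S"
      define a where "a i = (if v i \<in> S then h (v i) else 0)" for i
      have "(\<Sum>i<n. a i *\<^sub>R v i) = (\<Sum>x\<in>v ` {..<n}. (if x \<in> S then h x else 0) *\<^sub>R x)"
        by (subst sum.reindex) (auto simp: a_def intro: inj_on_subset[OF injv])
      also have "\<dots> = (\<Sum>x\<in>S. h x *\<^sub>R x)"
        by (rule sum.mono_neutral_cong_right) (use S in auto)
      finally have "(\<Sum>i<n. a i *\<^sub>R v i) = 0" using S(3) by simp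
      moreover obtain i where "i < n" "x = v i" using S by blast
      ultimately show "h x = 0" using lin[of a n i] S(4) by (simp add: a_def)
    qed
    moreover have "v ` {..<n} \<subseteq> span B" for n unfolding B(2) using Tu by (metis image_subset_iff rev_image_eqI)
    ultimately have "card (v ` {..<n}) \<le> card B" for n using independent_span_bound[OF B(1)] by blast
    then have "n \<le> card B" for n using card_image[OF inj_on_subset[OF injv subset_UNIV], of "{..<n}"] by (metis card_lessThan)
    then show False using not_less_eq_eq by blast
  qed
  show ?thesis
    unfolding contains_ell1_def infdim_subspace_def
  proof (intro exI[of _ ?Y] exI[of _ T] conjI)
    show "bij_betw T ell1 ?Y" using inj by (simp add: bij_betw_def)
    show "\<exists>c>0. \<exists>C. \<forall>a\<in>ell1. c * (\<Sum>i. \<bar>a i\<bar>) \<le> norm (T a) \<and> norm (T a) \<le> C * (\<Sum>i. \<bar>a i\<bar>)"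
      using c(1) lower upper unfolding \<nu>_def by blast
  qed (use sub cl inf Tadd Tscale in auto)
qed

text \<open>With singleton intervals, an upper estimate says that normalised vectors indexed by a
  Schreier set satisfy a lower l_1 estimate with constant t. If one t serves for all countable
  ordinals, the tree of finite sequences with such an estimate is big, and an infinite branch of it
  spans l_1.\<close>

lemma (in schauder_bound) contains_ell1_if_uniform_est:
  assumes L: "ladder_system L"
    and ex: "\<And>\<beta>. \<exists>y. sub_block y e \<and> (\<exists>N. upper_est (schreier L \<beta>) y N t)"
  shows "contains_ell1 (UNIV :: 'a set)"
proof -
  have t: "1 \<le> t"
    using ex[of 0] upper_est_ge_one'[OF _ regular_schreier[OF L]] by blast
  obtain C :: "'a set" where C0: "countable C \<and> (\<forall>x \<epsilon>. 0 < \<epsilon> \<longrightarrow> (\<exists>z\<in>C. norm (z - x) < \<epsilon>))"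
    using countable_dense by (elim exE)
  then have C: "countable C" "\<And>x \<epsilon>. 0 < \<epsilon> \<Longrightarrow> \<exists>z\<in>C. norm (z - x) < \<epsilon>" by simp_all
  define T where "T = {s \<in> lists C. (\<forall>x\<in>set s. norm x \<le> 2) \<and>
      (\<forall>a. (\<Sum>i<length s. \<bar>a i\<bar>) \<le> 2 * t * norm (\<Sum>i<length s. a i *\<^sub>R s ! i))}"
  have "big_tree L T"
    unfolding big_tree_def
  proof
    fix \<beta>
    obtain y p N M where y: "blocks y e p M" "upper_est (schreier L \<beta>) y N t"
      using ex[of \<beta>] unfolding sub_block_def by blast
    \<comment> \<open>An error of 1 / (2 t) in each normalised vector costs half of the lower
      estimate, hence the constant 2 t in T.\<close>
    have "\<exists>z\<in>C. norm (z - (1 / norm (y i)) *\<^sub>R y i) < 1 / (2 * t)" for i by (rule C(2)) (use t in simp)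
    then obtain z where z: "\<And>i. z i \<in> C" "\<And>i. norm (z i - (1 / norm (y i)) *\<^sub>R y i) < 1 / (2 * t)" by metis
    have zn: "norm (z i) \<le> 2" for i
    proof -
      have "norm ((1 / norm (y i)) *\<^sub>R y i) \<le> 1" by simp
      moreover have "1 / (2 * t) \<le> 1" using t by simp
      ultimately show ?thesis using z(2)[of i] norm_triangle_sub[of "z i" "(1 / norm (y i)) *\<^sub>R y i"] by linarith
    qed
    have "map z (sorted_list_of_set F) \<in> T" if F: "F \<in> schreier L \<beta>" "\<forall>i\<in>F. max N M \<le> i" for F
    proof -
      have fin: "finite F" by (rule regularD(3)[OF regular_schreier[OF L] F(1)])
      define l where "l = sorted_list_of_set F"
      have l: "distinct l" "set l = F" "length l = card F" using fin by (simp_all add: l_def)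
      have bij: "bij_betw ((!) l) {..<length l} F" by (rule bij_betw_nth[OF l(1)]) (simp_all add: l)
      have "(\<Sum>i<length l. \<bar>a i\<bar>) \<le> 2 * t * norm (\<Sum>i<length l. a i *\<^sub>R z (l ! i))" for a
      proof -
        define A where "A j = (if j \<in> F then a (inv_into {..<length l} ((!) l) j) else 0)" for j
        have A: "a i = A (l ! i)" if "i < length l" for i
          using that bij inv_into_f_f[OF bij_betw_imp_inj_on[OF bij], of i] l(2) nth_mem[of i l] by (simp add: A_def)
        have re: "(\<Sum>i<length l. f (a i) (l ! i)) = (\<Sum>j\<in>F. f (A j) j)" for f :: "real \<Rightarrow> nat \<Rightarrow> 'z::comm_monoid_add"
          using sum.reindex_bij_betw[OF bij, of "\<lambda>j. f (A j) j"] A by simp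
        define m where "m = Max (insert 0 F)"
        have m: "j \<le> m" if "j \<in> F" for j using that fin by (simp add: m_def)
        define B where "B j = A j / norm (y j)" for j
        have yz: "norm (y j) \<noteq> 0" if "j \<in> F" for j using blocksD(3)[OF y(1), of j] F(2) that by auto
        have "(\<Sum>j\<in>F. \<bar>A j\<bar>) = (\<Sum>g\<in>F. norm (\<Sum>i=g..g. B i *\<^sub>R y i))"
          by (rule sum.cong) (use yz in \<open>auto simp: B_def\<close>)
        also have "\<dots> \<le> t * norm (\<Sum>i\<le>m. B i *\<^sub>R y i)"
        proof (rule upper_estD[OF y(2)])
          show "B i = 0" if "i < N" for i using that F(2) by (auto simp: B_def A_def)
          show "B i = 0" if "m < i" for i
          proof -
            have "i \<notin> F" using m[of i] that by auto
            then show ?thesis by (simp add: B_def A_def)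
          qed
        qed (use F in \<open>auto simp: interval_system_def\<close>)
        also have "(\<Sum>i\<le>m. B i *\<^sub>R y i) = (\<Sum>i\<in>F. B i *\<^sub>R y i)"
          by (rule sum.mono_neutral_right) (use m in \<open>auto simp: B_def A_def\<close>)
        also have "\<dots> = (\<Sum>j\<in>F. A j *\<^sub>R z j) - (\<Sum>j\<in>F. A j *\<^sub>R (z j - (1 / norm (y j)) *\<^sub>R y j))"
          by (simp add: sum_subtractf[symmetric] scaleR_diff_right B_def)
        also have "norm \<dots> \<le> norm (\<Sum>j\<in>F. A j *\<^sub>R z j) + (\<Sum>j\<in>F. \<bar>A j\<bar>) / (2 * t)"
        proof -
          have "norm (\<Sum>j\<in>F. A j *\<^sub>R (z j - (1 / norm (y j)) *\<^sub>R y j)) \<le> (\<Sum>j\<in>F. \<bar>A j\<bar> / (2 * t))"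
          proof (rule sum_norm_le)
            fix j
            have "\<bar>A j\<bar> * norm (z j - (1 / norm (y j)) *\<^sub>R y j) \<le> \<bar>A j\<bar> * (1 / (2 * t))"
              using z(2)[of j] by (intro mult_left_mono) auto
            then show "norm (A j *\<^sub>R (z j - (1 / norm (y j)) *\<^sub>R y j)) \<le> \<bar>A j\<bar> / (2 * t)" by simp
          qed
          then show ?thesis
            using norm_triangle_ineq4[of "\<Sum>j\<in>F. A j *\<^sub>R z j" "\<Sum>j\<in>F. A j *\<^sub>R (z j - (1 / norm (y j)) *\<^sub>R y j)"]
            by (simp add: sum_divide_distrib)
        qed
        finally have "(\<Sum>j\<in>F. \<bar>A j\<bar>) \<le> t * (norm (\<Sum>j\<in>F. A j *\<^sub>R z j) + (\<Sum>j\<in>F. \<bar>A j\<bar>) / (2 * t))"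
          using t by (simp add: mult_left_mono)
        then have "(\<Sum>j\<in>F. \<bar>A j\<bar>) \<le> 2 * t * norm (\<Sum>j\<in>F. A j *\<^sub>R z j)"
          using t by (simp add: distrib_left)
        then show ?thesis using re[of "\<lambda>x j. \<bar>x\<bar>"] re[of "\<lambda>x j. x *\<^sub>R z j"] by simp
      qed
      then show ?thesis using z(1) zn by (auto simp: T_def l_def[symmetric] in_lists_conv_set)
    qed
    then show "\<exists>y N. \<forall>F\<in>schreier L \<beta>. (\<forall>i\<in>F. N \<le> i) \<longrightarrow> map y (sorted_list_of_set F) \<in> T" by blast
  qed
  then obtain v where v: "\<And>n. map v [0..<n] \<in> T"
    using big_tree_branch[OF L _ C(1), of T] T_def by blast
  show ?thesis
  proof (rule contains_ell1I)
    show "norm (v i) \<le> 2" for i using v[of "Suc i"] by (simp add: T_def)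
    show "0 < 1 / (2 * t)" using t by simp
    fix n and a :: "nat \<Rightarrow> real"
    have "(\<Sum>i<n. \<bar>a i\<bar>) \<le> 2 * t * norm (\<Sum>i<n. a i *\<^sub>R map v [0..<n] ! i)" using v[of n] by (simp add: T_def)
    also have "(\<Sum>i<n. a i *\<^sub>R map v [0..<n] ! i) = (\<Sum>i<n. a i *\<^sub>R v i)" by (rule sum.cong) auto
    finally show "1 / (2 * t) * (\<Sum>i<n. \<bar>a i\<bar>) \<le> norm (\<Sum>i<n. a i *\<^sub>R v i)"
      using t by (simp add: field_simps)
  qed
qed

section \<open>Bounded distortion on block sequences\<close>

text \<open>The extension is the infimal convolution of \<open>f\<close> and \<open>C\<close> times the norm.\<close>

lemma equivalent_norm_extend:
  fixes V :: "'a::banach set"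
  assumes V: "subspace V"
    and tri: "\<And>x y. x \<in> V \<Longrightarrow> y \<in> V \<Longrightarrow> f (x + y) \<le> f x + f y"
    and hom: "\<And>r x. x \<in> V \<Longrightarrow> f (r *\<^sub>R x) = \<bar>r\<bar> * f x"
    and bnd: "\<And>x. x \<in> V \<Longrightarrow> c * norm x \<le> f x" "\<And>x. x \<in> V \<Longrightarrow> f x \<le> C * norm x"
    and cC: "0 < c" "c \<le> C"
  shows "\<exists>N. equivalent_norm_on UNIV N \<and> (\<forall>x\<in>V. N x = f x) \<and> (\<forall>x. c * norm x \<le> N x \<and> N x \<le> C * norm x)"
proof -
  define N where "N x = (INF u\<in>V. f u + C * norm (x - u))" for x
  have C: "0 < C" using cC by simp
  have V0: "0 \<in> V" by (rule subspace_0[OF V])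
  then have ne: "V \<noteq> {}" by blast
  have f0: "f 0 = 0" using hom[OF V0, of 0] by simp
  have low: "c * norm x \<le> f u + C * norm (x - u)" if "u \<in> V" for x u
  proof -
    have "c * norm x \<le> c * (norm u + norm (x - u))"
      using cC(1) norm_triangle_ineq[of u "x - u"] by (intro mult_left_mono) auto
    also have "\<dots> \<le> f u + C * norm (x - u)"
      using bnd(1)[OF that] mult_right_mono[OF cC(2) norm_ge_zero[of "x - u"]] by (simp add: distrib_left)
    finally show ?thesis .
  qed
  have bdd: "bdd_below ((\<lambda>u. f u + C * norm (x - u)) ` V)" for x
    using low by (intro bdd_belowI[of _ "c * norm x"]) auto
  have N_le: "N x \<le> f u + C * norm (x - u)" if "u \<in> V" for x u
    unfolding N_def by (rule cINF_lower[OF bdd that])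
  have N_ge: "r \<le> N x" if "\<And>u. u \<in> V \<Longrightarrow> r \<le> f u + C * norm (x - u)" for r x
    unfolding N_def by (rule cINF_greatest[OF ne that])
  have N_lower: "c * norm x \<le> N x" for x by (rule N_ge) (rule low)
  have N_upper: "N x \<le> C * norm x" for x using N_le[OF V0, of x] f0 by simp
  have N_eq: "N x = f x" if x: "x \<in> V" for x
  proof (rule antisym)
    show "N x \<le> f x" using N_le[OF x, of x] by simp
    show "f x \<le> N x"
    proof (rule N_ge)
      fix u assume u: "u \<in> V"
      have "x - u \<in> V" by (rule subspace_diff[OF V x u])
      then show "f x \<le> f u + C * norm (x - u)" using tri[OF u, of "x - u"] bnd(2)[of "x - u"] by simp
    qed
  qed
  have N_tri: "N (x + y) \<le> N x + N y" for x y
  proof -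
    have 1: "N (x + y) - (f w + C * norm (y - w)) \<le> N x" if w: "w \<in> V" for w
    proof (rule N_ge)
      fix u assume u: "u \<in> V"
      have "N (x + y) \<le> f (u + w) + C * norm (x + y - (u + w))" by (rule N_le[OF subspace_add[OF V u w]])
      also have "\<dots> \<le> (f u + f w) + C * (norm (x - u) + norm (y - w))"
        using tri[OF u w] norm_triangle_ineq[of "x - u" "y - w"] C
        by (intro add_mono mult_left_mono) (simp_all add: algebra_simps)
      finally show "N (x + y) - (f w + C * norm (y - w)) \<le> f u + C * norm (x - u)" by (simp add: distrib_left)
    qed
    have "N (x + y) - N x \<le> N y" by (rule N_ge) (use 1 in \<open>simp add: algebra_simps\<close>)
    then show ?thesis by simp
  qed
  have N_hom_le: "N (r *\<^sub>R x) \<le> \<bar>r\<bar> * N x" if r: "r \<noteq> 0" for r x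
  proof -
    have "N (r *\<^sub>R x) / \<bar>r\<bar> \<le> N x"
    proof (rule N_ge)
      fix u assume u: "u \<in> V"
      have "N (r *\<^sub>R x) \<le> f (r *\<^sub>R u) + C * norm (r *\<^sub>R x - r *\<^sub>R u)" by (rule N_le[OF subspace_scale[OF V u]])
      also have "\<dots> = \<bar>r\<bar> * (f u + C * norm (x - u))"
        by (simp add: hom[OF u] scaleR_diff_right[symmetric] distrib_left)
      finally show "N (r *\<^sub>R x) / \<bar>r\<bar> \<le> f u + C * norm (x - u)" using r by (simp add: field_simps)
    qed
    then show ?thesis using r by (simp add: field_simps)
  qed
  have N_hom: "N (r *\<^sub>R x) = \<bar>r\<bar> * N x" for r x
  proof (cases "r = 0")
    case True
    then show ?thesis using N_eq[OF V0] f0 by simp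
  next
    case False
    have "N x \<le> \<bar>inverse r\<bar> * N (r *\<^sub>R x)" using N_hom_le[of "inverse r" "r *\<^sub>R x"] False by simp
    then show ?thesis using N_hom_le[OF False, of x] False by (simp add: field_simps)
  qed
  have "equivalent_norm_on UNIV N"
    unfolding equivalent_norm_on_def using N_tri N_hom N_lower N_upper cC(1)
    by (intro conjI ballI allI exI[of _ c] exI[of _ C]) simp_all
  then show ?thesis using N_eq N_lower N_upper by (intro exI[of _ N]) simp
qed

text \<open>The infimum over subspaces need not be attained, hence a strictly larger D'. The
  quotients form a bounded set, so a pointwise bound can be read off their supremum.\<close>

lemma distortion_subspace:
  fixes Y :: "'a::banach set"
  assumes bd: "bounded_distortion (UNIV :: 'a set) D" and Y: "infdim_subspace Y"
    and N: "equivalent_norm_on UNIV N" and D': "D < D'"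
  shows "\<exists>Z. infdim_subspace Z \<and> Z \<subseteq> Y \<and>
    (\<forall>x\<in>Z. \<forall>y\<in>Z. norm x = 1 \<longrightarrow> norm y = 1 \<longrightarrow> N x \<le> D' * N y)"
proof -
  let ?S = "\<lambda>Z. {N x / N y |x y. x \<in> Z \<and> y \<in> Z \<and> norm x = 1 \<and> norm y = 1}"
  obtain c C where cC: "0 < c" "\<And>x. c * norm x \<le> N x" "\<And>x. N x \<le> C * norm x"
    using N unfolding equivalent_norm_on_def by (metis UNIV_I)
  have "norm_distortion Y N < D'" using bd N Y D' unfolding bounded_distortion_def by (metis le_less_trans subset_UNIV)
  then have "Inf ((\<lambda>Z. Sup (?S Z)) ` {Z. infdim_subspace Z \<and> Z \<subseteq> Y}) < D'" by (simp only: norm_distortion_def)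
  moreover have "(\<lambda>Z. Sup (?S Z)) ` {Z. infdim_subspace Z \<and> Z \<subseteq> Y} \<noteq> {}" using Y by blast
  ultimately have "\<exists>s\<in>(\<lambda>Z. Sup (?S Z)) ` {Z. infdim_subspace Z \<and> Z \<subseteq> Y}. s < D'"
    by (intro cInf_lessD)
  then obtain s where "s \<in> (\<lambda>Z. Sup (?S Z)) ` {Z. infdim_subspace Z \<and> Z \<subseteq> Y}" "s < D'"
    by (elim bexE)
  then obtain Z where "Z \<in> {Z. infdim_subspace Z \<and> Z \<subseteq> Y}" "s = Sup (?S Z)" by (elim imageE)
  then have Z: "infdim_subspace Z" "Z \<subseteq> Y" "Sup (?S Z) < D'" using \<open>s < D'\<close> by simp_all
  show ?thesis
  proof (intro exI[of _ Z] conjI Z(1,2) ballI impI)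
    fix x y assume xy: "x \<in> Z" "y \<in> Z" "norm x = 1" "norm y = 1"
    have Ny: "0 < N y" using cC(1) cC(2)[of y] xy by simp
    have "bdd_above (?S Z)"
    proof (rule bdd_aboveI[of _ "C / c"])
      fix r assume "r \<in> ?S Z"
      then obtain u v where uv: "r = N u / N v" "norm u = 1" "norm v = 1" by blast
      have "N u \<le> C" "c \<le> N v" "0 \<le> N u" using cC(2,3)[of u] cC(2,3)[of v] cC(1) uv by auto
      then show "r \<le> C / c" unfolding uv(1) using cC(1) by (intro frac_le) auto
    qed
    then have "N x / N y \<le> Sup (?S Z)" by (intro cSup_upper) (use xy in blast)+
    then have "N x / N y \<le> D'" using Z(3) by simp
    then show "N x \<le> D' * N y" using Ny by (simp add: field_simps)
  qed
qed

context schauder_bound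
begin

text \<open>P n has finite rank and so cannot be injective on an infinite-dimensional
  subspace.\<close>

lemma infdim_kernel:
  assumes Z: "infdim_subspace Z"
  obtains z where "z \<in> Z" "norm z = 1" "P n z = 0"
proof -
  have sub: "subspace Z" and inf: "\<And>B. finite B \<Longrightarrow> span B \<noteq> Z" using Z by (auto simp: infdim_subspace_def)
  have "\<exists>z\<in>Z. z \<noteq> 0 \<and> P n z = 0"
  proof (rule ccontr)
    assume *: "\<not> ?thesis"
    have inj: "inj_on (P n) Z"
    proof (rule inj_onI)
      fix x y assume xy: "x \<in> Z" "y \<in> Z" "P n x = P n y"
      have "x - y \<in> Z" "P n (x - y) = 0" using xy subspace_diff[OF sub] by (auto simp: P_diff)
      then show "x = y" using * by auto
    qed
    obtain B where B: "B \<subseteq> Z" "independent B" "Z \<subseteq> span B" by (rule maximal_independent_subset)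
    have spB: "span B = Z" using B span_minimal[OF B(1) sub] by blast
    have "independent (P n ` B)"
      by (rule linear_independent_injective_image[OF linear_P B(2)]) (use inj spB in simp)
    moreover have "P n ` B \<subseteq> span (e ` {1..n})" using P_span by blast
    ultimately have "finite (P n ` B)" using independent_span_bound[of "e ` {1..n}"] by simp
    then have "finite B" by (rule finite_imageD) (rule inj_on_subset[OF inj B(1)])
    then show False using inf spB by blast
  qed
  then obtain z where z: "z \<in> Z" "z \<noteq> 0" "P n z = 0" by blast
  show ?thesis
    by (rule that[of "(1 / norm z) *\<^sub>R z"]) (use z subspace_scale[OF sub] in \<open>auto simp: P_scale\<close>)
qed

text \<open>The test is the given norm itself, whose quotients on the unit sphere are all 1.\<close>

lemma bounded_distortion_ge_one:
  assumes "bounded_distortion (UNIV :: 'a set) D"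
  shows "1 \<le> D"
proof (rule field_le_epsilon)
  fix \<epsilon> :: real assume "0 < \<epsilon>"
  then have D: "D < D + \<epsilon>" by simp
  have N: "equivalent_norm_on UNIV (norm :: 'a \<Rightarrow> real)"
    unfolding equivalent_norm_on_def by (auto simp: norm_triangle_ineq intro!: exI[of _ 1])
  from distortion_subspace[OF assms infdim_block_span[OF blocks_self order_refl] N D]
  obtain Z :: "'a set" where Z: "infdim_subspace Z"
    "\<forall>x\<in>Z. \<forall>y\<in>Z. norm x = 1 \<longrightarrow> norm y = 1 \<longrightarrow> norm x \<le> (D + \<epsilon>) * norm y"
    by (elim exE conjE)
  obtain z where "z \<in> Z" "norm z = 1" by (rule infdim_kernel[OF Z(1)])
  then show "1 \<le> D + \<epsilon>" using Z(2) by force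
qed

text \<open>A unit vector z of Z annihilated by P (p m) has no initial part. The initial part of an
  approximant x is then the projection of x - z, so removing it multiplies the error by at most 1 +
  K.\<close>

lemma gliding_hump:
  assumes bl: "blocks y e p N" and NM: "N \<le> M" and Z: "infdim_subspace Z" "Z \<subseteq> closure (span (y ` {M..}))"
    and m: "M \<le> m" and \<epsilon>: "0 < \<epsilon>"
  shows "\<exists>z u m'. z \<in> Z \<and> norm z = 1 \<and> m < m' \<and> u \<in> span (y ` {m<..m'}) \<and> norm (z - u) < \<epsilon>"
proof -
  obtain z where z: "z \<in> Z" "norm z = 1" "P (p m) z = 0" by (rule infdim_kernel[OF Z(1)])
  have "0 < \<epsilon> / (1 + K)" using \<epsilon> K1 by simp
  then obtain x where x: "x \<in> span (y ` {M..})" "norm (z - x) < \<epsilon> / (1 + K)"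
    using z(1) Z(2) unfolding closure_approachable
    by (metis (no_types, lifting) closure_approachable dist_norm norm_minus_commute subsetD)
  obtain a k where a: "\<And>i. i < M \<Longrightarrow> a i = 0" "\<And>i. k < i \<Longrightarrow> a i = 0" "x = (\<Sum>i\<le>k. a i *\<^sub>R y i)"
    using span_tail_sum[OF x(1)] by blast
  define m' where "m' = max k (Suc m)"
  have aN: "a i = 0" if "i < N" for i using a(1) that NM by simp
  have am: "a i = 0" if "m' < i" for i using a(2) that by (simp add: m'_def)
  have xm: "x = (\<Sum>i\<le>m'. a i *\<^sub>R y i)"
    unfolding a(3) by (rule sum.mono_neutral_left) (use a(2) in \<open>auto simp: m'_def\<close>)
  define u where "u = x - P (p m) x"
  have "Q p (Suc m) m' x = (\<Sum>i=Suc m..m'. a i *\<^sub>R y i)"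
    unfolding xm by (rule Q_block_sum[OF bl aN am]) (simp_all add: m'_def)
  moreover have "P (p m') x = x" unfolding xm by (rule P_block_sum[OF bl aN am])
  ultimately have "u = (\<Sum>i=Suc m..m'. a i *\<^sub>R y i)" by (simp add: Q_def u_def)
  then have "u \<in> span (y ` {m<..m'})" by (auto intro!: span_sum span_scale intro: span_base)
  moreover have "norm (z - u) < \<epsilon>"
  proof -
    have "z - u = (z - x) - P (p m) (z - x)" by (simp add: u_def P_diff z(3))
    then have "norm (z - u) \<le> norm (z - x) + norm (P (p m) (z - x))"
      using norm_triangle_ineq4[of "z - x" "P (p m) (z - x)"] by metis
    also have "\<dots> \<le> norm (z - x) + K * norm (z - x)" using P_bound[of "p m" "z - x"] by simp
    also have "\<dots> = (1 + K) * norm (z - x)" by (simp add: distrib_right)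
    also have "\<dots> < \<epsilon>" using x(2) K1 by (simp add: field_simps)
    finally show ?thesis .
  qed
  moreover have "m < m'" by (simp add: m'_def)
  ultimately show ?thesis using z by blast
qed

text \<open>Bounded distortion yields an arbitrary subspace Z, whereas the later arguments work with
  block sequences. Blocks close to vectors of Z keep their whole span close to Z, because the
  coefficients of x along them are at most 4 K norm x.\<close>

lemma block_perturbation:
  assumes bl: "blocks y e p N" and NM: "N \<le> M" and Z: "infdim_subspace Z" "Z \<subseteq> closure (span (y ` {M..}))"
    and \<eta>: "0 < \<eta>" "\<eta> \<le> 1"
  obtains v M' where "sub_block v y" "span (v ` {M'..}) \<subseteq> span (y ` {M..})"
    "\<And>x. x \<in> span (v ` {M'..}) \<Longrightarrow> \<exists>x'\<in>Z. norm (x - x') \<le> \<eta> * norm x"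
proof -
  \<comment> \<open>Chosen so that 4 K norm x times \<epsilon> (i - 1) is \<eta> / 2 norm x / 2^i,
    and these sum to at most \<eta> norm x. In the coefficient bound, 2 K comes from a one-block
    projection and a further 2 from norm (v i) being at least 1/2.\<close>
  define \<epsilon> where "\<epsilon> j = \<eta> / (8 * K) * (1/2) ^ Suc j" for j
  have \<epsilon>: "0 < \<epsilon> j" "\<epsilon> j \<le> 1/2" for j
  proof -
    show "0 < \<epsilon> j" using \<eta> K1 by (simp add: \<epsilon>_def)
    have "\<eta> / (8 * K) \<le> 1" using \<eta> K1 by (simp add: divide_le_eq)
    then have "\<epsilon> j \<le> 1 * (1/2) ^ Suc j"
      unfolding \<epsilon>_def by (rule mult_right_mono) simp
    also have "\<dots> \<le> 1/2" by (simp add: power_le_one)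
    finally show "\<epsilon> j \<le> 1/2" .
  qed
  have "\<forall>m j. \<exists>z u m'. M \<le> m \<longrightarrow> z \<in> Z \<and> norm z = 1 \<and> m < m' \<and> u \<in> span (y ` {m<..m'}) \<and> norm (z - u) < \<epsilon> j"
    using gliding_hump[OF bl NM Z _ \<epsilon>(1)] by blast
  then obtain zf uf nx where nx: "\<And>m j. M \<le> m \<Longrightarrow> zf m j \<in> Z \<and> norm (zf m j) = 1 \<and> m < nx m j \<and>
      uf m j \<in> span (y ` {m<..nx m j}) \<and> norm (zf m j - uf m j) < \<epsilon> j" by metis
  define q where "q = rec_nat M (\<lambda>j m. nx m j)"
  have q: "q 0 = M" "q (Suc j) = nx (q j) j" for j by (simp_all add: q_def)
  have Mq: "M \<le> q j" for j
  proof (induction j)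
    case (Suc j)
    then show ?case using nx[OF Suc, of j] by (simp add: q)
  qed (simp add: q)
  have qs: "strict_mono q" by (rule strict_monoI_Suc) (use nx[OF Mq] q in simp)
  define v where "v i = uf (q (i - 1)) (i - 1)" for i
  define z where "z i = zf (q (i - 1)) (i - 1)" for i
  have z: "z i \<in> Z" "norm (z i) = 1" "norm (z i - v i) < \<epsilon> (i - 1)" for i
    using nx[OF Mq] by (auto simp: z_def v_def)
  have v: "v i \<in> span (y ` {q (i - 1)<..q i})" if "1 \<le> i" for i
    using nx[OF Mq, of "i - 1" "i - 1"] q(2)[of "i - 1"] that by (simp add: v_def)
  have vn: "1/2 \<le> norm (v i)" for i
    using z(2,3)[of i] \<epsilon>(2)[of "i - 1"] norm_triangle_ineq2[of "z i" "v i"] by linarith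
  have vb: "blocks v y q 1"
    unfolding blocks_def using qs v vn by (metis norm_zero not_le order_refl zero_less_divide_1_iff zero_less_numeral)
  define M' where "M' = max 1 N"
  have vbe: "blocks v e (p \<circ> q) M'" unfolding M'_def by (rule blocks_trans[OF vb bl])
  have M'1: "1 \<le> M'" by (simp add: M'_def)
  show ?thesis
  proof (rule that)
    show "sub_block v y" using vb by (auto simp: sub_block_def)
    have "v i \<in> span (y ` {M..})" if "M' \<le> i" for i
    proof -
      have "{q (i - 1)<..q i} \<subseteq> {M..}" using Mq[of "i - 1"] by auto
      then have "span (y ` {q (i - 1)<..q i}) \<subseteq> span (y ` {M..})" by (intro span_mono image_mono)
      then show ?thesis using v that M'1 by auto
    qed
    then have "v ` {M'..} \<subseteq> span (y ` {M..})" by auto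
    then show "span (v ` {M'..}) \<subseteq> span (y ` {M..})" by (simp add: span_minimal)
    fix x assume x: "x \<in> span (v ` {M'..})"
    obtain a k where a: "\<And>i. i < M' \<Longrightarrow> a i = 0" "\<And>i. k < i \<Longrightarrow> a i = 0" "x = (\<Sum>i\<le>k. a i *\<^sub>R v i)"
      using span_tail_sum[OF x] by blast
    have an: "\<bar>a i\<bar> \<le> 4 * K * norm x" for i
    proof (cases "1 \<le> i")
      case True
      have "Q (p \<circ> q) i i x = (\<Sum>j=i..i. a j *\<^sub>R v j)"
        unfolding a(3) by (rule Q_block_sum[OF vbe a(1,2) True order_refl])
      then have "a i *\<^sub>R v i = P ((p \<circ> q) i) x - P ((p \<circ> q) (i - 1)) x" by (simp add: Q_def)
      then have "norm (a i *\<^sub>R v i) \<le> norm (P ((p \<circ> q) i) x) + norm (P ((p \<circ> q) (i - 1)) x)"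
        using norm_triangle_ineq4[of "P ((p \<circ> q) i) x" "P ((p \<circ> q) (i - 1)) x"] by metis
      then have "\<bar>a i\<bar> * norm (v i) \<le> K * norm x + K * norm x"
        using P_bound[of "(p \<circ> q) i" x] P_bound[of "(p \<circ> q) (i - 1)" x] by simp
      moreover have "\<bar>a i\<bar> * (1/2) \<le> \<bar>a i\<bar> * norm (v i)" using vn by (intro mult_left_mono) auto
      ultimately show ?thesis by simp
    next
      case False
      then show ?thesis using a(1)[of i] M'1 K1 by simp
    qed
    define x' where "x' = (\<Sum>i\<le>k. a i *\<^sub>R z i)"
    have "x' \<in> Z"
      unfolding x'_def using z(1) Z(1) by (intro subspace_sum subspace_scale) (auto simp: infdim_subspace_def)
    moreover have "norm (x - x') \<le> \<eta> * norm x"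
    proof -
      have "x - x' = (\<Sum>i\<le>k. a i *\<^sub>R (v i - z i))"
        by (simp add: a(3) x'_def sum_subtractf scaleR_diff_right)
      also have "norm \<dots> \<le> (\<Sum>i\<le>k. \<eta> / 2 * norm x * (1/2) ^ i)"
      proof (rule sum_norm_le)
        fix i
        show "norm (a i *\<^sub>R (v i - z i)) \<le> \<eta> / 2 * norm x * (1/2) ^ i"
        proof (cases "1 \<le> i")
          case True
          have "norm (a i *\<^sub>R (v i - z i)) = \<bar>a i\<bar> * norm (z i - v i)" by (simp add: norm_minus_commute)
          also have "\<dots> \<le> (4 * K * norm x) * \<epsilon> (i - 1)"
            using an z(3)[of i] K1 by (intro mult_mono) auto
          also have "\<dots> = \<eta> / 2 * norm x * (1/2) ^ i" using K1 True by (simp add: \<epsilon>_def)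
          finally show ?thesis .
        next
          case False
          then show ?thesis using a(1)[of i] M'1 \<eta> by simp
        qed
      qed
      also have "\<dots> = \<eta> / 2 * norm x * (\<Sum>i\<le>k. (1/2) ^ i)" by (simp add: sum_distrib_left)
      also have "\<dots> \<le> \<eta> / 2 * norm x * 2"
      proof (rule mult_left_mono)
        have "(\<Sum>i\<le>k. (1/2::real) ^ i) = 2 - (1/2) ^ k" by (induction k) (simp_all add: field_simps)
        then show "(\<Sum>i\<le>k. (1/2::real) ^ i) \<le> 2" by simp
      qed (use \<eta> in simp)
      finally show ?thesis by simp
    qed
    ultimately show "\<exists>x'\<in>Z. norm (x - x') \<le> \<eta> * norm x" by blast
  qed
qed

text \<open>The factor 2 D leaves room for two losses: the distortion is only approached, for which
  3/2 D is used, and the subspace found is replaced by a nearby block sequence, for which A is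
  lowered by 2 percent.\<close>

lemma distortion_block:
  assumes bd: "bounded_distortion (UNIV :: 'a set) D"
    and bl: "blocks y e p N" and NM: "N \<le> M"
    and tri: "\<And>u v. u \<in> span (y ` {M..}) \<Longrightarrow> v \<in> span (y ` {M..}) \<Longrightarrow> f (u + v) \<le> f u + f v"
    and hom: "\<And>r u. u \<in> span (y ` {M..}) \<Longrightarrow> f (r *\<^sub>R u) = \<bar>r\<bar> * f u"
    and bnd: "\<And>u. u \<in> span (y ` {M..}) \<Longrightarrow> \<gamma> * norm u \<le> f u"
      "\<And>u. u \<in> span (y ` {M..}) \<Longrightarrow> f u \<le> C * norm u"
    and \<gamma>: "0 < \<gamma>"
  obtains v M' A where "sub_block v y" "0 < A" "span (v ` {M'..}) \<subseteq> span (y ` {M..})"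
    "\<And>x. x \<in> span (v ` {M'..}) \<Longrightarrow> A * norm x \<le> f x \<and> f x \<le> 2 * D * A * norm x"
proof -
  let ?V = "span (y ` {M..})"
  have D1: "1 \<le> D" by (rule bounded_distortion_ge_one[OF bd])
  have yV: "y M \<in> ?V" "y M \<noteq> 0" using blocksD(3)[OF bl NM] by (auto intro: span_base)
  have cC: "\<gamma> \<le> C"
  proof -
    have "\<gamma> * norm (y M) \<le> C * norm (y M)" using bnd[OF yV(1)] by simp
    then show ?thesis using yV(2) by simp
  qed
  \<comment> \<open>Bounded distortion speaks of norms on the whole space, while f is controlled
    only on the span.\<close>
  have "\<exists>F. equivalent_norm_on UNIV F \<and> (\<forall>x\<in>?V. F x = f x) \<and> (\<forall>x. \<gamma> * norm x \<le> F x \<and> F x \<le> C * norm x)"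
    by (rule equivalent_norm_extend[OF subspace_span]) (fact tri hom bnd \<gamma> cC)+
  then obtain F where F0: "equivalent_norm_on UNIV F" "\<forall>x\<in>?V. F x = f x"
    "\<forall>x. \<gamma> * norm x \<le> F x \<and> F x \<le> C * norm x" by (elim exE conjE)
  then have F: "equivalent_norm_on UNIV F" "\<And>x. x \<in> ?V \<Longrightarrow> F x = f x"
    "\<And>x. \<gamma> * norm x \<le> F x" "\<And>x. F x \<le> C * norm x" by simp_all
  have Ftri: "F (u + v) \<le> F u + F v" and Fhom: "F (r *\<^sub>R u) = \<bar>r\<bar> * F u" for u v r
    using F(1) by (auto simp: equivalent_norm_on_def)
  have D: "D < 3/2 * D" using D1 by simp
  from distortion_subspace[OF bd infdim_block_span[OF bl NM] F(1) D]
  obtain Z :: "'a set" where Z0: "infdim_subspace Z" "Z \<subseteq> closure ?V"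
    "\<forall>x\<in>Z. \<forall>y\<in>Z. norm x = 1 \<longrightarrow> norm y = 1 \<longrightarrow> F x \<le> 3/2 * D * F y"
    by (elim exE conjE)
  then have Z: "infdim_subspace Z" "Z \<subseteq> closure ?V"
    "\<And>x y. x \<in> Z \<Longrightarrow> y \<in> Z \<Longrightarrow> norm x = 1 \<Longrightarrow> norm y = 1 \<Longrightarrow> F x \<le> 3/2 * D * F y"
    by simp_all
  define A where "A = (INF z\<in>{z\<in>Z. norm z = 1}. F z)"
  obtain z0 where z0: "z0 \<in> Z" "norm z0 = 1" by (rule infdim_kernel[OF Z(1)])
  have bddA: "bdd_below (F ` {z\<in>Z. norm z = 1})"
  proof (rule bdd_belowI[of _ \<gamma>])
    fix r assume "r \<in> F ` {z\<in>Z. norm z = 1}"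
    then obtain z where "r = F z" "norm z = 1" by auto
    then show "\<gamma> \<le> r" using F(3)[of z] by simp
  qed
  have Ac: "\<gamma> \<le> A"
    unfolding A_def
  proof (rule cINF_greatest)
    show "{z \<in> Z. norm z = 1} \<noteq> {}" using z0 by blast
    show "\<gamma> \<le> F z" if "z \<in> {z \<in> Z. norm z = 1}" for z using F(3)[of z] that by simp
  qed
  have A1: "A \<le> F z" if "z \<in> Z" "norm z = 1" for z
    unfolding A_def by (rule cINF_lower[OF bddA]) (use that in simp)
  have A2: "F z \<le> 3/2 * D * A" if z: "z \<in> Z" "norm z = 1" for z
  proof -
    have "F z / (3/2 * D) \<le> A"
      unfolding A_def
    proof (rule cINF_greatest)
      show "{z \<in> Z. norm z = 1} \<noteq> {}" using z0 by blast
      fix u assume "u \<in> {z \<in> Z. norm z = 1}"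
      then have "F z \<le> 3/2 * D * F u" using Z(3)[OF z(1) _ z(2)] by blast
      then show "F z / (3/2 * D) \<le> F u" using D1 by (simp add: field_simps)
    qed
    then show ?thesis using D1 by (simp add: field_simps)
  qed
  have AZ: "A * norm z \<le> F z \<and> F z \<le> 3/2 * D * A * norm z" if z: "z \<in> Z" for z
  proof (cases "z = 0")
    case True
    then show ?thesis using Fhom[of 0 0] by simp
  next
    case False
    define u where "u = (1 / norm z) *\<^sub>R z"
    have u: "u \<in> Z" "norm u = 1"
      using z Z(1) False by (auto simp: u_def infdim_subspace_def subspace_scale)
    have "z = norm z *\<^sub>R u" using False by (simp add: u_def)
    then have "F z = norm z * F u" by (metis Fhom abs_norm_cancel)
    then show ?thesis using A1[OF u] A2[OF u] mult_left_mono[OF A1[OF u] norm_ge_zero[of z]] mult_left_mono[OF A2[OF u] norm_ge_zero[of z]]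
      by (simp add: mult_ac)
  qed
  \<comment> \<open>As \<gamma> \<le> A, the value of F at the perturbation is at most A / 100 times
    the norm.\<close>
  define \<eta> where "\<eta> = \<gamma> / (100 * C)"
  have C0: "0 < C" using \<gamma> cC by simp
  have \<eta>: "0 < \<eta>" "\<eta> \<le> 1/100" "C * \<eta> \<le> A / 100" using \<gamma> cC C0 Ac by (simp_all add: \<eta>_def divide_le_eq)
  obtain v M' where v: "sub_block v y" "span (v ` {M'..}) \<subseteq> ?V"
    "\<And>x. x \<in> span (v ` {M'..}) \<Longrightarrow> \<exists>x'\<in>Z. norm (x - x') \<le> \<eta> * norm x"
    by (rule block_perturbation[OF bl NM Z(1,2) \<eta>(1)]) (use \<eta>(2) in auto)
  have A0: "0 < A" using \<gamma> Ac by simp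
  show ?thesis
  proof (rule that[OF v(1) _ v(2)])
    show "0 < 98/100 * A" using A0 by simp
    fix x assume x: "x \<in> span (v ` {M'..})"
    obtain x' where x': "x' \<in> Z" "norm (x - x') \<le> \<eta> * norm x" using v(3)[OF x] by blast
    define b where "b = norm x"
    have b: "0 \<le> b" by (simp add: b_def)
    have d: "norm (x - x') \<le> 1/100 * b"
      using x'(2) mult_right_mono[OF \<eta>(2) b] by (simp add: b_def)
    have Fd: "F (x - x') \<le> A / 100 * b" "F (x' - x) \<le> A / 100 * b"
    proof -
      have "C * norm (x - x') \<le> C * (\<eta> * b)" using x'(2) C0 by (simp add: b_def)
      also have "\<dots> \<le> A / 100 * b" using mult_right_mono[OF \<eta>(3) b] by simp
      finally show "F (x - x') \<le> A / 100 * b" "F (x' - x) \<le> A / 100 * b"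
        using F(4)[of "x - x'"] F(4)[of "x' - x"] by (simp_all add: norm_minus_commute)
    qed
    have n1: "99/100 * b \<le> norm x'" "norm x' \<le> 101/100 * b"
      using d norm_triangle_ineq2[of x x'] norm_triangle_ineq2[of x' x] by (simp_all add: b_def norm_minus_commute)
    have F1: "F x \<le> F x' + A / 100 * b" "F x' \<le> F x + A / 100 * b"
      using Ftri[of x' "x - x'"] Ftri[of x "x' - x"] Fd by simp_all
    have "A * (99/100 * b) \<le> A * norm x'" using n1(1) A0 by (intro mult_left_mono) auto
    then have low: "98/100 * A * b \<le> F x" using F1(2) AZ[OF x'(1)] by (simp add: algebra_simps)
    have "3/2 * D * A * norm x' \<le> 3/2 * D * A * (101/100 * b)" using n1(2) A0 D1 by (intro mult_left_mono) auto
    then have "F x \<le> 3/2 * D * A * (101/100 * b) + A / 100 * b" using F1(1) AZ[OF x'(1)] by linarith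
    also have "A / 100 * b \<le> D * (A / 100 * b)" using D1 A0 b mult_right_mono[OF D1, of "A / 100 * b"] by simp
    finally have "F x \<le> (3/2 * (101/100) + 1/100) * (D * A * b)" by (simp add: algebra_simps)
    \<comment> \<open>The left factor is 1.525 and the right one 1.96, so the two losses
      fit.\<close>
    also have "\<dots> \<le> (2 * (98/100)) * (D * A * b)" using D1 A0 b by (intro mult_right_mono) auto
    finally have up: "F x \<le> 2 * D * (98/100 * A) * b" by (simp add: mult_ac)
    have "F x = f x" using F(2) v(2) x by blast
    then show "98/100 * A * norm x \<le> f x \<and> f x \<le> 2 * D * (98/100 * A) * norm x"
      using low up by (simp add: b_def)
  qed
qed

end

section \<open>Geometric growth of the constants\<close>

text \<open>The spreading functions of \<open>schreier_add_comp\<close> and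
  \<open>schreier_comp_add\<close>, one pair for each n and m, are dominated by a single sequence.
  Every faster q' is covered as well, so that q can later be shifted.\<close>

lemma schreier_fast_sequence:
  assumes L: "ladder_system L"
  shows "\<exists>q. strict_mono q \<and> (\<forall>q' n m. strict_mono q' \<longrightarrow> (\<forall>i. q i \<le> q' i) \<longrightarrow> (\<exists>N.
      (\<forall>F\<in>schreier L (a * ord_of_nat (n + m)). (\<forall>i\<in>F. N \<le> i) \<longrightarrow>
        (\<lambda>g. Suc (q' (g - 1))) ` F \<in> family_comp (schreier L (a * ord_of_nat m)) (schreier L (a * ord_of_nat n))) \<and>
      (\<forall>F\<in>family_comp (schreier L (a * ord_of_nat m)) (schreier L (a * ord_of_nat n)). (\<forall>i\<in>F. N \<le> i) \<longrightarrow>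
        (\<lambda>g. Suc (q' (g - 1))) ` F \<in> schreier L (a * ord_of_nat (n + m)))))"
proof -
  let ?S = "\<lambda>n. schreier L (a * ord_of_nat n)"
  have "\<forall>n m. \<exists>h. \<forall>F\<in>?S (n + m). \<forall>\<phi>. strict_mono_on F \<phi> \<longrightarrow> (\<forall>i\<in>F. h i \<le> \<phi> i) \<longrightarrow>
      \<phi> ` F \<in> family_comp (?S m) (?S n)"
    unfolding mult_ord_of_nat_add using schreier_add_comp[OF L] by blast
  then obtain h where h: "\<And>n m F \<phi>. F \<in> ?S (n + m) \<Longrightarrow> strict_mono_on F \<phi> \<Longrightarrow> (\<And>i. i \<in> F \<Longrightarrow> h n m i \<le> \<phi> i) \<Longrightarrow>
      \<phi> ` F \<in> family_comp (?S m) (?S n)" by metis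
  have "\<forall>n m. \<exists>k. \<forall>F\<in>family_comp (?S m) (?S n). \<forall>\<phi>. strict_mono_on F \<phi> \<longrightarrow> (\<forall>i\<in>F. k i \<le> \<phi> i) \<longrightarrow>
      \<phi> ` F \<in> ?S (n + m)"
    unfolding mult_ord_of_nat_add using schreier_comp_add[OF L] by blast
  then obtain k where k: "\<And>n m F \<phi>. F \<in> family_comp (?S m) (?S n) \<Longrightarrow> strict_mono_on F \<phi> \<Longrightarrow> (\<And>i. i \<in> F \<Longrightarrow> k n m i \<le> \<phi> i) \<Longrightarrow>
      \<phi> ` F \<in> ?S (n + m)" by metis
  \<comment> \<open>At i this dominates the functions of all n and m up to i, which is why sets must
    start at or after max 1 (max n m).\<close>
  define w where "w i = Suc (\<Sum>n\<le>i. \<Sum>m\<le>i. h n m i + k n m i)" for i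
  have w: "h n m i \<le> w i" "k n m i \<le> w i" if "n \<le> i" "m \<le> i" for n m i
  proof -
    have "h n m i + k n m i \<le> (\<Sum>m\<le>i. h n m i + k n m i)"
      using that by (intro member_le_sum[of m "{..i}" "\<lambda>m. h n m i + k n m i"]) auto
    also have "\<dots> \<le> (\<Sum>n\<le>i. \<Sum>m\<le>i. h n m i + k n m i)"
      using that by (intro member_le_sum[of n "{..i}" "\<lambda>n. \<Sum>m\<le>i. h n m i + k n m i"]) auto
    finally show "h n m i \<le> w i" "k n m i \<le> w i" by (simp_all add: w_def)
  qed
  \<comment> \<open>Left endpoints are moved from g to Suc (q (g - 1)), so q (g - 1) has to be at
    least w g.\<close>
  define q where "q j = (\<Sum>i\<le>j. w (Suc i))" for j
  have qs: "strict_mono q" by (rule strict_monoI_Suc) (simp add: q_def w_def)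
  have qw: "w (Suc j) \<le> q j" for j
    unfolding q_def by (rule member_le_sum[of j "{..j}" "\<lambda>i. w (Suc i)"]) auto
  show ?thesis
  proof (intro exI[of _ q] conjI qs allI impI)
    fix q' :: "nat \<Rightarrow> nat" and n m assume q': "strict_mono q'" "\<forall>i. q i \<le> q' i"
    define \<phi> where "\<phi> g = Suc (q' (g - 1))" for g
    have \<phi>w: "w g \<le> \<phi> g" if "1 \<le> g" for g
      using qw[of "g - 1"] spec[OF q'(2), of "g - 1"] that by (simp add: \<phi>_def)
    have \<phi>s: "strict_mono_on F \<phi>" if "0 \<notin> F" for F
    proof (rule strict_mono_onI)
      fix r s assume "r \<in> F" "r < s"
      moreover from this that have "1 \<le> r" by (metis One_nat_def Suc_leI gr0I)
      ultimately show "\<phi> r < \<phi> s" using strict_mono_less[OF q'(1)] by (simp add: \<phi>_def)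
    qed
    have zero: "0 \<notin> F" if "F \<in> ?S j" for F j by (rule regularD(4)[OF regular_schreier[OF L] that])
    have zero': "0 \<notin> F" if "F \<in> family_comp (?S m) (?S n)" for F
      by (rule regularD(4)[OF regular_family_comp[OF regular_schreier[OF L] regular_schreier[OF L]] that])
    have bnd: "h n m i \<le> \<phi> i \<and> k n m i \<le> \<phi> i" if "max 1 (max n m) \<le> i" for i
      using w[of n i m] \<phi>w[of i] that by simp
    show "\<exists>N. (\<forall>F\<in>?S (n + m). (\<forall>i\<in>F. N \<le> i) \<longrightarrow> (\<lambda>g. Suc (q' (g - 1))) ` F \<in> family_comp (?S m) (?S n)) \<and>
      (\<forall>F\<in>family_comp (?S m) (?S n). (\<forall>i\<in>F. N \<le> i) \<longrightarrow> (\<lambda>g. Suc (q' (g - 1))) ` F \<in> ?S (n + m))"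
      unfolding \<phi>_def[symmetric]
    proof (intro exI[of _ "max 1 (max n m)"] conjI ballI impI)
      fix F assume F: "F \<in> ?S (n + m)" "\<forall>i\<in>F. max 1 (max n m) \<le> i"
      show "\<phi> ` F \<in> family_comp (?S m) (?S n)"
        by (rule h[OF F(1) \<phi>s[OF zero[OF F(1)]]]) (use bnd F(2) in blast)
    next
      fix F assume F: "F \<in> family_comp (?S m) (?S n)" "\<forall>i\<in>F. max 1 (max n m) \<le> i"
      show "\<phi> ` F \<in> ?S (n + m)"
        by (rule k[OF F(1) \<phi>s[OF zero'[OF F(1)]]]) (use bnd F(2) in blast)
    qed
  qed
qed

text \<open>A Fekete type argument with l the infimum of the m-th roots of T m. One side is l^n
  \<le> T n \<le> B A n. For the other, T is at least a power of A n along multiples of n and at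
  most a power of T m, up to a fixed factor, along multiples of m; at common arguments this excludes
  A n > l^n.\<close>

lemma submultiplicative_rate:
  fixes T A :: "nat \<Rightarrow> real"
  assumes T1: "\<And>n. 1 \<le> n \<Longrightarrow> 1 \<le> T n" and A0: "\<And>n. 1 \<le> n \<Longrightarrow> 0 < A n"
    and sub: "\<And>n m. 1 \<le> n \<Longrightarrow> 1 \<le> m \<Longrightarrow> T (n + m) \<le> T n * T m"
    and sup: "\<And>n m. 1 \<le> n \<Longrightarrow> 1 \<le> m \<Longrightarrow> A n * T m \<le> T (n + m)"
    and TA: "\<And>n. 1 \<le> n \<Longrightarrow> T n \<le> B * A n" and B: "0 < B" and n0: "1 \<le> n0" "B < T n0"
  obtains l where "1 < l" "\<And>n. 1 \<le> n \<Longrightarrow> A n \<le> l ^ n" "\<And>n. 1 \<le> n \<Longrightarrow> l ^ n \<le> B * A n"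
proof -
  define R where "R m = T m powr (1 / real m)" for m
  define l where "l = (INF m\<in>{1..}. R m)"
  have R0: "0 < R m" if "1 \<le> m" for m using T1[OF that] by (simp add: R_def)
  have Rm: "R m ^ m = T m" if "1 \<le> m" for m
    using T1[OF that] that R0[OF that] by (simp add: R_def powr_realpow[symmetric] powr_powr)
  have bdd: "bdd_below (R ` {1..})" using R0 less_imp_le by (intro bdd_belowI[of _ 0]) auto
  have lR: "l \<le> R m" if "1 \<le> m" for m unfolding l_def by (rule cINF_lower[OF bdd]) (use that in simp)
  have l0: "0 \<le> l" unfolding l_def by (rule cINF_greatest) (use R0 less_imp_le in auto)
  have lT: "l ^ n \<le> T n" if "1 \<le> n" for n
    using power_mono[OF lR[OF that] l0, of n] Rm[OF that] by simp
  have AT: "A n ^ j * T n \<le> T (n * j + n)" if n: "1 \<le> n" for n j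
  proof (induction j)
    case (Suc j)
    have "A n ^ Suc j * T n = A n * (A n ^ j * T n)" by simp
    also have "\<dots> \<le> A n * T (n * j + n)" using Suc A0[OF n] by (intro mult_left_mono) auto
    also have "\<dots> \<le> T (n + (n * j + n))" by (rule sup) (use n in auto)
    finally show ?case by (simp add: add_ac)
  qed simp
  have TT: "T (m * j + n) \<le> T m ^ j * T n" if m: "1 \<le> m" "1 \<le> n" for m n j
  proof (induction j)
    case (Suc j)
    have "T (m * Suc j + n) = T (m + (m * j + n))" by (simp add: add_ac)
    also have "\<dots> \<le> T m * T (m * j + n)" by (rule sub) (use m in auto)
    also have "\<dots> \<le> T m * (T m ^ j * T n)" using Suc T1[OF m(1)] by (intro mult_left_mono) auto
    finally show ?case by (simp add: mult_ac)
  qed simp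
  have Al: "A n \<le> l ^ n" if n: "1 \<le> n" for n
  proof (rule ccontr)
    assume "\<not> ?thesis"
    then have less: "l ^ n < A n" by simp
    define \<rho> where "\<rho> = A n powr (1 / real n)"
    have \<rho>: "0 < \<rho>" "\<rho> ^ n = A n" using A0[OF n] n by (simp_all add: \<rho>_def powr_realpow[symmetric] powr_powr)
    have "l < \<rho>" using less \<rho> by (metis less_imp_le not_less power_mono)
    then have "\<exists>r\<in>R ` {1..}. r < \<rho>" unfolding l_def by (intro cInf_lessD) auto
    then obtain m where m: "1 \<le> m" "R m < \<rho>" by auto
    \<comment> \<open>This exceeds 1 if A n > l^n, but the two chains of inequalities meet at the
      argument m (n j) + n and keep every power of x below T n.\<close>
    define x where "x = A n ^ m / T m ^ n"
    have "T m ^ n = (R m ^ n) ^ m" using Rm[OF m(1)] by (metis mult.commute power_mult)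
    moreover have "R m ^ n < A n" using \<rho>(2) power_strict_mono[OF m(2)] R0[OF m(1)] n by (metis less_imp_le less_le_trans zero_less_one)
    ultimately have "T m ^ n < A n ^ m" using R0[OF m(1)] m(1) by (simp add: power_strict_mono)
    then have x1: "1 < x" using T1[OF m(1)] by (simp add: x_def)
    have xb: "x ^ j \<le> T n" for j
    proof -
      have "A n ^ (m * j) * 1 \<le> A n ^ (m * j) * T n" using T1[OF n] A0[OF n] by (intro mult_left_mono) auto
      also have "\<dots> \<le> T (n * (m * j) + n)" by (rule AT[OF n])
      also have "n * (m * j) + n = m * (n * j) + n" by simp
      also have "T \<dots> \<le> T m ^ (n * j) * T n" by (rule TT[OF m(1) n])
      finally have "(A n ^ m) ^ j \<le> (T m ^ n) ^ j * T n" by (simp add: power_mult)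
      then show ?thesis using T1[OF m(1)] by (simp add: x_def power_divide divide_le_eq mult.commute)
    qed
    obtain j where "T n < x ^ j" using real_arch_pow[OF x1] by blast
    then show False using xb[of j] by simp
  qed
  \<comment> \<open>The threshold B < T n0 gives A n0 > 1, and with it l > 1.\<close>
  have "B * 1 < B * A n0" using TA[OF n0(1)] n0(2) by simp
  then have "1 < A n0" using B by simp
  then have "1 < l ^ n0" using Al[OF n0(1)] by simp
  then have "1 < l" using l0 by (metis not_less power_le_one)
  then show ?thesis using that Al lT TA by (meson order_trans)
qed

section \<open>Admissible sums of restrictions, and their two-sided comparison with the norm\<close>

context schauder_bound
begin

lemma P_P: "P a (P b x) = P (min a b) x"
proof -
  have "P a (P b x) = (\<Sum>i=1..b. c x i *\<^sub>R P a (e i))"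
    unfolding P_def[of b] by (simp add: P_sum P_scale)
  also have "\<dots> = (\<Sum>i=1..b. if i \<le> a then c x i *\<^sub>R e i else 0)"
    by (rule sum.cong) (auto simp: P_e)
  also have "\<dots> = (\<Sum>i\<in>{1..b} \<inter> {..a}. c x i *\<^sub>R e i)"
    by (simp only: sum.inter_restrict finite_atLeastAtMost atMost_iff)
  also have "{1..b} \<inter> {..a} = {1..min a b}" by auto
  finally show ?thesis by (simp add: P_def)
qed

lemma P_window:
  assumes bl: "blocks w e p 1" and s: "1 \<le> s" and x: "x \<in> span (w ` {s..k})"
  shows "k \<le> h \<Longrightarrow> P (p h) x = x" "h < s \<Longrightarrow> P (p h) x = 0"
proof -
  have *: "\<exists>i\<ge>1. s \<le> i \<and> i \<le> k \<and> y = w i" if y: "y \<in> w ` {s..k}" for y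
  proof -
    obtain i where "y = w i" "i \<in> {s..k}" using y by (rule imageE)
    then show ?thesis using s by (intro exI[of _ i]) auto
  qed
  show "P (p h) x = x" if "k \<le> h"
    using x
  proof (induction rule: span_induct_alt)
    case (step r y z)
    then obtain i where "1 \<le> i" "i \<le> k" "y = w i" using * by blast
    then have "P (p h) y = y"
      using that strict_mono_less_eq[OF blocksD(1)[OF bl]] by (auto intro!: P_block(1)[OF bl])
    then show ?case using step by (simp add: P_add P_scale)
  qed (rule P_zero)
  show "P (p h) x = 0" if "h < s"
    using x
  proof (induction rule: span_induct_alt)
    case (step r y z)
    then obtain i where i: "1 \<le> i" "s \<le> i" "y = w i" using * by blast
    then have "p h \<le> p (i - 1)" using that strict_mono_less_eq[OF blocksD(1)[OF bl]] by simp
    then have "P (p h) y = 0" using P_block(2)[OF bl i(1)] i(3) by simp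
    then show ?case using step by (simp add: P_add P_scale)
  qed (rule P_zero)
qed

text \<open>A vector supported between s and k does not see the part of an interval outside this
  window. This is the identity that \<open>interval_system_cut\<close> asks of f.\<close>

lemma Q_window:
  assumes bl: "blocks w e p 1" and s: "1 \<le> s" and x: "x \<in> span (w ` {s..k})" and gh: "1 \<le> g" "g \<le> h"
  shows "Q p g h x = (if max g s \<le> min h k then Q p (max g s) (min h k) x else 0)"
proof -
  note W = P_window[OF bl s x]
  have 1: "P (p h) x = P (p (min h k)) x" using W(1)[of h] W(1)[of k] by (cases "h \<le> k") (auto simp: min_def)
  have 2: "P (p (g - 1)) x = P (p (max g s - 1)) x"
    using W(2)[of "g - 1"] W(2)[of "s - 1"] s gh by (cases "g \<le> s") (auto simp: max_def)
  show ?thesis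
  proof (cases "max g s \<le> min h k")
    case True
    then show ?thesis using 1 2 by (simp add: Q_def)
  next
    case False
    then consider "h < s" | "k < g" | "k < s" using gh by linarith
    then show ?thesis
    proof cases
      case 1
      then show ?thesis using W(2)[of h] W(2)[of "g - 1"] gh False by (simp add: Q_def)
    next
      case 2
      then show ?thesis using W(1)[of h] W(1)[of "g - 1"] gh False by (simp add: Q_def)
    next
      case 3
      then have "x = 0" using x by simp
      then show ?thesis using False by (simp add: Q_def P_zero)
    qed
  qed
qed

lemma span_tail_window:
  fixes w :: "nat \<Rightarrow> 'a"
  assumes "x \<in> span (w ` {N..})"
  obtains k where "x \<in> span (w ` {N..k})"
proof -
  obtain a m where a: "\<And>i. i < N \<Longrightarrow> a i = 0" "\<And>i. m < i \<Longrightarrow> a i = 0" "x = (\<Sum>i\<le>m. a i *\<^sub>R w i)"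
    using span_tail_sum[OF assms] by blast
  have "x \<in> span (w ` {N..m})"
    unfolding a(3)
  proof (rule span_sum)
    fix i assume "i \<in> {..m}"
    then show "a i *\<^sub>R w i \<in> span (w ` {N..m})"
      using a(1)[of i] by (cases "i < N") (simp_all add: span_zero span_scale span_base)
  qed
  then show ?thesis by (rule that)
qed

text \<open>An upper estimate covers intervals starting at or after N. Cutting the system to the
  support of x moves earlier left endpoints up to N without changing the sum.\<close>

lemma upper_est_Q_all:
  assumes bl: "blocks w e p 1" and u: "upper_est \<F> w N t" and N: "1 \<le> N" and reg: "regular \<F>"
    and x: "x \<in> span (w ` {N..})" and isys: "interval_system \<F> G r"
  shows "(\<Sum>g\<in>G. norm (Q p g (r g) x)) \<le> t * norm x"
proof -
  obtain k where k: "x \<in> span (w ` {N..k})" by (rule span_tail_window[OF x])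
  from interval_system_cut[OF isys reg, of N k]
  obtain G' r' where G': "interval_system \<F> G' r'" "\<forall>g\<in>G'. N \<le> g \<and> r' g \<le> k"
    "\<forall>f :: nat \<Rightarrow> nat \<Rightarrow> real. (\<forall>g h. 1 \<le> g \<longrightarrow> g \<le> h \<longrightarrow>
        f g h = (if max g N \<le> min h k then f (max g N) (min h k) else 0)) \<longrightarrow>
        (\<Sum>g\<in>G. f g (r g)) = (\<Sum>g\<in>G'. f g (r' g))" by (elim exE conjE)
  have "(\<Sum>g\<in>G. norm (Q p g (r g) x)) = (\<Sum>g\<in>G'. norm (Q p g (r' g) x))"
  proof (rule mp[OF spec[OF G'(3), of "\<lambda>g h. norm (Q p g h x)"]], intro allI impI)
    fix g h :: nat assume "1 \<le> g" "g \<le> h"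
    from Q_window[OF bl N k this]
    show "norm (Q p g h x) = (if max g N \<le> min h k then norm (Q p (max g N) (min h k) x) else 0)" by simp
  qed
  also have "\<dots> \<le> t * norm x"
    by (rule upper_est_Q[OF bl u N x G'(1)]) (use G'(2) in blast)
  finally show ?thesis .
qed

text \<open>The supremum of the admissible sums lies between A norm x and 2 D A norm x, expressed
  without forming it: every factor A' below A is reached by some system. The restrictions belong to
  the block sequence with ends p, even if V is spanned by further blocks of it.\<close>

definition sums_comparable :: "(nat \<Rightarrow> nat) \<Rightarrow> nat set set \<Rightarrow> 'a set \<Rightarrow> real \<Rightarrow> real \<Rightarrow> bool" where
  "sums_comparable p \<F> V D A \<longleftrightarrow>
    (\<forall>x\<in>V. \<forall>G r. interval_system \<F> G r \<longrightarrow> (\<Sum>g\<in>G. norm (Q p g (r g) x)) \<le> 2 * D * A * norm x) \<and>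
    (\<forall>x\<in>V. \<forall>A'<A. \<exists>G r. interval_system \<F> G r \<and> A' * norm x \<le> (\<Sum>g\<in>G. norm (Q p g (r g) x)))"

lemma sums_comparableD:
  assumes "sums_comparable p \<F> V D A" "x \<in> V"
  shows "interval_system \<F> G r \<Longrightarrow> (\<Sum>g\<in>G. norm (Q p g (r g) x)) \<le> 2 * D * A * norm x"
    and "A' < A \<Longrightarrow> \<exists>G r. interval_system \<F> G r \<and> A' * norm x \<le> (\<Sum>g\<in>G. norm (Q p g (r g) x))"
  using assms unfolding sums_comparable_def by blast+

lemma sums_comparable_subset: "sums_comparable p \<F> V D A \<Longrightarrow> W \<subseteq> V \<Longrightarrow> sums_comparable p \<F> W D A"
  unfolding sums_comparable_def by blast

text \<open>The supremum f of the admissible sums along w is an equivalent norm on the span of a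
  tail of y: a single interval covering the support gives norm x \<le> f x, the upper estimate gives
  f x \<le> t norm x. Bounded distortion makes it proportional to the norm up to 2 D.\<close>

lemma distorted_block:
  assumes bd: "bounded_distortion (UNIV :: 'a set) D"
    and bl: "blocks w e p 1" and reg: "regular \<F>" and u: "upper_est \<F> w N t" and y: "sub_block y w"
  obtains v M A where "sub_block v y" "0 < A" "sums_comparable p \<F> (span (v ` {M..})) D A"
proof -
  obtain py Ny where bly: "blocks y w py Ny" using y by (auto simp: sub_block_def)
  have blye: "blocks y e (p \<circ> py) (max Ny 1)" by (rule blocks_trans[OF bly bl])
  define N' where "N' = max N 1"
  have uN: "upper_est \<F> w N' t" "1 \<le> N'" using upper_est_mono[OF u] by (auto simp: N'_def)
  define M where "M = max (max Ny 1) N'"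
  let ?V = "span (y ` {M..})"
  have Vw: "?V \<subseteq> span (w ` {N'..})"
  proof (rule span_minimal)
    show "y ` {M..} \<subseteq> span (w ` {N'..})"
    proof (rule image_subsetI)
      fix i assume "i \<in> {M..}"
      then have i: "Ny \<le> i" "1 \<le> i" "N' \<le> i" by (auto simp: M_def)
      have "i - 1 \<le> py (i - 1)" by (rule strict_mono_ge[OF blocksD(1)[OF bly]])
      then have "{py (i - 1)<..py i} \<subseteq> {N'..}" using i by auto
      then have "span (w ` {py (i - 1)<..py i}) \<subseteq> span (w ` {N'..})" by (intro span_mono image_mono)
      then show "y i \<in> span (w ` {N'..})" using blocksD(4)[OF bly i(1)] by blast
    qed
  qed simp
  define I where "I = {(G, r). interval_system \<F> G r}"
  define \<sigma> where "\<sigma> x s = (\<Sum>g\<in>fst s. norm (Q p g (snd s g) x))" for x s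
  define f where "f x = (SUP s\<in>I. \<sigma> x s)" for x
  have I0: "({}, \<lambda>_. 0) \<in> I" using regularD(6)[OF reg] by (simp add: I_def interval_system_def)
  have \<sigma>t: "\<sigma> x s \<le> t * norm x" if "x \<in> ?V" "s \<in> I" for x s
    using upper_est_Q_all[OF bl uN reg subsetD[OF Vw that(1)], of "fst s" "snd s"] that(2)
    by (auto simp: \<sigma>_def I_def)
  have bdd: "bdd_above (\<sigma> x ` I)" if "x \<in> ?V" for x
    by (rule bdd_aboveI[of _ "t * norm x"]) (use \<sigma>t[OF that] in blast)
  have f_ge: "\<sigma> x s \<le> f x" if "x \<in> ?V" "s \<in> I" for x s
    unfolding f_def by (rule cSUP_upper[OF that(2) bdd[OF that(1)]])
  have f_le: "f x \<le> r" if "\<And>s. s \<in> I \<Longrightarrow> \<sigma> x s \<le> r" for x r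
    unfolding f_def by (rule cSUP_least) (use I0 that in auto)
  have tri: "f (x + z) \<le> f x + f z" if xz: "x \<in> ?V" "z \<in> ?V" for x z
  proof (rule f_le)
    fix s assume s: "s \<in> I"
    have "\<sigma> (x + z) s \<le> \<sigma> x s + \<sigma> z s"
      unfolding \<sigma>_def sum.distrib[symmetric] Q_add by (rule sum_mono) (rule norm_triangle_ineq)
    then show "\<sigma> (x + z) s \<le> f x + f z" using f_ge[OF xz(1) s] f_ge[OF xz(2) s] by simp
  qed
  have \<sigma>_scale: "\<sigma> (r *\<^sub>R x) s = \<bar>r\<bar> * \<sigma> x s" for r x s
    by (simp add: \<sigma>_def Q_scale sum_distrib_left)
  have hom_le: "f (r *\<^sub>R x) \<le> \<bar>r\<bar> * f x" if x: "x \<in> ?V" for r x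
    by (rule f_le) (simp add: \<sigma>_scale mult_left_mono f_ge[OF x])
  have hom: "f (r *\<^sub>R x) = \<bar>r\<bar> * f x" if x: "x \<in> ?V" for r x
  proof (cases "r = 0")
    case True
    have \<sigma>0: "\<sigma> 0 s = 0" for s using \<sigma>_scale[of 0 0 s] by simp
    have "f 0 \<le> 0" by (rule f_le) (simp add: \<sigma>0)
    moreover have "0 \<le> f 0" using f_ge[OF span_zero I0] by (simp add: \<sigma>0)
    ultimately have "f 0 = 0" by simp
    then show ?thesis using True by simp
  next
    case False
    have "f x \<le> \<bar>inverse r\<bar> * f (r *\<^sub>R x)" using hom_le[OF span_scale[OF x], of "inverse r" r] False by simp
    then show ?thesis using hom_le[OF x, of r] False by (simp add: field_simps)
  qed
  have low: "1 * norm x \<le> f x" if x: "x \<in> ?V" for x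
  proof -
    obtain k where "x \<in> span (w ` {N'..k})" by (rule span_tail_window[OF subsetD[OF Vw x]])
    then have k: "x \<in> span (w ` {1..max 1 k})"
      using span_mono[of "w ` {N'..k}" "w ` {1..max 1 k}"] uN(2) by (auto simp: image_mono)
    have s: "({1}, \<lambda>_. max 1 k) \<in> I" using regularD(5)[OF reg, of 1] by (simp add: I_def interval_system_def)
    have "Q p 1 (max 1 k) x = x"
      using P_window[OF bl _ k, of "max 1 k"] P_window(2)[OF bl _ k, of 0] by (simp add: Q_def)
    then have "\<sigma> x ({1}, \<lambda>_. max 1 k) = norm x" by (simp add: \<sigma>_def)
    then show ?thesis using f_ge[OF x s] by simp
  qed
  have up: "f x \<le> t * norm x" if x: "x \<in> ?V" for x by (rule f_le) (rule \<sigma>t[OF x])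
  have M: "max Ny 1 \<le> M" by (simp add: M_def)
  obtain v M' A where v: "sub_block v y" "0 < A" "span (v ` {M'..}) \<subseteq> ?V"
    "\<And>x. x \<in> span (v ` {M'..}) \<Longrightarrow> A * norm x \<le> f x \<and> f x \<le> 2 * D * A * norm x"
    by (rule distortion_block[OF bd blye M, of f 1 t]) (use tri hom low up in \<open>assumption | simp\<close>)+
  show ?thesis
  proof (rule that[OF v(1,2)], unfold sums_comparable_def, intro conjI ballI allI impI)
    fix x G r assume x: "x \<in> span (v ` {M'..})" and "interval_system \<F> G r"
    then have s: "(G, r) \<in> I" by (simp add: I_def)
    show "(\<Sum>g\<in>G. norm (Q p g (r g) x)) \<le> 2 * D * A * norm x"
      using f_ge[OF subsetD[OF v(3) x] s] v(4)[OF x] by (simp add: \<sigma>_def)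
  next
    fix x A' assume x: "x \<in> span (v ` {M'..})" and A': "A' < A"
    show "\<exists>G r. interval_system \<F> G r \<and> A' * norm x \<le> (\<Sum>g\<in>G. norm (Q p g (r g) x))"
    proof (cases "x = 0")
      case True
      have "interval_system \<F> {} (\<lambda>_. 0)" using I0 by (simp add: I_def)
      then show ?thesis using True by (intro exI[of _ "{}"] exI[of _ "\<lambda>_. 0"]) simp
    next
      case False
      then have "A' * norm x < f x" using A' v(4)[OF x] by (meson less_le_trans mult_strict_right_mono zero_less_norm_iff)
      then have "\<exists>s\<in>I. A' * norm x < \<sigma> x s"
        unfolding f_def using less_cSUP_iff[of I "\<sigma> x" "A' * norm x"] I0 bdd[OF subsetD[OF v(3) x]] by blast
      then show ?thesis by (auto simp: I_def \<sigma>_def intro: less_imp_le)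
    qed
  qed
qed

text \<open>Intervals of blocks of v are intervals along w with left endpoints spread to the right.
  Applied to the upper half of \<open>sums_comparable\<close>, this gives T n \<le> 2 D A n.\<close>

lemma upper_est_from_Q:
  assumes bl: "blocks w e p 1" and reg: "regular \<F>" and blv: "blocks v w pv Nv"
    and Q: "\<And>x G r. x \<in> span (v ` {M..}) \<Longrightarrow> interval_system \<F> G r \<Longrightarrow> (\<Sum>g\<in>G. norm (Q p g (r g) x)) \<le> t * norm x"
  shows "upper_est \<F> v (max M (max Nv 1)) t"
  unfolding upper_est_def
proof (intro allI impI)
  fix a :: "nat \<Rightarrow> real" and m G r
  let ?N = "max M (max Nv 1)" and ?x = "\<Sum>i\<le>m. a i *\<^sub>R v i"
  assume *: "\<forall>i. i < ?N \<or> m < i \<longrightarrow> a i = 0" "interval_system \<F> G r" "\<forall>g\<in>G. ?N \<le> g"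
  have blve: "blocks v e (p \<circ> pv) (max Nv 1)" by (rule blocks_trans[OF blv bl])
  note sm = blocksD(1)[OF blv]
  have g1: "1 \<le> g" if "g \<in> G" for g using *(3) that by auto
  have x: "?x \<in> span (v ` {M..})" by (rule sum_in_span_tail) (use *(1) in auto)
  have Qg: "(\<Sum>i=g..r g. a i *\<^sub>R v i) = Q p (Suc (pv (g - 1))) (pv (r g)) ?x" if g: "g \<in> G" for g
  proof -
    have "Q (p \<circ> pv) g (r g) ?x = (\<Sum>i=g..r g. a i *\<^sub>R v i)"
      by (rule Q_block_sum[OF blve]) (use *(1) g1[OF g] interval_systemD(2)[OF *(2) g] in auto)
    then show ?thesis by (simp add: Q_def)
  qed
  have FG: "(\<lambda>g. Suc (pv (g - 1))) ` G \<in> \<F>"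
    by (rule regular_spread_blocks[OF reg sm interval_systemD(1)[OF *(2)]])
  from interval_system_blocks[OF *(2) sm g1 FG]
  obtain R where "interval_system \<F> ((\<lambda>g. Suc (pv (g - 1))) ` G) R \<and> (\<forall>f :: nat \<Rightarrow> nat \<Rightarrow> real.
    (\<Sum>k\<in>(\<lambda>g. Suc (pv (g - 1))) ` G. f k (R k)) = (\<Sum>g\<in>G. f (Suc (pv (g - 1))) (pv (r g))))" ..
  note R = conjunct1[OF this] spec[OF conjunct2[OF this]]
  have "(\<Sum>g\<in>G. norm (\<Sum>i=g..r g. a i *\<^sub>R v i)) = (\<Sum>k\<in>(\<lambda>g. Suc (pv (g - 1))) ` G. norm (Q p k (R k) ?x))"
    using Qg R(2)[of "\<lambda>k l. norm (Q p k l ?x)"] by simp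
  also have "\<dots> \<le> t * norm ?x" by (rule Q[OF x R(1)])
  finally show "(\<Sum>g\<in>G. norm (\<Sum>i=g..r g. a i *\<^sub>R v i)) \<le> t * norm ?x" .
qed

text \<open>On each outer piece y g some \<G>-system has sum at least A' norm (y g). Cut to the
  windows of the pieces, these systems unite to one of the composed family, whose sum is at most t
  times the norm. This is the source of A n T m \<le> T (n + m).\<close>

lemma upper_est_from_lower:
  assumes bl: "blocks w e p 1" and reg: "regular \<F>" "regular \<G>" and blv: "blocks v w pv Nv"
    and u: "upper_est (family_comp \<F> \<G>) w N t" and A': "0 < A'"
    and low: "\<And>x. x \<in> span (v ` {M..}) \<Longrightarrow>
      \<exists>G r. interval_system \<G> G r \<and> A' * norm x \<le> (\<Sum>g\<in>G. norm (Q p g (r g) x))"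
  shows "\<exists>M'. upper_est \<F> v M' (t / A')"
proof -
  let ?N = "max (max M N) (max Nv 1)"
  have blve: "blocks v e (p \<circ> pv) (max Nv 1)" by (rule blocks_trans[OF blv bl])
  note sm = blocksD(1)[OF blv] and smp = blocksD(1)[OF bl]
  have "upper_est \<F> v ?N (t / A')"
    unfolding upper_est_def
  proof (intro allI impI)
    fix a :: "nat \<Rightarrow> real" and m G r
    let ?x = "\<Sum>i\<le>m. a i *\<^sub>R v i"
    assume *: "\<forall>i. i < ?N \<or> m < i \<longrightarrow> a i = 0" "interval_system \<F> G r" "\<forall>g\<in>G. ?N \<le> g"
    define lo where "lo g = Suc (pv (g - 1))" for g
    define hi where "hi g = pv (r g)" for g
    define y where "y g = (\<Sum>i=g..r g. a i *\<^sub>R v i)" for g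
    have g1: "1 \<le> g" if "g \<in> G" for g using *(3) that by auto
    have lo: "g \<le> lo g" "1 \<le> lo g" for g using strict_mono_ge[OF sm, of "g - 1"] by (simp_all add: lo_def)
    have hilo: "hi g < lo h" if "g \<in> G" "h \<in> G" "g < h" for g h
    proof -
      have "r g \<le> h - 1" using interval_systemD(3)[OF *(2) that] by simp
      then show ?thesis using strict_mono_less_eq[OF sm] by (simp add: lo_def hi_def less_Suc_eq_le)
    qed
    have Qy: "y g = P (p (hi g)) ?x - P (p (lo g - 1)) ?x" if g: "g \<in> G" for g
    proof -
      have "Q (p \<circ> pv) g (r g) ?x = y g"
        unfolding y_def by (rule Q_block_sum[OF blve]) (use *(1) g1[OF g] interval_systemD(2)[OF *(2) g] in auto)
      then show ?thesis by (simp add: Q_def lo_def hi_def)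
    qed
    have yv: "y g \<in> span (v ` {M..})" for g unfolding y_def by (rule sum_in_span_tail) (use *(1) in auto)
    have yw: "y g \<in> span (w ` {lo g..hi g})" if g: "g \<in> G" for g
      unfolding y_def
    proof (intro span_sum span_scale)
      fix i assume i: "i \<in> {g..r g}"
      have "Nv \<le> i" using i *(3) g by auto
      then have "v i \<in> span (w ` {pv (i - 1)<..pv i})" by (rule blocksD(4)[OF blv])
      moreover have "pv (g - 1) \<le> pv (i - 1)" "pv i \<le> pv (r g)" using i strict_mono_less_eq[OF sm] by auto
      then have "{pv (i - 1)<..pv i} \<subseteq> {lo g..hi g}" by (auto simp: lo_def hi_def)
      then have "span (w ` {pv (i - 1)<..pv i}) \<subseteq> span (w ` {lo g..hi g})" by (intro span_mono image_mono)
      ultimately show "v i \<in> span (w ` {lo g..hi g})" by blast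
    qed
    have "\<exists>z. interval_system \<G> (fst z) (snd z) \<and> (\<forall>h\<in>fst z. lo g \<le> h \<and> snd z h \<le> hi g) \<and>
        A' * norm (y g) \<le> (\<Sum>h\<in>fst z. norm (Q p h (snd z h) ?x))" if g: "g \<in> G" for g
    proof -
      obtain G1 r1 where G1: "interval_system \<G> G1 r1" "A' * norm (y g) \<le> (\<Sum>h\<in>G1. norm (Q p h (r1 h) (y g)))"
        using low[OF yv] by blast
      from interval_system_cut[OF G1(1) reg(2), of "lo g" "hi g"]
      obtain H s where H: "interval_system \<G> H s" "\<forall>h\<in>H. lo g \<le> h \<and> s h \<le> hi g"
        "\<forall>f :: nat \<Rightarrow> nat \<Rightarrow> real. (\<forall>k h. 1 \<le> k \<longrightarrow> k \<le> h \<longrightarrow>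
          f k h = (if max k (lo g) \<le> min h (hi g) then f (max k (lo g)) (min h (hi g)) else 0)) \<longrightarrow>
          (\<Sum>h\<in>G1. f h (r1 h)) = (\<Sum>h\<in>H. f h (s h))" by (elim exE conjE)
      have "(\<Sum>h\<in>G1. norm (Q p h (r1 h) (y g))) = (\<Sum>h\<in>H. norm (Q p h (s h) (y g)))"
      proof (rule mp[OF spec[OF H(3), of "\<lambda>k h. norm (Q p k h (y g))"]], intro allI impI)
        fix k h :: nat assume "1 \<le> k" "k \<le> h"
        from Q_window[OF bl lo(2) yw[OF g] this]
        show "norm (Q p k h (y g)) =
          (if max k (lo g) \<le> min h (hi g) then norm (Q p (max k (lo g)) (min h (hi g)) (y g)) else 0)" by simp
      qed
      \<comment> \<open>Inside its window the piece y g has the same restrictions as the whole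
        vector, because products of basis projections collapse.\<close>
      also have "\<dots> = (\<Sum>h\<in>H. norm (Q p h (s h) ?x))"
      proof (intro sum.cong refl arg_cong[where f = norm])
        fix h assume h: "h \<in> H"
        have "lo g \<le> h" "h \<le> s h" "s h \<le> hi g" using H(2) h interval_systemD(2)[OF H(1) h] by auto
        then have "lo g - 1 \<le> h - 1" "h - 1 \<le> hi g" "lo g - 1 \<le> s h" "s h \<le> hi g" by auto
        then have "p (lo g - 1) \<le> p (h - 1)" "p (h - 1) \<le> p (hi g)" "p (lo g - 1) \<le> p (s h)" "p (s h) \<le> p (hi g)"
          using strict_mono_less_eq[OF smp] by auto
        then show "Q p h (s h) (y g) = Q p h (s h) ?x"
          unfolding Qy[OF g] by (simp add: Q_def P_diff P_P min_absorb1 min_absorb2)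
      qed
      finally have "A' * norm (y g) \<le> (\<Sum>h\<in>H. norm (Q p h (s h) ?x))" using G1(2) by simp
      then show ?thesis using H(1,2) by (intro exI[of _ "(H, s)"]) simp
    qed
    then have "\<forall>g\<in>G. \<exists>z. interval_system \<G> (fst z) (snd z) \<and> (\<forall>h\<in>fst z. lo g \<le> h \<and> snd z h \<le> hi g) \<and>
        A' * norm (y g) \<le> (\<Sum>h\<in>fst z. norm (Q p h (snd z h) ?x))" by blast
    from bchoice[OF this] obtain Z where Z: "\<forall>g\<in>G. interval_system \<G> (fst (Z g)) (snd (Z g)) \<and>
        (\<forall>h\<in>fst (Z g). lo g \<le> h \<and> snd (Z g) h \<le> hi g) \<and>
        A' * norm (y g) \<le> (\<Sum>h\<in>fst (Z g). norm (Q p h (snd (Z g) h) ?x))" ..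
    define H where "H g = fst (Z g)" for g
    define s where "s g = snd (Z g)" for g
    have H: "\<And>g. g \<in> G \<Longrightarrow> interval_system \<G> (H g) (s g)"
      "\<And>g h. g \<in> G \<Longrightarrow> h \<in> H g \<Longrightarrow> lo g \<le> h" "\<And>g h. g \<in> G \<Longrightarrow> h \<in> H g \<Longrightarrow> s g h \<le> hi g"
      "\<And>g. g \<in> G \<Longrightarrow> A' * norm (y g) \<le> (\<Sum>h\<in>H g. norm (Q p h (s g h) ?x))"
      using Z by (simp_all add: H_def s_def)
    have "\<exists>S. interval_system (family_comp \<F> \<G>) (\<Union> (H ` G)) S \<and> (\<forall>f :: nat \<Rightarrow> nat \<Rightarrow> real.
      (\<Sum>h\<in>\<Union> (H ` G). f h (S h)) = (\<Sum>g\<in>G. \<Sum>h\<in>H g. f h (s g h)))"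
    proof (rule interval_system_union[OF reg interval_systemD(1)[OF *(2)]])
      show "g \<le> lo g" for g by (rule lo(1))
    qed (fact hilo H(1) H(2) H(3))+
    then obtain S where "interval_system (family_comp \<F> \<G>) (\<Union> (H ` G)) S \<and> (\<forall>f :: nat \<Rightarrow> nat \<Rightarrow> real.
      (\<Sum>h\<in>\<Union> (H ` G). f h (S h)) = (\<Sum>g\<in>G. \<Sum>h\<in>H g. f h (s g h)))" ..
    note S = conjunct1[OF this] spec[OF conjunct2[OF this]]
    have xw: "?x \<in> span (w ` {?N..})"
    proof (intro span_sum)
      fix i
      show "a i *\<^sub>R v i \<in> span (w ` {?N..})"
      proof (cases "i < ?N")
        case True
        then show ?thesis using *(1) by (simp add: span_zero)
      next
        case False
        then have i: "Nv \<le> i" "1 \<le> i" "?N \<le> i" by auto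
        have "i - 1 \<le> pv (i - 1)" by (rule strict_mono_ge[OF sm])
        then have "{pv (i - 1)<..pv i} \<subseteq> {?N..}" using i by auto
        then have "span (w ` {pv (i - 1)<..pv i}) \<subseteq> span (w ` {?N..})" by (intro span_mono image_mono)
        then show ?thesis using blocksD(4)[OF blv i(1)] by (intro span_scale) blast
      qed
    qed
    have "A' * (\<Sum>g\<in>G. norm (y g)) \<le> (\<Sum>g\<in>G. \<Sum>h\<in>H g. norm (Q p h (s g h) ?x))"
      unfolding sum_distrib_left by (rule sum_mono) (rule H(4))
    also have "\<dots> = (\<Sum>h\<in>\<Union> (H ` G). norm (Q p h (S h) ?x))"
      using S(2)[of "\<lambda>k l. norm (Q p k l ?x)"] by simp
    also have "\<dots> \<le> t * norm ?x"
    proof (rule upper_est_Q[OF bl upper_est_mono[OF u _ order_refl] _ xw S(1)])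
      show "?N \<le> h" if "h \<in> \<Union> (H ` G)" for h
      proof -
        from that obtain g where g: "g \<in> G" "h \<in> H g" by blast
        have "?N \<le> g" using *(3) g(1) by blast
        then show ?thesis using lo(1)[of g] H(2)[OF g] by linarith
      qed
    qed auto
    finally show "(\<Sum>g\<in>G. norm (\<Sum>i=g..r g. a i *\<^sub>R v i)) \<le> t / A' * norm ?x"
      using A' by (simp add: y_def field_simps)
  qed
  then show ?thesis ..
qed

end

section \<open>Admissible lists as interval systems, and constants of sums of ordinals\<close>

lemma successive_interval_system:
  assumes "admissible L b Es"
  obtains r where "interval_system (schreier L b) (Min ` set Es) r" "\<forall>g\<in>Min ` set Es. 1 \<le> g"
    "\<forall>f :: nat set \<Rightarrow> real. (\<Sum>E\<leftarrow>Es. f E) = (\<Sum>g\<in>Min ` set Es. f {g..r g})"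
proof -
  have s: "successive Es" and F: "Min ` set Es \<in> schreier L b"
    and iv: "\<And>E. E \<in> set Es \<Longrightarrow> \<exists>m n. 1 \<le> m \<and> m \<le> n \<and> E = {m..n}"
    using assms by (auto simp: admissible_def)
  note inj = successive_inj_Min[OF s]
  define A where "A = inv_into (set Es) Min"
  define r where "r g = Max (A g)" for g
  have A: "A (Min E) = E" if "E \<in> set Es" for E using inj that by (simp add: A_def)
  have E: "E = {Min E..Max E}" "1 \<le> Min E" "Min E \<le> Max E" if EEs: "E \<in> set Es" for E
  proof -
    obtain m n where mn: "1 \<le> m" "m \<le> n" "E = {m..n}" using iv[OF EEs] by blast
    have "Min E = m" "Max E = n" using mn by (auto intro!: Min_eqI Max_eqI)
    then show "E = {Min E..Max E}" "1 \<le> Min E" "Min E \<le> Max E" using mn by simp_all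
  qed
  show ?thesis
  proof (rule that)
    show "interval_system (schreier L b) (Min ` set Es) r"
      unfolding interval_system_def
      using F A E(3) successive_Min_mono[OF s] by (auto simp: r_def)
    show "\<forall>g\<in>Min ` set Es. 1 \<le> g" using E(2) by blast
    show "\<forall>f :: nat set \<Rightarrow> real. (\<Sum>E\<leftarrow>Es. f E) = (\<Sum>g\<in>Min ` set Es. f {g..r g})"
    proof
      fix f :: "nat set \<Rightarrow> real"
      have "(\<Sum>E\<leftarrow>Es. f E) = (\<Sum>E\<in>set Es. f E)"
        by (rule sum_list_distinct_conv_sum_set[OF successive_distinct[OF s]])
      also have "\<dots> = (\<Sum>E\<in>set Es. f {Min E..r (Min E)})"
        by (rule sum.cong[OF refl]) (metis A E(1) r_def)
      finally show "(\<Sum>E\<leftarrow>Es. f E) = (\<Sum>g\<in>Min ` set Es. f {g..r g})"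
        by (simp add: sum.reindex[OF inj])
    qed
  qed
qed

lemma interval_system_admissible:
  assumes L: "ladder_system L" and isys: "interval_system (schreier L b) G r"
  shows "\<exists>Es. admissible L b Es \<and> (\<forall>f :: nat set \<Rightarrow> real. (\<Sum>E\<leftarrow>Es. f E) = (\<Sum>g\<in>G. f {g..r g}))"
proof -
  let ?l = "sorted_list_of_set G" and ?A = "\<lambda>g. {g..r g}"
  have fin: "finite G" "0 \<notin> G"
    using regularD(3,4)[OF regular_schreier[OF L] interval_systemD(1)[OF isys]] by auto
  have mb: "min_blocks G ?A"
    unfolding min_blocks_def using interval_systemD(2,3)[OF isys] by (auto intro: le_less_trans)
  have Min: "Min ` ?A ` G = G" using min_blocksD(4)[OF mb] by (force simp: image_iff)
  have "admissible L b (map ?A ?l)"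
    unfolding admissible_def
  proof (intro conjI)
    show "successive (map ?A ?l)" by (rule successive_map_min_blocks[OF mb fin(1)])
    show "\<forall>E\<in>set (map ?A ?l). \<exists>m n. 1 \<le> m \<and> m \<le> n \<and> E = {m..n}"
    proof
      fix E assume "E \<in> set (map ?A ?l)"
      then obtain g where g: "g \<in> G" "E = {g..r g}" using fin by auto
      then have "1 \<le> g" using fin(2) by (metis One_nat_def Suc_leI gr0I)
      then show "\<exists>m n. 1 \<le> m \<and> m \<le> n \<and> E = {m..n}" using g interval_systemD(2)[OF isys] by blast
    qed
    show "Min ` set (map ?A ?l) \<in> schreier L b" using Min fin interval_systemD(1)[OF isys] by simp
  qed
  moreover have "(\<Sum>E\<leftarrow>map ?A ?l. f E) = (\<Sum>g\<in>G. f {g..r g})" for f :: "nat set \<Rightarrow> real"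
    using fin by (simp add: o_def sum_list_distinct_conv_sum_set)
  ultimately show ?thesis by blast
qed

text \<open>Skipping the terms before q 1 turns a sequence that consists of blocks only from N on
  into one that does so from index 1, as a block basis must.\<close>

lemma blocks_subseq_tail:
  assumes bl: "blocks u e p N" and q: "strict_mono q" and N: "N \<le> q 1"
  shows "blocks (u \<circ> q) e (p \<circ> q) 1"
  unfolding blocks_def
proof (intro conjI allI impI)
  show "strict_mono (p \<circ> q)" using blocksD(1)[OF bl] q by (simp add: strict_mono_o)
  fix i :: nat assume i: "1 \<le> i"
  have Ni: "N \<le> q i" using N i strict_mono_less_eq[OF q, of 1 i] by simp
  show "(u \<circ> q) i \<noteq> 0" using blocksD(3)[OF bl Ni] by simp
  have "q (i - 1) < q i" using i strict_mono_less[OF q] by simp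
  then have "p (q (i - 1)) \<le> p (q i - 1)" using strict_mono_less_eq[OF blocksD(1)[OF bl]] by simp
  then have "span (e ` {p (q i - 1)<..p (q i)}) \<subseteq> span (e ` {(p \<circ> q) (i - 1)<..(p \<circ> q) i})"
    by (intro span_mono image_mono) auto
  then show "(u \<circ> q) i \<in> span (e ` {(p \<circ> q) (i - 1)<..(p \<circ> q) i})"
    using blocksD(4)[OF bl Ni] by auto
qed simp

lemma block_basis_of_iff: "block_basis_of y x \<longleftrightarrow> (\<exists>p. blocks y x p 1)"
  by (simp add: block_basis_of_def blocks_def)

lemma upper_est_schreier_mono:
  assumes L: "ladder_system L" and ab: "a \<le> b" and u: "upper_est (schreier L b) w N t"
  shows "\<exists>M. upper_est (schreier L a) w M t"
proof -
  from schreier_eventually_mono[OF L ab]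
  obtain m where m: "\<forall>F\<in>schreier L a. (\<forall>i\<in>F. m \<le> i) \<longrightarrow> F \<in> schreier L b" ..
  show ?thesis by (rule upper_est_eventually_subset[OF u]) (use m in blast)
qed

text \<open>Along the subsequence u \<circ> q, members of the family of the ordinal sum become
  members of the composed family for u, where constants multiply. The constants are infima that need
  not be attained, hence the \<delta> added to each.\<close>

lemma est_const_add_le:
  assumes L: "ladder_system L" and u: "sub_block u x" and q: "strict_mono q"
    and fin: "finite_est (schreier L (a * ord_of_nat n)) u" "finite_est (schreier L (a * ord_of_nat m)) u"
    and N0: "\<forall>F\<in>schreier L (a * ord_of_nat (n + m)). (\<forall>i\<in>F. N0 \<le> i) \<longrightarrow>
        (\<lambda>g. Suc (q (g - 1))) ` F \<in> family_comp (schreier L (a * ord_of_nat m)) (schreier L (a * ord_of_nat n))"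
  shows "finite_est (schreier L (a * ord_of_nat (n + m))) (u \<circ> q)"
    and "est_const (schreier L (a * ord_of_nat (n + m))) (u \<circ> q) \<le>
      est_const (schreier L (a * ord_of_nat n)) u * est_const (schreier L (a * ord_of_nat m)) u"
proof -
  let ?S = "\<lambda>n. schreier L (a * ord_of_nat n)"
  note reg = regular_schreier[OF L]
  have sq: "sub_block (u \<circ> q) u" by (rule sub_block_subseq[OF u q])
  obtain p M where blu: "blocks u x p M" using u by (auto simp: sub_block_def)
  have blq: "blocks (u \<circ> q) u q M"
    using blocksD(2,3)[OF blu] strict_mono_ge[OF q] by (intro blocks_subseq[OF q]) (auto intro: order_trans)
  have main: "\<exists>N. upper_est (?S (n + m)) (u \<circ> q) N (s * t)"
    if st: "upper_est (?S n) u N1 s" "upper_est (?S m) u N2 t" for s t N1 N2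
  proof -
    have s: "upper_est (?S n) u (max N1 N2) s" and t: "upper_est (?S m) u (max N1 N2) t"
      using upper_est_mono[OF st(1)] upper_est_mono[OF st(2)] by auto
    have "0 \<le> s" using upper_est_ge_one'[OF u reg st(1)] by simp
    from upper_est_family_comp[OF t s reg reg this]
    have c: "upper_est (family_comp (?S m) (?S n)) u (max N1 N2) (t * s)" .
    let ?N = "max (max M N0) (max N1 N2)"
    have "upper_est (?S (n + m)) (u \<circ> q) ?N (t * s)"
    proof (rule upper_est_blocks[OF blq c])
      show "max N1 N2 \<le> Suc (q (?N - 1))" using strict_mono_ge[OF q, of "?N - 1"] by linarith
    qed (use N0 in auto)
    then show ?thesis by (auto simp: mult.commute)
  qed
  obtain s N1 t N2 where "upper_est (?S n) u N1 s" "upper_est (?S m) u N2 t" using fin by (auto simp: finite_est_def)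
  from main[OF this] show f: "finite_est (?S (n + m)) (u \<circ> q)" by (auto simp: finite_est_def)
  let ?T = "\<lambda>n. est_const (?S n) u"
  have T1: "1 \<le> ?T n" "1 \<le> ?T m" using est_const_ge_one[OF u reg] fin by auto
  show "est_const (?S (n + m)) (u \<circ> q) \<le> ?T n * ?T m"
  proof (rule field_le_epsilon)
    fix \<epsilon> :: real assume \<epsilon>: "0 < \<epsilon>"
    define \<delta> where "\<delta> = min 1 (\<epsilon> / (?T n + ?T m + 1))"
    have s0: "0 < ?T n + ?T m + 1" using T1 by simp
    have \<delta>: "0 < \<delta>" "\<delta> \<le> 1" using \<epsilon> s0 by (simp_all add: \<delta>_def)
    have "\<delta> \<le> \<epsilon> / (?T n + ?T m + 1)" by (simp add: \<delta>_def)
    then have \<delta>3: "\<delta> * (?T n + ?T m + 1) \<le> \<epsilon>" using s0 by (simp only: pos_le_divide_eq)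
    obtain N1 where N1: "upper_est (?S n) u N1 (?T n + \<delta>)" using est_const_less[OF fin(1), of "?T n + \<delta>"] \<delta>(1) by auto
    obtain N2 where N2: "upper_est (?S m) u N2 (?T m + \<delta>)" using est_const_less[OF fin(2), of "?T m + \<delta>"] \<delta>(1) by auto
    obtain N where "upper_est (?S (n + m)) (u \<circ> q) N ((?T n + \<delta>) * (?T m + \<delta>))" using main[OF N1 N2] by blast
    then have "est_const (?S (n + m)) (u \<circ> q) \<le> (?T n + \<delta>) * (?T m + \<delta>)" by (rule est_const_le[OF sq reg])
    also have "\<dots> = ?T n * ?T m + \<delta> * (?T n + ?T m + \<delta>)" by (simp add: algebra_simps)
    also have "\<dots> \<le> ?T n * ?T m + \<delta> * (?T n + ?T m + 1)" using \<delta> by (intro add_left_mono mult_left_mono) auto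
    also have "\<dots> \<le> ?T n * ?T m + \<epsilon>" using \<delta>3 by simp
    finally show "est_const (?S (n + m)) (u \<circ> q) \<le> ?T n * ?T m + \<epsilon>" .
  qed
qed

section \<open>The critical exponent and the assembly of the estimates\<close>

context schauder_bound
begin

text \<open>Minimality of \<beta> is taken over all block sequences x together. So for b < \<beta>
  every block sequence has a further one on which all multiples of \<omega>^b are bounded by t.
  These multiples exceed all ordinals below \<omega>^\<beta>, and the constant at \<omega>^\<beta>
  is then finite, though possibly larger than t.\<close>

lemma critical_exponent:
  assumes L: "ladder_system L" and as: "asymptotic_l1 e" and nl: "\<not> contains_ell1 (UNIV :: 'a set)" and t: "0 \<le> t"
  shows "\<exists>\<beta> x. sub_block x e \<and> finite_est (schreier L (opow omega \<beta>)) x \<and>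
    (\<forall>y. sub_block y x \<longrightarrow> (\<exists>n\<ge>1. \<forall>N. \<not> upper_est (schreier L (opow omega \<beta> * ord_of_nat n)) y N t))"
proof -
  define G :: "omega1 \<Rightarrow> (nat \<Rightarrow> 'a) \<Rightarrow> bool" where "G b x \<longleftrightarrow> (\<forall>y. sub_block y x \<longrightarrow> (\<exists>n\<ge>1. \<forall>N. \<not> upper_est (schreier L (opow omega b * ord_of_nat n)) y N t))" for b x
  have e0: "sub_block e e" using blocks_self by (auto simp: sub_block_def)
  have "\<exists>b x. sub_block x e \<and> G b x"
  proof -
    \<comment> \<open>Since l_1 does not embed, t fails for some ordinal b on all block sequences; b
      may be replaced by \<omega>^b because b \<le> \<omega>^b.\<close>
    obtain b where b: "\<And>y N. sub_block y e \<Longrightarrow> \<not> upper_est (schreier L b) y N t"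
      using contains_ell1_if_uniform_est[OF L] nl by blast
    have "G b e"
      unfolding G_def
    proof (intro allI impI exI[of _ 1] conjI order_refl notI)
      fix y N assume y: "sub_block y e" and u: "upper_est (schreier L (opow omega b * ord_of_nat 1)) y N t"
      have "b \<le> opow omega b * ord_of_nat 1"
        unfolding One_nat_def mult_ord_of_nat_one using le_opow_omega by blast
      from upper_est_schreier_mono[OF L this u] obtain N' where "upper_est (schreier L b) y N' t" ..
      with b[OF y] show False by (rule notE)
    qed
    then show ?thesis using e0 by blast
  qed
  define \<beta> where "\<beta> = (LEAST b. \<exists>x. sub_block x e \<and> G b x)"
  have "\<exists>x. sub_block x e \<and> G \<beta> x" unfolding \<beta>_def by (rule LeastI_ex) fact
  then obtain x where x: "sub_block x e" "G \<beta> x" by blast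
  have below: "\<exists>y. sub_block y x' \<and> (\<exists>N. upper_est (schreier L a) y N t)"
    if a: "a < opow omega \<beta>" "\<beta> \<noteq> 0" and x': "sub_block x' x" for a x'
  proof -
    obtain b n where b: "b < \<beta>" "1 \<le> n" "a < opow omega b * ord_of_nat n" by (rule less_opow_omegaE[OF a])
    have "\<not> (\<exists>x. sub_block x e \<and> G b x)" using b(1) unfolding \<beta>_def by (rule not_less_Least)
    then obtain y N where y: "sub_block y x'" "upper_est (schreier L (opow omega b * ord_of_nat n)) y N t"
      using sub_block_trans[OF x' x(1)] b(2) unfolding G_def by blast
    from upper_est_schreier_mono[OF L less_imp_le[OF b(3)] y(2)] show ?thesis using y(1) by blast
  qed
  have "\<exists>y. sub_block y x \<and> finite_est (schreier L (opow omega \<beta>)) y"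
  proof (cases "\<beta> = 0")
    \<comment> \<open>Here \<omega>^0 = 1, and \<open>schreier1\<close> is governed by the
      asymptotic hypothesis.\<close>
    case True
    have "finite_est (schreier L 1) e"
      using upper_est_schreier1[OF as] by (auto simp: finite_est_def schreier_one)
    then have "finite_est (schreier L 1) x" by (rule finite_est_sub_block[OF x(1) regular_schreier[OF L]])
    then show ?thesis using sub_block_refl'[OF x(1)] True by (auto simp: opow_rec)
  next
    case False
    show ?thesis
    proof (cases "opow omega \<beta>" rule: omega1_cases)
      case 1
      then show ?thesis using le_opow_omega[of \<beta>] by simp
    next
      \<comment> \<open>A multiple that exceeds d is at least the successor of d, so the bound at
        that multiple applies directly.\<close>
      case (2 d)
      then have "d < opow omega \<beta>" by (simp add: less_osuc)
      then obtain b n where b: "b < \<beta>" "1 \<le> n" "d < opow omega b * ord_of_nat n" using False by (rule less_opow_omegaE)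
      have "\<not> (\<exists>x. sub_block x e \<and> G b x)" using b(1) unfolding \<beta>_def by (rule not_less_Least)
      then obtain y N where y: "sub_block y x" "upper_est (schreier L (opow omega b * ord_of_nat n)) y N t"
        using x(1) b(2) unfolding G_def by blast
      have "opow omega \<beta> \<le> opow omega b * ord_of_nat n" using b(3) 2 by (simp add: osuc_le_iff)
      from upper_est_schreier_mono[OF L this y(2)] show ?thesis using y(1) unfolding finite_est_def by blast
    next
      case 3
      show ?thesis by (rule finite_est_limit[OF L 3 x(1) t]) (rule below[OF _ False])
    qed
  qed
  then obtain y where y: "sub_block y x" "finite_est (schreier L (opow omega \<beta>)) y" by blast
  show ?thesis
  proof (intro exI[of _ \<beta>] exI[of _ y] conjI allI impI y(2) sub_block_trans[OF y(1) x(1)])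
    fix z assume "sub_block z y"
    then show "\<exists>n\<ge>1. \<forall>N. \<not> upper_est (schreier L (opow omega \<beta> * ord_of_nat n)) z N t"
      using x(2) sub_block_trans[OF _ y(1)] unfolding G_def by blast
  qed
qed

text \<open>Each passage to the subsequence q raises the multiple with finite constant by one,
  through submultiplicativity. A diagonal sequence then has finite constants for all
  multiples.\<close>

lemma finite_est_multiples:
  assumes L: "ladder_system L" and x: "sub_block x y" and fin: "finite_est (schreier L a) x"
  obtains z where "sub_block z x" "\<And>n. 1 \<le> n \<Longrightarrow> finite_est (schreier L (a * ord_of_nat n)) z"
proof -
  let ?S = "\<lambda>n. schreier L (a * ord_of_nat n)"
  note reg = regular_schreier[OF L]
  from schreier_fast_sequence[OF L, of a]
  obtain q where q: "strict_mono q"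
    "\<forall>q' n m. strict_mono q' \<longrightarrow> (\<forall>i. q i \<le> q' i) \<longrightarrow> (\<exists>N.
      (\<forall>F\<in>?S (n + m). (\<forall>i\<in>F. N \<le> i) \<longrightarrow> (\<lambda>g. Suc (q' (g - 1))) ` F \<in> family_comp (?S m) (?S n)) \<and>
      (\<forall>F\<in>family_comp (?S m) (?S n). (\<forall>i\<in>F. N \<le> i) \<longrightarrow> (\<lambda>g. Suc (q' (g - 1))) ` F \<in> ?S (n + m)))"
    by (elim exE conjE)
  define W where "W = rec_nat x (\<lambda>_ w. w \<circ> q)"
  have W: "W 0 = x" "W (Suc k) = W k \<circ> q" for k by (simp_all add: W_def)
  have Wsub: "sub_block (W k) x" for k
  proof (induction k)
    case 0
    then show ?case using sub_block_refl'[OF x] W by simp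
  next
    case (Suc k)
    show ?case unfolding W(2) by (rule sub_block_trans[OF sub_block_subseq[OF Suc q(1)] Suc])
  qed
  have WS: "sub_block (W (Suc k)) (W k)" for k
    unfolding W(2) by (rule sub_block_subseq[OF Wsub q(1)])
  have fin1: "finite_est (?S 1) (W k)" for k
    unfolding One_nat_def mult_ord_of_nat_one by (rule finite_est_sub_block[OF Wsub reg fin])
  have finW: "finite_est (?S (Suc k)) (W k)" for k
  proof (induction k)
    case 0
    then show ?case using fin1[of 0] by simp
  next
    case (Suc k)
    obtain N0 where "\<forall>F\<in>?S (Suc k + 1). (\<forall>i\<in>F. N0 \<le> i) \<longrightarrow> (\<lambda>g. Suc (q (g - 1))) ` F \<in> family_comp (?S 1) (?S (Suc k))"
      using q(2)[rule_format, OF q(1) order_refl, of "Suc k" 1] by blast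
    from est_const_add_le(1)[OF L Wsub q(1) Suc fin1 this]
    show ?case unfolding W(2) by (simp only: Suc_eq_plus1)
  qed
  obtain z where z: "\<And>j. sub_block z (W j)" using sub_block_diagonal[of W] WS by blast
  show ?thesis
  proof (rule that)
    show "sub_block z x" using z[of 0] by (simp add: W)
    fix n :: nat assume "1 \<le> n"
    then obtain k where "n = Suc k" by (cases n) auto
    then show "finite_est (?S n) z" using finite_est_sub_block[OF z reg finW[of k]] by simp
  qed
qed

text \<open>In the proof \<open>u\<close> carries the stabilised constants \<open>T n\<close>, \<open>w\<close> is a subsequence of \<open>u\<close> so sparse that
  composed Schreier families may be replaced by sums of ordinals, and \<open>Z n\<close> is the \<open>n\<close>-th of the
  successive block sequences of \<open>w\<close> obtained from bounded distortion.\<close>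

lemma geometric_estimates:
  assumes L: "ladder_system L" and as: "asymptotic_l1 e" and nl: "\<not> contains_ell1 (UNIV :: 'a set)"
    and bd: "bounded_distortion (UNIV :: 'a set) D"
  shows "\<exists>w p \<beta> l v A M. blocks w e p 1 \<and> 1 < l \<and> sub_block v w \<and>
    (\<forall>n\<ge>1. 0 < A n \<and> A n \<le> l ^ n \<and> l ^ n \<le> 2 * D * A n \<and>
      sums_comparable p (schreier L (opow omega \<beta> * ord_of_nat n)) (span (v ` {M n..})) D (A n))"
proof -
  have D1: "1 \<le> D" by (rule bounded_distortion_ge_one[OF bd])
  note reg = regular_schreier[OF L]
  have "0 \<le> 3 * D" using D1 by simp
  from critical_exponent[OF L as nl this]
  obtain \<beta> x where x: "sub_block x e" "finite_est (schreier L (opow omega \<beta>)) x"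
    "\<forall>y. sub_block y x \<longrightarrow> (\<exists>n\<ge>1. \<forall>N. \<not> upper_est (schreier L (opow omega \<beta> * ord_of_nat n)) y N (3 * D))"
    by (elim exE conjE)
  define S where "S n = schreier L (opow omega \<beta> * ord_of_nat n)" for n
  have regS: "regular (S n)" for n unfolding S_def by (rule reg)
  obtain y where y: "sub_block y x" "\<And>n. 1 \<le> n \<Longrightarrow> finite_est (S n) y"
    using finite_est_multiples[OF L x(1,2)] unfolding S_def by blast
  have "\<exists>u. sub_block u y \<and> (\<forall>n v. sub_block v u \<longrightarrow> est_const (S (Suc n)) v = est_const (S (Suc n)) u)"
  proof (rule sub_block_stabilise[OF y(1), of "\<lambda>n v. est_const (S (Suc n)) v"])
    show "est_const (S (Suc n)) v \<le> est_const (S (Suc n)) v'" if "sub_block v v'" "sub_block v' y" for n v v'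
      by (rule est_const_sub_block[OF that(1) regS finite_est_sub_block[OF that(2) regS y(2)]]) simp
    show "0 \<le> est_const (S (Suc n)) v" if "sub_block v y" for n v
      using est_const_ge_one[OF that regS finite_est_sub_block[OF that regS y(2)], of "Suc n"] by simp
  qed
  then obtain u where u: "sub_block u y" "\<And>n v. sub_block v u \<Longrightarrow> est_const (S (Suc n)) v = est_const (S (Suc n)) u"
    by blast
  have ue: "sub_block u e" using u(1) y(1) x(1) sub_block_trans by blast
  define T where "T n = est_const (S n) u" for n
  have stab: "est_const (S n) v = T n" if "1 \<le> n" "sub_block v u" for n v
    using u(2)[OF that(2), of "n - 1"] that(1) by (simp add: T_def)
  have finu: "finite_est (S n) v" if "1 \<le> n" "sub_block v u" for n v
    by (rule finite_est_sub_block[OF sub_block_trans[OF that(2) u(1)] regS y(2)[OF that(1)]])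
  have uu: "sub_block u u" by (rule sub_block_refl'[OF ue])
  have T1: "1 \<le> T n" if "1 \<le> n" for n
    unfolding T_def by (rule est_const_ge_one[OF ue regS finu[OF that uu]])
  from schreier_fast_sequence[OF L, of "opow omega \<beta>", folded S_def]
  obtain q0 where q0: "strict_mono q0"
    "\<forall>q' n m. strict_mono q' \<longrightarrow> (\<forall>i. q0 i \<le> q' i) \<longrightarrow> (\<exists>N.
      (\<forall>F\<in>S (n + m). (\<forall>i\<in>F. N \<le> i) \<longrightarrow> (\<lambda>g. Suc (q' (g - 1))) ` F \<in> family_comp (S m) (S n)) \<and>
      (\<forall>F\<in>family_comp (S m) (S n). (\<forall>i\<in>F. N \<le> i) \<longrightarrow> (\<lambda>g. Suc (q' (g - 1))) ` F \<in> S (n + m)))"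
    by (elim exE conjE)
  obtain pu Nu where blu: "blocks u e pu Nu" using ue by (auto simp: sub_block_def)
  \<comment> \<open>The shift by Nu makes w a block basis of e from index 1 on, and q stays above
    q0.\<close>
  define q where "q i = q0 (i + Nu)" for i
  have qs: "strict_mono q" using q0(1) by (simp add: q_def strict_mono_def)
  have q_ge: "q0 i \<le> q i" for i using strict_mono_less_eq[OF q0(1)] by (simp add: q_def)
  note qc = q0(2)[rule_format, OF qs q_ge]
  have "Nu \<le> q 1" using strict_mono_ge[OF q0(1), of "1 + Nu"] by (simp add: q_def)
  define w where "w = u \<circ> q"
  define p where "p = pu \<circ> q"
  have blw: "blocks w e p 1" unfolding w_def p_def by (rule blocks_subseq_tail[OF blu qs]) fact
  have wu: "sub_block w u" unfolding w_def by (rule sub_block_subseq[OF ue qs])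
  have blwu: "blocks w u q 1"
    unfolding w_def by (rule blocks_subseq[OF qs order_refl])
      (use blocksD(3)[OF blw] in \<open>simp add: w_def\<close>)
  have Tsub: "T (n + m) \<le> T n * T m" if nm: "1 \<le> n" "1 \<le> m" for n m
  proof -
    obtain N0 where "\<forall>F\<in>S (n + m). (\<forall>i\<in>F. N0 \<le> i) \<longrightarrow> (\<lambda>g. Suc (q (g - 1))) ` F \<in> family_comp (S m) (S n)"
      using qc[of n m] by blast
    from est_const_add_le(2)[OF L ue qs finu[OF nm(1) uu, unfolded S_def] finu[OF nm(2) uu, unfolded S_def] this[unfolded S_def]]
    show ?thesis using stab[of "n + m" w] wu nm by (simp add: T_def S_def w_def)
  qed
  define est where "est n v A M \<longleftrightarrow> sums_comparable p (S n) (span (v ` {M..})) D A"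
    for n A M and v :: "nat \<Rightarrow> 'a"
  have "\<exists>Z. \<forall>k. sub_block (Z k) w \<and> (sub_block (Z (Suc k)) (Z k) \<and> (\<exists>A M. 0 < A \<and> est (Suc k) (Z (Suc k)) A M))"
  proof (rule dependent_nat_choice)
    show "\<exists>z. sub_block z w" using sub_block_refl'[OF wu] by blast
    fix z k assume z: "sub_block z w"
    obtain N t where t: "upper_est (S (Suc k)) w N t" using finu[OF _ wu, of "Suc k"] by (auto simp: finite_est_def)
    \<comment> \<open>The new sequence is found below z, but its admissible sums still refer to w;
      all A n thus belong to the same restrictions.\<close>
    obtain v M A where "sub_block v z" "0 < A" "est (Suc k) v A M"
      unfolding est_def by (rule distorted_block[OF bd blw regS t z])
    then show "\<exists>z'. sub_block z' w \<and> sub_block z' z \<and> (\<exists>A M. 0 < A \<and> est (Suc k) z' A M)"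
      using sub_block_trans[OF _ z] by blast
  qed
  then obtain Z where Z: "\<And>k. sub_block (Z k) w" "\<And>k. sub_block (Z (Suc k)) (Z k)"
    "\<And>k. \<exists>A M. 0 < A \<and> est (Suc k) (Z (Suc k)) A M" by blast
  have "\<forall>n. \<exists>A M. 1 \<le> n \<longrightarrow> 0 < A \<and> est n (Z n) A M"
  proof
    fix n
    show "\<exists>A M. 1 \<le> n \<longrightarrow> 0 < A \<and> est n (Z n) A M" using Z(3)[of "n - 1"] by (cases n) auto
  qed
  then obtain A M where AM: "\<And>n. 1 \<le> n \<Longrightarrow> 0 < A n" "\<And>n. 1 \<le> n \<Longrightarrow> est n (Z n) (A n) (M n)" by metis
  have Zu: "sub_block (Z n) u" for n by (rule sub_block_trans[OF Z(1) wu])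
  have TA: "T n \<le> (2 * D) * A n" if n: "1 \<le> n" for n
  proof -
    obtain pv Nv where blv: "blocks (Z n) w pv Nv" using Z(1)[of n] by (auto simp: sub_block_def)
    have "upper_est (S n) (Z n) (max (M n) (max Nv 1)) (2 * D * A n)"
      by (rule upper_est_from_Q[OF blw regS blv sums_comparableD(1)[OF AM(2)[OF n, unfolded est_def]]])
    then have "est_const (S n) (Z n) \<le> 2 * D * A n" by (rule est_const_le[OF Z(1) regS])
    then show ?thesis using stab[OF n Zu] by simp
  qed
  have AT: "A n * T m \<le> T (n + m)" if nm: "1 \<le> n" "1 \<le> m" for n m
  proof -
    obtain pv Nv where blv: "blocks (Z n) w pv Nv" using Z(1)[of n] by (auto simp: sub_block_def)
    obtain N0 where N0: "\<forall>F\<in>family_comp (S m) (S n). (\<forall>i\<in>F. N0 \<le> i) \<longrightarrow> (\<lambda>g. Suc (q (g - 1))) ` F \<in> S (n + m)"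
      using qc[of n m] by blast
    \<comment> \<open>Taking A' below A n and t above T (n + m) avoids bounds that need not be
      attained; both are removed afterwards by density.\<close>
    have key: "A' * T m \<le> t" if A': "0 < A'" "A' < A n" and t: "T (n + m) < t" for A' t
    proof -
      have "1 \<le> n + m" using nm by simp
      obtain N where N: "upper_est (S (n + m)) u N t"
        using est_const_less[OF finu[OF \<open>1 \<le> n + m\<close> uu], of t] t by (auto simp: T_def)
      let ?N = "max 1 (max N N0)"
      have "upper_est (family_comp (S m) (S n)) w ?N t"
      proof (rule upper_est_blocks[OF blwu N])
        show "N \<le> Suc (q (?N - 1))" using strict_mono_ge[OF qs, of "?N - 1"] by linarith
      qed (use N0 in auto)
      then have "\<exists>M'. upper_est (S m) (Z n) M' (t / A')"
        by (rule upper_est_from_lower[OF blw regS regS blv _ A'(1), where M = "M n"])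
           (rule sums_comparableD(2)[OF AM(2)[OF nm(1), unfolded est_def] _ A'(2)])
      then have "est_const (S m) (Z n) \<le> t / A'" using est_const_le[OF Z(1) regS] by blast
      then show ?thesis using stab[OF nm(2) Zu] A'(1) by (simp add: field_simps)
    qed
    have "A' * T m \<le> T (n + m)" if "0 < A'" "A' < A n" for A'
      by (rule dense_ge) (rule key[OF that])
    then have "A' \<le> T (n + m) / T m" if "0 < A'" "A' < A n" for A'
      using that T1[OF nm(2)] by (simp add: field_simps)
    then have "A n \<le> T (n + m) / T m" by (rule dense_le_bounded[OF AM(1)[OF nm(1)]])
    then show ?thesis using T1[OF nm(2)] by (simp add: field_simps)
  qed
  have "sub_block u x" by (rule sub_block_trans[OF u(1) y(1)])
  then obtain n0 where n0: "1 \<le> n0" "\<And>N. \<not> upper_est (S n0) u N (3 * D)" using x(3) unfolding S_def by blast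
  \<comment> \<open>The failure of every estimate with constant 3 D bounds the infimum T n0 only
    weakly, but as D is positive this is still strictly above the threshold 2 D of the growth
    lemma.\<close>
  have "3 * D \<le> T n0"
  proof (rule ccontr)
    assume "\<not> ?thesis"
    then obtain N where "upper_est (S n0) u N (3 * D)" using est_const_less[OF finu[OF n0(1) uu], of "3 * D"] by (auto simp: T_def)
    then show False using n0(2) by blast
  qed
  then have TD: "2 * D < T n0" using D1 by simp
  have "0 < 2 * D" using D1 by simp
  obtain l where l: "1 < l" "\<And>n. 1 \<le> n \<Longrightarrow> A n \<le> l ^ n" "\<And>n. 1 \<le> n \<Longrightarrow> l ^ n \<le> 2 * D * A n"
    using submultiplicative_rate[of T A "2 * D" n0] T1 AM(1) Tsub AT TA \<open>0 < 2 * D\<close> n0(1) TD by blast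
  obtain v where v: "\<And>j. sub_block v (Z j)" using sub_block_diagonal[of Z] Z(2) by blast
  have "\<exists>M'. span (v ` {M'..}) \<subseteq> span (Z n ` {M n..})" for n
  proof -
    obtain pv Nv where blv: "blocks v (Z n) pv Nv" using v[of n] by (auto simp: sub_block_def)
    have "v i \<in> span (Z n ` {M n..})" if i: "max (max Nv 1) (M n) \<le> i" for i
    proof -
      have "i - 1 \<le> pv (i - 1)" by (rule strict_mono_ge[OF blocksD(1)[OF blv]])
      then have "{pv (i - 1)<..pv i} \<subseteq> {M n..}" using i by auto
      then have "span (Z n ` {pv (i - 1)<..pv i}) \<subseteq> span (Z n ` {M n..})" by (intro span_mono image_mono)
      then show ?thesis using blocksD(4)[OF blv, of i] i by auto
    qed
    then have "v ` {max (max Nv 1) (M n)..} \<subseteq> span (Z n ` {M n..})" by auto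
    then show ?thesis by (meson span_minimal subspace_span)
  qed
  then obtain M' where M': "\<And>n. span (v ` {M' n..}) \<subseteq> span (Z n ` {M n..})" by metis
  show ?thesis
  proof (intro exI conjI allI impI)
    show "blocks w e p 1" "1 < l" "sub_block v w" by (fact blw l(1) sub_block_trans[OF v Z(1)])+
    fix n :: nat assume n: "1 \<le> n"
    show "0 < A n" "A n \<le> l ^ n" "l ^ n \<le> 2 * D * A n" using AM(1) l(2,3) n by blast+
    show "sums_comparable p (schreier L (opow omega \<beta> * ord_of_nat n)) (span (v ` {M' n..})) D (A n)"
      using sums_comparable_subset[OF AM(2)[OF n, unfolded est_def] M'] unfolding S_def .
  qed
qed

text \<open>For a fixed system the upper bound passes to limits. In the lower bound the system
  depends on the vector, so it is taken from a nearby y in V and the error is absorbed by the upper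
  bound. This halves A, the loss that turns 2 D into 4 D.\<close>

lemma admissible_sums_on_closure:
  assumes reg: "regular \<F>" and D1: "1 \<le> D" and A: "0 < A"
    and comp: "sums_comparable p \<F> V D A"
    and V: "subspace V" and x: "x \<in> closure V"
  shows "interval_system \<F> G r \<Longrightarrow> (\<Sum>g\<in>G. norm (Q p g (r g) x)) \<le> 2 * D * A * norm x"
    and "\<exists>G r. interval_system \<F> G r \<and> A / 2 * norm x \<le> (\<Sum>g\<in>G. norm (Q p g (r g) x))"
proof -
  have up': "(\<Sum>g\<in>G. norm (Q p g (r g) z)) \<le> 2 * D * A * norm z"
    if z: "z \<in> closure V" and isys: "interval_system \<F> G r" for z G r
  proof -
    obtain f where f: "\<And>k. f k \<in> V" "f \<longlonglongrightarrow> z" using z by (auto simp: closure_sequential)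
    have "(\<lambda>k. \<Sum>g\<in>G. norm (Q p g (r g) (f k))) \<longlonglongrightarrow> (\<Sum>g\<in>G. norm (Q p g (r g) z))"
      by (intro tendsto_sum tendsto_norm bounded_linear.tendsto[OF bounded_linear_Q f(2)])
    moreover have "(\<lambda>k. 2 * D * A * norm (f k)) \<longlonglongrightarrow> 2 * D * A * norm z"
      by (intro tendsto_mult tendsto_const tendsto_norm f(2))
    ultimately show ?thesis by (rule LIMSEQ_le) (use sums_comparableD(1)[OF comp f(1) isys] in blast)
  qed
  then show "interval_system \<F> G r \<Longrightarrow> (\<Sum>g\<in>G. norm (Q p g (r g) x)) \<le> 2 * D * A * norm x" using x by blast
  show "\<exists>G r. interval_system \<F> G r \<and> A / 2 * norm x \<le> (\<Sum>g\<in>G. norm (Q p g (r g) x))"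
  proof (cases "x = 0")
    case True
    have "interval_system \<F> {} (\<lambda>_. 0)" using regularD(6)[OF reg] by (simp add: interval_system_def)
    then show ?thesis using True by (intro exI[of _ "{}"] exI[of _ "\<lambda>_. 0"]) simp
  next
    case False
    define b where "b = norm x"
    have b: "0 < b" using False by (simp add: b_def)
    \<comment> \<open>With this \<delta> the error to be absorbed is at most A / 5 times norm x, and
      81/100 minus 1/5 still exceeds 1/2.\<close>
    define \<delta> where "\<delta> = 1 / (10 * D)"
    have \<delta>: "0 < \<delta>" "\<delta> \<le> 1/10" "D * \<delta> = 1/10" using D1 by (simp_all add: \<delta>_def divide_le_eq)
    have "0 < \<delta> * b" using \<delta> b by simp
    then obtain y where y: "y \<in> V" "norm (x - y) < \<delta> * b"
      using x unfolding closure_approachable dist_norm by (metis norm_minus_commute)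
    have "9/10 * A < A" using A by simp
    then obtain G r where G: "interval_system \<F> G r" "9/10 * A * norm y \<le> (\<Sum>g\<in>G. norm (Q p g (r g) y))"
      using sums_comparableD(2)[OF comp y(1)] by blast
    have "x - y \<in> closure V" using subspace_diff[OF subspace_closure[OF V] x] closure_subset y(1) by blast
    then have 1: "(\<Sum>g\<in>G. norm (Q p g (r g) (x - y))) \<le> 2 * D * A * norm (x - y)" using up' G(1) by blast
    have 2: "(\<Sum>g\<in>G. norm (Q p g (r g) y)) \<le> (\<Sum>g\<in>G. norm (Q p g (r g) x)) + (\<Sum>g\<in>G. norm (Q p g (r g) (x - y)))"
      unfolding sum.distrib[symmetric]
    proof (rule sum_mono)
      fix g
      show "norm (Q p g (r g) y) \<le> norm (Q p g (r g) x) + norm (Q p g (r g) (x - y))"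
        using norm_triangle_ineq4[of "Q p g (r g) x" "Q p g (r g) (x - y)"] by (simp add: Q_diff)
    qed
    have 3: "2 * D * A * norm (x - y) \<le> 2/10 * A * b"
    proof -
      have "2 * D * A * norm (x - y) \<le> 2 * D * A * (\<delta> * b)" using y(2) D1 A by (intro mult_left_mono) auto
      also have "\<dots> = 2 * (D * \<delta>) * A * b" by simp
      finally show ?thesis by (simp add: \<delta>(3))
    qed
    have "norm (x - y) \<le> 1/10 * b" using y(2) mult_right_mono[OF \<delta>(2), of b] b by linarith
    then have "9/10 * b \<le> norm y" using norm_triangle_ineq2[of x y] by (simp add: b_def)
    then have 4: "9/10 * A * (9/10 * b) \<le> 9/10 * A * norm y" using A by (intro mult_left_mono) auto
    have "A / 2 * b \<le> 9/10 * A * (9/10 * b) - 2/10 * A * b" using mult_nonneg_nonneg[of A b] A b by simp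
    then have "A / 2 * b \<le> (\<Sum>g\<in>G. norm (Q p g (r g) x))" using 1 2 3 4 G(2) by linarith
    then show ?thesis using G(1) unfolding b_def by blast
  qed
qed

end

theorem theorem6p10:
  fixes L :: "omega1 \<Rightarrow> nat \<Rightarrow> omega1"
    and e :: "nat \<Rightarrow> 'a::banach"
    and D :: real
  assumes "ladder_system L"
    and "schauder_basis e"
    and "asymptotic_l1 e"
    and "bounded_distortion (UNIV :: 'a set) D"
    and "\<not> contains_ell1 (UNIV :: 'a set)"
  shows "\<exists>(w :: nat \<Rightarrow> 'a) (\<alpha> :: omega1) (\<beta>\<^sub>0 :: omega1) (\<theta> :: real) (z :: nat \<Rightarrow> 'a).
    block_basis_of w e \<and> \<alpha> = opow omega \<beta>\<^sub>0 \<and> 0 < \<theta> \<and> \<theta> < 1 \<and> block_basis_of z w \<and>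
    (\<forall>k\<ge>1. \<forall>x\<in>clspan_from z k.
       ereal (1 / (4 * D)) *
         (SUP n\<in>{1..k}. SUP Es\<in>{Es. admissible L (\<alpha> * ord_of_nat n) Es}.
            ereal (\<theta> ^ n * (\<Sum>E\<leftarrow>Es. norm (restr_wrt w E x))))
         \<le> ereal (norm x) \<and>
       ereal (norm x) \<le> ereal (4 * D) *
         (INF n\<in>{1..k}. SUP Es\<in>{Es. admissible L (\<alpha> * ord_of_nat n) Es}.
            ereal (\<theta> ^ n * (\<Sum>E\<leftarrow>Es. norm (restr_wrt w E x)))))"
proof -
  note L = assms(1)
  interpret schauder e by unfold_locales (rule assms(2))
  obtain K where "1 \<le> K" "\<And>n x. norm (P n x) \<le> K * norm x" using P_bounded by blast
  then interpret schauder_bound e K by unfold_locales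
  have D1: "1 \<le> D" by (rule bounded_distortion_ge_one[OF assms(4)])
  from geometric_estimates[OF L assms(3,5,4)]
  obtain w p \<beta> l v A M where w: "blocks w e p 1" and l: "1 < l" and v: "sub_block v w"
    and A: "\<forall>n\<ge>1. 0 < A n \<and> A n \<le> l ^ n \<and> l ^ n \<le> 2 * D * A n \<and>
      sums_comparable p (schreier L (opow omega \<beta> * ord_of_nat n)) (span (v ` {M n..})) D (A n)"
    by (elim exE conjE)
  obtain pv Nv where blv: "blocks v w pv Nv" using v by (auto simp: sub_block_def)
  \<comment> \<open>The vectors z i with i \<ge> k lie in the tails of v on which the estimates for
    all n \<le> k hold. The range of n in the conclusion originates here.\<close>
  define q where "q k = k + Nv + (\<Sum>n\<le>k. M n)" for k
  have qs: "strict_mono q" by (rule strict_monoI_Suc) (simp add: q_def)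
  have qM: "M n \<le> q k" if "n \<le> k" for n k using member_le_sum[of n "{..k}" M] that by (simp add: q_def)
  define z where "z = v \<circ> q"
  have blz: "blocks z w (pv \<circ> q) 1"
    unfolding z_def by (rule blocks_subseq_tail[OF blv qs]) (simp add: q_def)
  define \<theta> where "\<theta> = 1 / l"
  have \<theta>: "0 < \<theta>" "\<theta> < 1" using l by (simp_all add: \<theta>_def)
  let ?\<alpha> = "opow omega \<beta>"
  let ?N = "\<lambda>n x Es. \<theta> ^ n * (\<Sum>E\<leftarrow>Es. norm (restr_wrt w E x))"
  have est: "(\<forall>Es. admissible L (?\<alpha> * ord_of_nat n) Es \<longrightarrow> ?N n x Es \<le> 4 * D * norm x) \<and>
      (\<exists>Es. admissible L (?\<alpha> * ord_of_nat n) Es \<and> norm x \<le> 4 * D * ?N n x Es)"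
    if k: "x \<in> clspan_from z k" and n: "1 \<le> n" "n \<le> k" for x k n
  proof -
    let ?V = "span (v ` {M n..})"
    have "z ` {k..} \<subseteq> v ` {M n..}"
    proof (rule image_subsetI)
      fix i assume "i \<in> {k..}"
      then have "M n \<le> q i" using qM[of n i] n by simp
      then show "z i \<in> v ` {M n..}" by (simp add: z_def)
    qed
    then have xV: "x \<in> closure ?V" using k closure_mono[OF span_mono] unfolding clspan_from_def by blast
    have "z ` {k..} \<subseteq> span (w ` {1..})"
    proof (rule image_subsetI)
      fix i assume "i \<in> {k..}"
      then have "z i \<in> span (w ` {(pv \<circ> q) (i - 1)<..(pv \<circ> q) i})" using n by (intro blocksD(4)[OF blz]) simp
      moreover have "span (w ` {(pv \<circ> q) (i - 1)<..(pv \<circ> q) i}) \<subseteq> span (w ` {1..})"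
        by (intro span_mono image_mono) auto
      ultimately show "z i \<in> span (w ` {1..})" by blast
    qed
    then have "span (z ` {k..}) \<subseteq> span (w ` {1..})" by (simp add: span_minimal)
    then have xw: "x \<in> clspan_from w 1" using k closure_mono unfolding clspan_from_def by blast
    have R: "restr_wrt w {g..h} x = Q p g h x" if "1 \<le> g" "g \<le> h" for g h
      by (rule restr_wrt_block[OF w xw that])
    note reg = regular_schreier[OF L]
    have An: "0 < A n" "A n \<le> l ^ n" "l ^ n \<le> 2 * D * A n"
      and comp: "sums_comparable p (schreier L (?\<alpha> * ord_of_nat n)) ?V D (A n)" using A n(1) by blast+
    note C = admissible_sums_on_closure[OF reg D1 An(1) comp subspace_span xV]
    have l0: "0 < l ^ n" "\<theta> ^ n = 1 / l ^ n" using l by (simp_all add: \<theta>_def power_one_over)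
    show ?thesis
    proof (intro conjI allI impI)
      fix Es assume Es: "admissible L (?\<alpha> * ord_of_nat n) Es"
      obtain r where r: "interval_system (schreier L (?\<alpha> * ord_of_nat n)) (Min ` set Es) r" "\<forall>g\<in>Min ` set Es. 1 \<le> g"
        "\<forall>f :: nat set \<Rightarrow> real. (\<Sum>E\<leftarrow>Es. f E) = (\<Sum>g\<in>Min ` set Es. f {g..r g})"
        by (rule successive_interval_system[OF Es])
      have "(\<Sum>E\<leftarrow>Es. norm (restr_wrt w E x)) = (\<Sum>g\<in>Min ` set Es. norm (restr_wrt w {g..r g} x))"
        using r(3) by blast
      also have "\<dots> = (\<Sum>g\<in>Min ` set Es. norm (Q p g (r g) x))"
      proof (rule sum.cong[OF refl])
        fix g assume g: "g \<in> Min ` set Es"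
        show "norm (restr_wrt w {g..r g} x) = norm (Q p g (r g) x)"
          using R[OF bspec[OF r(2) g] interval_systemD(2)[OF r(1) g]] by simp
      qed
      also have "\<dots> \<le> 2 * D * A n * norm x" by (rule C(1)[OF r(1)])
      also have "\<dots> \<le> 2 * D * l ^ n * norm x"
        using An(2) D1 by (intro mult_right_mono mult_left_mono) auto
      finally have "?N n x Es \<le> 2 * D * norm x" using l0 by (simp add: field_simps)
      also have "\<dots> \<le> 4 * D * norm x" using D1 by (intro mult_right_mono) auto
      finally show "?N n x Es \<le> 4 * D * norm x" .
    next
      obtain G r where G: "interval_system (schreier L (?\<alpha> * ord_of_nat n)) G r"
        "A n / 2 * norm x \<le> (\<Sum>g\<in>G. norm (Q p g (r g) x))" using C(2) by blast
      obtain Es where Es: "admissible L (?\<alpha> * ord_of_nat n) Es"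
        "\<forall>f :: nat set \<Rightarrow> real. (\<Sum>E\<leftarrow>Es. f E) = (\<Sum>g\<in>G. f {g..r g})"
        using interval_system_admissible[OF L G(1)] by blast
      have g1: "1 \<le> g" if "g \<in> G" for g
        using regularD(4)[OF reg interval_systemD(1)[OF G(1)]] that by (metis One_nat_def Suc_leI gr0I)
      have "(\<Sum>E\<leftarrow>Es. norm (restr_wrt w E x)) = (\<Sum>g\<in>G. norm (restr_wrt w {g..r g} x))"
        using Es(2) by blast
      also have "\<dots> = (\<Sum>g\<in>G. norm (Q p g (r g) x))"
        by (rule sum.cong[OF refl]) (use g1 interval_systemD(2)[OF G(1)] R in simp)
      finally have s: "A n / 2 * norm x \<le> (\<Sum>E\<leftarrow>Es. norm (restr_wrt w E x))" using G(2) by simp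
      \<comment> \<open>Both losses meet here: 2 D from comparing l^n with A n, and 2 from the
        halved lower bound on the closed span.\<close>
      have "l ^ n * norm x \<le> 2 * D * A n * norm x" using An(3) by (intro mult_right_mono) auto
      also have "\<dots> = 4 * D * (A n / 2 * norm x)" by simp
      also have "\<dots> \<le> 4 * D * (\<Sum>E\<leftarrow>Es. norm (restr_wrt w E x))" using s D1 by (intro mult_left_mono) auto
      finally have "norm x \<le> 4 * D * ?N n x Es" using l0 by (simp add: field_simps)
      then show "\<exists>Es. admissible L (?\<alpha> * ord_of_nat n) Es \<and> norm x \<le> 4 * D * ?N n x Es" using Es(1) by blast
    qed
  qed
  show ?thesis
  proof (rule exI[of _ w], rule exI[of _ ?\<alpha>], rule exI[of _ \<beta>], rule exI[of _ \<theta>], rule exI[of _ z],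
      intro conjI allI impI ballI \<theta> refl)
    show "block_basis_of w e" "block_basis_of z w" using w blz by (auto simp: block_basis_of_iff)
    fix k :: nat and x assume k: "1 \<le> k" and x: "x \<in> clspan_from z k"
    let ?A = "\<lambda>n. {Es. admissible L (?\<alpha> * ord_of_nat n) Es}"
    have "(SUP n\<in>{1..k}. SUP Es\<in>?A n. ereal (?N n x Es)) \<le> ereal (4 * D * norm x)"
      using est[OF x] by (intro SUP_least) simp
    then have "ereal (1 / (4 * D)) * (SUP n\<in>{1..k}. SUP Es\<in>?A n. ereal (?N n x Es))
        \<le> ereal (1 / (4 * D)) * ereal (4 * D * norm x)"
      using D1 by (intro ereal_mult_left_mono) auto
    also have "\<dots> = ereal (norm x)" using D1 by simp
    finally show "ereal (1 / (4 * D)) * (SUP n\<in>{1..k}. SUP Es\<in>?A n. ereal (?N n x Es)) \<le> ereal (norm x)" .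
    have "ereal (norm x / (4 * D)) \<le> (INF n\<in>{1..k}. SUP Es\<in>?A n. ereal (?N n x Es))"
    proof (rule INF_greatest)
      fix n assume n: "n \<in> {1..k}"
      then obtain Es where Es: "admissible L (?\<alpha> * ord_of_nat n) Es" "norm x \<le> 4 * D * ?N n x Es"
        using est[OF x, of n] by auto
      have "ereal (norm x / (4 * D)) \<le> ereal (?N n x Es)" using Es(2) D1 by (simp add: divide_le_eq mult.commute)
      also have "\<dots> \<le> (SUP Es\<in>?A n. ereal (?N n x Es))" using Es(1) by (intro SUP_upper) simp
      finally show "ereal (norm x / (4 * D)) \<le> (SUP Es\<in>?A n. ereal (?N n x Es))" .
    qed
    then have "ereal (4 * D) * ereal (norm x / (4 * D)) \<le> ereal (4 * D) * (INF n\<in>{1..k}. SUP Es\<in>?A n. ereal (?N n x Es))"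
      using D1 by (intro ereal_mult_left_mono) auto
    moreover have "ereal (4 * D) * ereal (norm x / (4 * D)) = ereal (norm x)" using D1 by simp
    ultimately show "ereal (norm x) \<le> ereal (4 * D) * (INF n\<in>{1..k}. SUP Es\<in>?A n. ereal (?N n x Es))" by simp
  qed
qed

end
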